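(* (a) Let $L$ be a regular Lagrangian on $\widetilde{TM}$ with canonical N-connection ${}^{L}N^i_j$ and adapted frame $(e_i,v_i)$ and coframe $(e^i,v^i)$. The N-connection induces an almost complex structure $\mathbf F$ on $\widetilde{TM}$, acting on vector fields by $\mathbf F(e_i)=-v_i$ and $\mathbf F(v_i)=e_i$, i.e. $$\mathbf F=-v_i\otimes e^i+e_i\otimes v^i,$$ which satisfies $\mathbf F\circ\mathbf F=-\mathbf I$. (b) Let $l$ be a regular Lagrangian on a Lie algebroid $E$ with canonical N-connection ${}^{l}N^a_b$ on $\mathcal L^{\pi}E$ and adapted basis $(\mathbf z_a,\mathbf v_a)$ with dual basis $(\mathbf z^a,\mathbf v^a)$. The N-connection induces an almost complex structure ${}^{\circ}\mathbf F$ on $\mathcal L^\pi E$, acting on sections by ${}^{\circ}\mathbf F(\mathbf z_a)=-\mathbf v_a$ and ${}^{\circ}\mathbf F(\mathbf v_a)=\mathbf z_a$, i.e. $${}^{\circ}\mathbf F=-\mathbf v_a\otimes\mathbf z^a+\mathbf z_a\otimes\mathbf v^a,$$ which satisfies ${}^{\circ}\mathbf F\circ{}^{\circ}\mathbf F=-\mathbf I$.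
   Context: Summation over repeated indices. Part (a). $M$ is an $n$-manifold, $\widetilde{TM}$ is $TM$ without the zero section, with coordinates $(x^i,y^i)$ induced from $M$. $L$ is regular: ${}^{L}g_{ij}=\frac12\frac{\partial^2L}{\partial y^i\partial y^j}$ is nondegenerate of constant signature, with inverse ${}^{L}g^{ij}$. $2\,{}^{L}G^i=\frac12{}^{L}g^{ij}\big(\frac{\partial^2L}{\partial y^j\partial x^k}y^k-\frac{\partial L}{\partial x^j}\big)$, ${}^{L}N^i_j=\partial\,{}^{L}G^i/\partial y^j$, $e_i=\frac{\partial}{\partial x^i}-{}^{L}N^j_i\frac{\partial}{\partial y^j}$, $v_i=\frac{\partial}{\partial y^i}$, $e^i=dx^i$, $v^i=dy^i+{}^{L}N^i_jdx^j$. Part (b). $\pi:E\to M$ is a rank $m$ vector bundle with Lie algebroid structure $([\cdot,\cdot],\rho)$; in a chart with local basis $v_a$ of sections of $E$ (fibre coordinates $u^a$), $\rho(v_a)=\rho^i_a(x)\partial/\partial x^i$, $[v_a,v_b]=C^c_{ab}(x)v_c$. The prolongation is $\mathcal L^{\pi}E=\{(b,z)\in E\times TE:\rho(b)=T\pi(z)\}$, a rank $2m$ vector bundle over $E$ via $(b,z)\mapsto\tau_E(z)$ ($\tau_E:TE\to E$ the tangent projection), with anchor $(b,z)\mapsto z$ and a local basis $(\widetilde z_a,\widetilde v_a)$ of sections with anchors $\rho_a^i\partial/\partial x^i$ and $\partial/\partial u^a$ and brackets $[\widetilde z_a,\widetilde z_b]=C_{ab}^e\widetilde z_e$, $[\widetilde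 z_a,\widetilde v_b]=0$, $[\widetilde v_a,\widetilde v_b]=0$. $l$ is regular: ${}^{l}g_{ab}=\frac12\frac{\partial^2l}{\partial u^a\partial u^b}$ is nondegenerate of constant signature off the zero section (everything is considered there), with inverse ${}^{l}g^{ab}$. In the chart with the fixed basis $v_a$: $2\,{}^{l}G^a=\frac12{}^{l}g^{ab}\big(\frac{\partial^2l}{\partial u^b\partial x^i}\rho^i_cu^c+C^e_{bc}u^c\frac{\partial l}{\partial u^e}-\rho^i_b\frac{\partial l}{\partial x^i}\big)$, ${}^{l}N^a_b=\partial\,{}^{l}G^a/\partial u^b$, $\mathbf z_a=\widetilde z_a-{}^{l}N^b_a\widetilde v_b$, $\mathbf v_a=\widetilde v_a$, with dual basis $\mathbf z^a=\widetilde z^a$, $\mathbf v^a=\widetilde v^a+{}^{l}N^a_b\widetilde z^b$. An almost complex structure on $\mathcal L^\pi E$ is a bundle endomorphism with square $-\mathbf I$. *)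

theory Defs
  imports "HOL-Analysis.Analysis" "HOL-Library.Function_Algebras"
begin

text \<open>Functions into a real vector space form a real vector space. Tangent vectors are represented
  below by such functions.\<close>

instantiation "fun" :: (type, real_vector) real_vector
begin

definition scaleR_fun :: "real \<Rightarrow> ('a \<Rightarrow> 'b) \<Rightarrow> 'a \<Rightarrow> 'b" where
  "scaleR_fun r f = (\<lambda>x. r *\<^sub>R f x)"

instance
  by standard (simp_all add: scaleR_fun_def fun_eq_iff scaleR_add_right scaleR_add_left)

end


section \<open>Smooth manifolds\<close>

primrec times_differentiable_on ::
  "nat \<Rightarrow> 'a::real_normed_vector set \<Rightarrow> ('a \<Rightarrow> 'b::real_normed_vector) \<Rightarrow> bool" where
  "times_differentiable_on 0 S f \<longleftrightarrow> continuous_on S f"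
| "times_differentiable_on (Suc k) S f \<longleftrightarrow>
     (\<forall>x\<in>S. f differentiable (at x)) \<and>
     (\<forall>h. times_differentiable_on k S (\<lambda>x. frechet_derivative f (at x) h))"

text \<open>Only used on open sets.\<close>

definition smooth_on :: "'a::real_normed_vector set \<Rightarrow> ('a \<Rightarrow> 'b::real_normed_vector) \<Rightarrow> bool" where
  "smooth_on S f \<longleftrightarrow> (\<forall>k. times_differentiable_on k S f)"

text \<open>A chart is a pair of its domain and its coordinate map; values of the coordinate map outside
  the domain are irrelevant.\<close>

type_synonym ('p, 'e) chart = "'p set \<times> ('p \<Rightarrow> 'e)"

definition local_rep :: "('p, 'e) chart \<Rightarrow> ('p \<Rightarrow> 'b) \<Rightarrow> 'e \<Rightarrow> 'b" where
  "local_rep c f = f \<circ> inv_into (fst c) (snd c)"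

definition transition :: "('p, 'e) chart \<Rightarrow> ('p, 'e) chart \<Rightarrow> 'e \<Rightarrow> 'e" where
  "transition c d = local_rep c (snd d)"

definition smooth_atlas :: "'p set \<Rightarrow> ('p, 'e::euclidean_space) chart set \<Rightarrow> bool" where
  "smooth_atlas M A \<longleftrightarrow>
     (\<Union>c\<in>A. fst c) = M \<and>
     (\<forall>c\<in>A. inj_on (snd c) (fst c) \<and> open (snd c ` fst c)) \<and>
     (\<forall>c\<in>A. \<forall>d\<in>A. open (snd c ` (fst c \<inter> fst d)) \<and>
        smooth_on (snd c ` (fst c \<inter> fst d)) (transition c d))"

definition atlas_topology :: "'p set \<Rightarrow> ('p, 'e::euclidean_space) chart set \<Rightarrow> 'p topology" where
  "atlas_topology M A = topology (\<lambda>S. S \<subseteq> M \<and> (\<forall>c\<in>A. open (snd c ` (fst c \<inter> S))))"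

lemma openin_atlas_topology:
  assumes "smooth_atlas M A"
  shows "openin (atlas_topology M A) S \<longleftrightarrow> S \<subseteq> M \<and> (\<forall>c\<in>A. open (snd c ` (fst c \<inter> S)))"
proof -
  have inj: "inj_on (snd c) (fst c)" if "c \<in> A" for c
    using assms that by (auto simp: smooth_atlas_def)
  have "istopology (\<lambda>S. S \<subseteq> M \<and> (\<forall>c\<in>A. open (snd c ` (fst c \<inter> S))))"
    unfolding istopology_def
  proof (intro conjI allI impI ballI)
    fix S T c
    assume *: "S \<subseteq> M \<and> (\<forall>c\<in>A. open (snd c ` (fst c \<inter> S)))"
      "T \<subseteq> M \<and> (\<forall>c\<in>A. open (snd c ` (fst c \<inter> T)))" and c: "c \<in> A"
    have "snd c ` (fst c \<inter> (S \<inter> T)) = snd c ` (fst c \<inter> S) \<inter> snd c ` (fst c \<inter> T)"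
      using inj[OF c] by (auto simp: inj_on_def)
    then show "open (snd c ` (fst c \<inter> (S \<inter> T)))"
      using * c by auto
  next
    fix \<K> c
    assume *: "\<forall>K\<in>\<K>. K \<subseteq> M \<and> (\<forall>c\<in>A. open (snd c ` (fst c \<inter> K)))" and c: "c \<in> A"
    have "snd c ` (fst c \<inter> \<Union>\<K>) = (\<Union>K\<in>\<K>. snd c ` (fst c \<inter> K))"
      by auto
    then show "open (snd c ` (fst c \<inter> \<Union>\<K>))"
      using * c by auto
  qed auto
  then show ?thesis
    by (simp add: atlas_topology_def topology_inverse')
qed

definition smooth_manifold :: "'p set \<Rightarrow> ('p, 'e::euclidean_space) chart set \<Rightarrow> bool" where
  "smooth_manifold M A \<longleftrightarrow> smooth_atlas M A \<and>
     Hausdorff_space (atlas_topology M A) \<and> second_countable (atlas_topology M A)"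

definition smooth_fun ::
  "('p, 'e::euclidean_space) chart set \<Rightarrow> 'p set \<Rightarrow> ('p \<Rightarrow> 'b::real_normed_vector) \<Rightarrow> bool" where
  "smooth_fun A S f \<longleftrightarrow> (\<forall>c\<in>A. smooth_on (snd c ` (fst c \<inter> S)) (local_rep c f))"


section \<open>Tangent vectors\<close>

text \<open>A tangent vector at \<open>p\<close> is the family of its components in all charts around \<open>p\<close>, which are
  related by the derivatives of the transition maps. The value at all other charts is set to 0, so
  that two tangent vectors at \<open>p\<close> are equal iff their components agree.\<close>

type_synonym ('p, 'e) tvec = "('p, 'e) chart \<Rightarrow> 'e"

definition tangent_space :: "('p, 'e::euclidean_space) chart set \<Rightarrow> 'p \<Rightarrow> ('p, 'e) tvec set" where
  "tangent_space A p =
     {X. (\<forall>c. \<not> (c \<in> A \<and> p \<in> fst c) \<longrightarrow> X c = 0) \<and>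
         (\<forall>c\<in>A. \<forall>d\<in>A. p \<in> fst c \<inter> fst d \<longrightarrow>
            X d = frechet_derivative (transition c d) (at (snd c p)) (X c))}"

text \<open>The tangent vector at \<open>p\<close> with components \<open>h\<close> in the chart \<open>c\<close>.\<close>

definition coord_vec ::
  "('p, 'e::euclidean_space) chart set \<Rightarrow> ('p, 'e) chart \<Rightarrow> 'p \<Rightarrow> 'e \<Rightarrow> ('p, 'e) tvec" where
  "coord_vec A c p h = (\<lambda>d. if d \<in> A \<and> p \<in> fst d
      then frechet_derivative (transition c d) (at (snd c p)) h else 0)"

definition tangent_map ::
  "('p, 'e::euclidean_space) chart set \<Rightarrow> ('q, 'f::euclidean_space) chart set \<Rightarrow> ('p \<Rightarrow> 'q) \<Rightarrow>
   'p \<Rightarrow> ('p, 'e) tvec \<Rightarrow> ('q, 'f) tvec" where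
  "tangent_map A A' f p X = (\<lambda>d. if d \<in> A' \<and> f p \<in> fst d
      then let c = (SOME c. c \<in> A \<and> p \<in> fst c)
           in frechet_derivative (local_rep c (snd d \<circ> f)) (at (snd c p)) (X c)
      else 0)"

lemma coord_vec_same_chart:
  assumes "smooth_atlas M A" "c \<in> A" "p \<in> fst c"
  shows "coord_vec A c p h c = h"
proof -
  have inj: "inj_on (snd c) (fst c)" and op: "open (snd c ` fst c)"
    using assms by (auto simp: smooth_atlas_def)
  have "(transition c c has_derivative (\<lambda>h. h)) (at (snd c p))"
  proof (rule has_derivative_transform_within_open[OF has_derivative_ident op])
    show "snd c p \<in> snd c ` fst c" using assms by auto
    show "x = transition c c x" if "x \<in> snd c ` fst c" for x
      using that inj by (auto simp: transition_def local_rep_def f_inv_into_f)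
  qed
  then have "frechet_derivative (transition c c) (at (snd c p)) = (\<lambda>h. h)"
    by (metis frechet_derivative_at)
  then show ?thesis
    using assms by (simp add: coord_vec_def)
qed


section \<open>Vector bundles\<close>

text \<open>The fibres \<open>V p\<close> of a vector bundle are subspaces of a common real vector space \<open>'v\<close>, and the
  total space is the set of pairs \<open>(p, v)\<close> with \<open>v \<in> V p\<close>; the bundle projection is \<^const>\<open>fst\<close>.
  A local trivialization is given by its domain in the base and its fibrewise component maps;
  it is the same thing as a local basis of sections.\<close>

type_synonym ('p, 'v, 'f) triv = "'p set \<times> ('p \<Rightarrow> 'v \<Rightarrow> 'f)"

definition linear_between ::
  "'a::real_vector set \<Rightarrow> 'b::real_vector set \<Rightarrow> ('a \<Rightarrow> 'b) \<Rightarrow> bool" where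
  "linear_between S T f \<longleftrightarrow> (\<forall>x\<in>S. f x \<in> T) \<and>
     (\<forall>x\<in>S. \<forall>y\<in>S. f (x + y) = f x + f y) \<and> (\<forall>r. \<forall>x\<in>S. f (r *\<^sub>R x) = r *\<^sub>R f x)"

text \<open>The element of the fibre over \<open>p\<close> with components \<open>\<xi>\<close>.\<close>

definition triv_vec :: "('p \<Rightarrow> 'v set) \<Rightarrow> ('p, 'v, 'f) triv \<Rightarrow> 'f \<Rightarrow> 'p \<Rightarrow> 'v" where
  "triv_vec V t \<xi> p = inv_into (V p) (snd t p) \<xi>"

definition vector_bundle ::
  "'p set \<Rightarrow> ('p, 'e::euclidean_space) chart set \<Rightarrow> ('p \<Rightarrow> 'v::real_vector set) \<Rightarrow>
   ('p, 'v, 'f::euclidean_space) triv set \<Rightarrow> bool" where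
  "vector_bundle M A V B \<longleftrightarrow>
     (\<forall>p\<in>M. subspace (V p)) \<and>
     (\<Union>t\<in>B. fst t) = M \<and>
     (\<forall>t\<in>B. openin (atlas_topology M A) (fst t) \<and>
        (\<forall>p\<in>fst t. linear_between (V p) UNIV (snd t p) \<and> bij_betw (snd t p) (V p) UNIV)) \<and>
     (\<forall>t\<in>B. \<forall>t'\<in>B. \<forall>\<xi>. smooth_fun A (fst t \<inter> fst t') (\<lambda>p. snd t' p (triv_vec V t \<xi> p)))"

definition smooth_section ::
  "('p, 'e::euclidean_space) chart set \<Rightarrow> ('p \<Rightarrow> 'v set) \<Rightarrow>
   ('p, 'v, 'f::euclidean_space) triv set \<Rightarrow> 'p set \<Rightarrow> ('p \<Rightarrow> 'v) \<Rightarrow> bool" where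
  "smooth_section A V B U s \<longleftrightarrow> (\<forall>p\<in>U. s p \<in> V p) \<and>
     (\<forall>t\<in>B. smooth_fun A (U \<inter> fst t) (\<lambda>p. snd t p (s p)))"

text \<open>The total space, without the zero section.\<close>

definition slit_total :: "'p set \<Rightarrow> ('p \<Rightarrow> 'v::zero set) \<Rightarrow> ('p \<times> 'v) set" where
  "slit_total M V = {(p, v). p \<in> M \<and> v \<in> V p \<and> v \<noteq> 0}"

text \<open>Coordinates \<open>(x\<^sup>i, u\<^sup>a)\<close> on the total space, from a chart of the base and a trivialization.\<close>

definition bundle_chart ::
  "('p \<Rightarrow> 'v set) \<Rightarrow> ('p, 'e) chart \<Rightarrow> ('p, 'v, 'f) triv \<Rightarrow> ('p \<times> 'v, 'e \<times> 'f) chart" where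
  "bundle_chart V c t = ({(p, v). p \<in> fst c \<inter> fst t \<and> v \<in> V p}, \<lambda>(p, v). (snd c p, snd t p v))"

definition bundle_atlas ::
  "('p, 'e) chart set \<Rightarrow> ('p \<Rightarrow> 'v set) \<Rightarrow> ('p, 'v, 'f) triv set \<Rightarrow> ('p \<times> 'v, 'e \<times> 'f) chart set" where
  "bundle_atlas A V B = {bundle_chart V c t | c t. c \<in> A \<and> t \<in> B}"

text \<open>Smooth fibrewise linear maps of the part of a vector bundle over the open set \<open>W\<close> of its base
  (with atlas \<open>A\<close>) to itself; smoothness is that of the matrix of the map in some local
  trivialization around each point, and hence in all of them.\<close>

definition bundle_endomorphism ::
  "('p, 'e::euclidean_space) chart set \<Rightarrow> 'p set \<Rightarrow> ('p \<Rightarrow> 'v::real_vector set) \<Rightarrow>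
   ('p, 'v, 'f::euclidean_space) triv set \<Rightarrow> ('p \<Rightarrow> 'v \<Rightarrow> 'v) \<Rightarrow> bool" where
  "bundle_endomorphism A W V B F \<longleftrightarrow>
     (\<forall>p\<in>W. linear_between (V p) (V p) (F p)) \<and>
     (\<forall>p\<in>W. \<exists>t\<in>B. p \<in> fst t \<and>
        (\<forall>\<xi>. smooth_fun A (W \<inter> fst t) (\<lambda>q. snd t q (F q (triv_vec V t \<xi> q)))))"

definition almost_complex_structure ::
  "('p, 'e::euclidean_space) chart set \<Rightarrow> 'p set \<Rightarrow> ('p \<Rightarrow> 'v::real_vector set) \<Rightarrow>
   ('p, 'v, 'f::euclidean_space) triv set \<Rightarrow> ('p \<Rightarrow> 'v \<Rightarrow> 'v) \<Rightarrow> bool" where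
  "almost_complex_structure A W V B F \<longleftrightarrow>
     bundle_endomorphism A W V B F \<and> (\<forall>p\<in>W. \<forall>X\<in>V p. F p (F p X) = - X)"

text \<open>The trivialization of the tangent bundle and the induced coordinates \<open>(x\<^sup>i, y\<^sup>i)\<close>.\<close>

definition tangent_triv :: "('p, 'e) chart \<Rightarrow> ('p, ('p, 'e) tvec, 'e) triv" where
  "tangent_triv c = (fst c, \<lambda>p X. X c)"

definition tangent_chart :: "('p, 'e::euclidean_space) chart set \<Rightarrow> ('p, 'e) chart \<Rightarrow>
    ('p \<times> ('p, 'e) tvec, 'e \<times> 'e) chart" where
  "tangent_chart A c = bundle_chart (tangent_space A) c (tangent_triv c)"

definition tangent_atlas :: "('p, 'e::euclidean_space) chart set \<Rightarrow>
    ('p \<times> ('p, 'e) tvec, 'e \<times> 'e) chart set" where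
  "tangent_atlas A = tangent_chart A ` A"


section \<open>Regular Lagrangians\<close>

text \<open>Partial derivatives in the base and fibre coordinates.\<close>

definition base_pd :: "'n \<Rightarrow> ((real^'n) \<times> (real^'r) \<Rightarrow> real) \<Rightarrow> (real^'n) \<times> (real^'r) \<Rightarrow> real" where
  "base_pd i f z = frechet_derivative f (at z) (axis i 1, 0)"

definition fibre_pd :: "'r \<Rightarrow> ((real^'n) \<times> (real^'r) \<Rightarrow> real) \<Rightarrow> (real^'n) \<times> (real^'r) \<Rightarrow> real" where
  "fibre_pd a f z = frechet_derivative f (at z) (0, axis a 1)"

definition fibre_metric :: "((real^'n) \<times> (real^'r) \<Rightarrow> real) \<Rightarrow> (real^'n) \<times> (real^'r) \<Rightarrow> real^'r^'r" where
  "fibre_metric f z = (\<chi> a b. 1/2 * fibre_pd a (fibre_pd b f) z)"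

text \<open>The numbers of positive and of negative eigenvalues of a symmetric matrix, counted with
  multiplicity.\<close>

definition signature :: "real^'r^'r \<Rightarrow> nat \<times> nat" where
  "signature g =
     (\<Sum>\<mu> | 0 < \<mu> \<and> (\<exists>v. v \<noteq> 0 \<and> g *v v = \<mu> *\<^sub>R v). dim {v. g *v v = \<mu> *\<^sub>R v},
      \<Sum>\<mu> | \<mu> < 0 \<and> (\<exists>v. v \<noteq> 0 \<and> g *v v = \<mu> *\<^sub>R v). dim {v. g *v v = \<mu> *\<^sub>R v})"

text \<open>\<open>A\<close> is an atlas of the total space by bundle coordinates and \<open>W\<close> is the complement of the zero
  section.\<close>

definition regular_lagrangian ::
  "('p, (real^'n) \<times> (real^'r)) chart set \<Rightarrow> 'p set \<Rightarrow> ('p \<Rightarrow> real) \<Rightarrow> bool" where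
  "regular_lagrangian A W L \<longleftrightarrow> smooth_fun A W L \<and>
     (\<exists>\<sigma>. \<forall>c\<in>A. \<forall>w \<in> fst c \<inter> W. invertible (fibre_metric (local_rep c L) (snd c w)) \<and>
        signature (fibre_metric (local_rep c L) (snd c w)) = \<sigma>)"


section \<open>The canonical N-connection on the tangent bundle\<close>

definition tm_spray :: "((real^'n) \<times> (real^'n) \<Rightarrow> real) \<Rightarrow> 'n \<Rightarrow> (real^'n) \<times> (real^'n) \<Rightarrow> real" where
  "tm_spray f i z = 1/2 * (1/2 * (\<Sum>j\<in>UNIV. matrix_inv (fibre_metric f z) $ i $ j *
     ((\<Sum>k\<in>UNIV. fibre_pd j (base_pd k f) z * snd z $ k) - base_pd j f z)))"

text \<open>\<open>tm_N f i j\<close> is \<open>N\<^sup>i\<^sub>j\<close>, with the upper index first.\<close>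

definition tm_N :: "((real^'n) \<times> (real^'n) \<Rightarrow> real) \<Rightarrow> 'n \<Rightarrow> 'n \<Rightarrow> (real^'n) \<times> (real^'n) \<Rightarrow> real" where
  "tm_N f i j = fibre_pd j (tm_spray f i)"

text \<open>For a chart \<open>c\<close> of the base and a point \<open>w\<close> of the slit tangent bundle: \<open>\<partial>/\<partial>x\<^sup>i\<close> and
  \<open>\<partial>/\<partial>y\<^sup>i\<close> at \<open>w\<close>, the coefficients \<open>N\<^sup>i\<^sub>j\<close> at \<open>w\<close>, and the adapted frame and coframe at \<open>w\<close>.\<close>

type_synonym ('p, 'n) ttvec =
  "('p \<times> ('p, real^'n) tvec, (real^'n) \<times> (real^'n)) tvec"

definition tm_dx :: "('p, real^'n) chart set \<Rightarrow> ('p, real^'n) chart \<Rightarrow> 'n \<Rightarrow>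
    'p \<times> ('p, real^'n) tvec \<Rightarrow> ('p, 'n) ttvec" where
  "tm_dx A c i w = coord_vec (tangent_atlas A) (tangent_chart A c) w (axis i 1, 0)"

definition tm_dy :: "('p, real^'n) chart set \<Rightarrow> ('p, real^'n) chart \<Rightarrow> 'n \<Rightarrow>
    'p \<times> ('p, real^'n) tvec \<Rightarrow> ('p, 'n) ttvec" where
  "tm_dy A c i w = coord_vec (tangent_atlas A) (tangent_chart A c) w (0, axis i 1)"

definition tm_N_at :: "('p, real^'n) chart set \<Rightarrow> ('p \<times> ('p, real^'n) tvec \<Rightarrow> real) \<Rightarrow>
    ('p, real^'n) chart \<Rightarrow> 'n \<Rightarrow> 'n \<Rightarrow> 'p \<times> ('p, real^'n) tvec \<Rightarrow> real" where
  "tm_N_at A L c i j w =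
     tm_N (local_rep (tangent_chart A c) L) i j (snd (tangent_chart A c) w)"

definition tm_e :: "('p, real^'n) chart set \<Rightarrow> ('p \<times> ('p, real^'n) tvec \<Rightarrow> real) \<Rightarrow>
    ('p, real^'n) chart \<Rightarrow> 'n \<Rightarrow> 'p \<times> ('p, real^'n) tvec \<Rightarrow> ('p, 'n) ttvec" where
  "tm_e A L c i w = tm_dx A c i w - (\<Sum>j\<in>UNIV. tm_N_at A L c j i w *\<^sub>R tm_dy A c j w)"

definition tm_v :: "('p, real^'n) chart set \<Rightarrow> ('p, real^'n) chart \<Rightarrow> 'n \<Rightarrow>
    'p \<times> ('p, real^'n) tvec \<Rightarrow> ('p, 'n) ttvec" where
  "tm_v A c i w = tm_dy A c i w"

definition tm_e_dual :: "('p, real^'n) chart set \<Rightarrow> ('p, real^'n) chart \<Rightarrow> 'n \<Rightarrow>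
    'p \<times> ('p, real^'n) tvec \<Rightarrow> ('p, 'n) ttvec \<Rightarrow> real" where
  "tm_e_dual A c i w X = fst (X (tangent_chart A c)) $ i"

definition tm_v_dual :: "('p, real^'n) chart set \<Rightarrow> ('p \<times> ('p, real^'n) tvec \<Rightarrow> real) \<Rightarrow>
    ('p, real^'n) chart \<Rightarrow> 'n \<Rightarrow> 'p \<times> ('p, real^'n) tvec \<Rightarrow> ('p, 'n) ttvec \<Rightarrow> real" where
  "tm_v_dual A L c i w X = snd (X (tangent_chart A c)) $ i +
     (\<Sum>j\<in>UNIV. tm_N_at A L c i j w * fst (X (tangent_chart A c)) $ j)"


section \<open>Lie algebroids\<close>

text \<open>The bracket is given as a bracket of sections over each open set of the base, compatible with
  restriction, so that brackets of local basis sections make sense; \<open>br U s s'\<close> is only meaningful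
  for smooth sections over \<open>U\<close>, and only its values on \<open>U\<close> matter. That the anchor is a homomorphism
  of brackets follows from the axioms.\<close>

definition lie_algebroid ::
  "'p set \<Rightarrow> ('p, 'e::euclidean_space) chart set \<Rightarrow> ('p \<Rightarrow> 'v::real_vector set) \<Rightarrow>
   ('p, 'v, 'f::euclidean_space) triv set \<Rightarrow> ('p \<Rightarrow> 'v \<Rightarrow> ('p, 'e) tvec) \<Rightarrow>
   ('p set \<Rightarrow> ('p \<Rightarrow> 'v) \<Rightarrow> ('p \<Rightarrow> 'v) \<Rightarrow> ('p \<Rightarrow> 'v)) \<Rightarrow> bool" where
  "lie_algebroid M A V B \<rho> br \<longleftrightarrow>
     smooth_manifold M A \<and> vector_bundle M A V B \<and>
     \<comment> \<open>the anchor is a bundle map to the tangent bundle\<close>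
     (\<forall>p\<in>M. linear_between (V p) (tangent_space A p) (\<rho> p)) \<and>
     (\<forall>c\<in>A. \<forall>t\<in>B. \<forall>\<xi>. smooth_fun A (fst c \<inter> fst t) (\<lambda>p. \<rho> p (triv_vec V t \<xi> p) c)) \<and>
     \<comment> \<open>compatibility of the brackets with restriction\<close>
     (\<forall>U U' s1 s2 r1 r2. openin (atlas_topology M A) U \<longrightarrow> openin (atlas_topology M A) U' \<longrightarrow>
        U' \<subseteq> U \<longrightarrow> smooth_section A V B U s1 \<longrightarrow> smooth_section A V B U s2 \<longrightarrow>
        (\<forall>p\<in>U'. r1 p = s1 p \<and> r2 p = s2 p) \<longrightarrow>
        (\<forall>p\<in>U'. br U' r1 r2 p = br U s1 s2 p)) \<and>
     \<comment> \<open>Lie bracket and Leibniz rule\<close>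
     (\<forall>U s1 s2 s3. openin (atlas_topology M A) U \<longrightarrow> smooth_section A V B U s1 \<longrightarrow>
        smooth_section A V B U s2 \<longrightarrow> smooth_section A V B U s3 \<longrightarrow>
        smooth_section A V B U (br U s1 s2) \<and>
        (\<forall>p\<in>U.
          br U s1 s2 p = - br U s2 s1 p \<and>
          br U s1 (\<lambda>q. s2 q + s3 q) p = br U s1 s2 p + br U s1 s3 p \<and>
          (\<forall>r. br U s1 (\<lambda>q. r *\<^sub>R s2 q) p = r *\<^sub>R br U s1 s2 p) \<and>
          br U s1 (br U s2 s3) p + br U s2 (br U s3 s1) p + br U s3 (br U s1 s2) p = 0 \<and>
          (\<forall>f. smooth_fun A U f \<longrightarrow> (\<forall>c\<in>A. p \<in> fst c \<longrightarrow>
             br U s1 (\<lambda>q. f q *\<^sub>R s2 q) p = f p *\<^sub>R br U s1 s2 p +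
               frechet_derivative (local_rep c f) (at (snd c p)) (\<rho> p (s1 p) c) *\<^sub>R s2 p))))"

text \<open>The local basis \<open>v\<^sub>a\<close> and the structure functions \<open>\<rho>\<^sup>i\<^sub>a\<close> and \<open>C\<^sup>c\<^sub>a\<^sub>b\<close>, with upper indices first.\<close>

definition basis_section ::
  "('p \<Rightarrow> 'v set) \<Rightarrow> ('p, 'v, real^'r) triv \<Rightarrow> 'r \<Rightarrow> 'p \<Rightarrow> 'v" where
  "basis_section V t a = triv_vec V t (axis a 1)"

definition anchor_coeff ::
  "('p \<Rightarrow> 'v set) \<Rightarrow> ('p \<Rightarrow> 'v \<Rightarrow> ('p, real^'n) tvec) \<Rightarrow> ('p, real^'n) chart \<Rightarrow>
   ('p, 'v, real^'r) triv \<Rightarrow> 'n \<Rightarrow> 'r \<Rightarrow> 'p \<Rightarrow> real" where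
  "anchor_coeff V \<rho> c t i a p = \<rho> p (basis_section V t a p) c $ i"

definition bracket_coeff ::
  "('p \<Rightarrow> 'v set) \<Rightarrow> ('p set \<Rightarrow> ('p \<Rightarrow> 'v) \<Rightarrow> ('p \<Rightarrow> 'v) \<Rightarrow> ('p \<Rightarrow> 'v)) \<Rightarrow>
   ('p, 'v, real^'r) triv \<Rightarrow> 'r \<Rightarrow> 'r \<Rightarrow> 'r \<Rightarrow> 'p \<Rightarrow> real" where
  "bracket_coeff V br t c a b p =
     snd t p (br (fst t) (basis_section V t a) (basis_section V t b) p) $ c"


section \<open>The prolongation and its canonical N-connection\<close>

text \<open>The fibre over a point \<open>e = (p, u)\<close> of \<open>E\<close>, with the base point of \<open>b \<in> E\<close> (which is \<open>p\<close>)
  suppressed.\<close>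

type_synonym ('p, 'v, 'n, 'r) pvec = "'v \<times> ('p \<times> 'v, (real^'n) \<times> (real^'r)) tvec"

definition prolongation ::
  "('p, real^'n) chart set \<Rightarrow> ('p \<Rightarrow> 'v set) \<Rightarrow> ('p, 'v, real^'r) triv set \<Rightarrow>
   ('p \<Rightarrow> 'v \<Rightarrow> ('p, real^'n) tvec) \<Rightarrow> 'p \<times> 'v \<Rightarrow> ('p, 'v, 'n, 'r) pvec set" where
  "prolongation A V B \<rho> e = {(b, z). b \<in> V (fst e) \<and> z \<in> tangent_space (bundle_atlas A V B) e \<and>
     \<rho> (fst e) b = tangent_map (bundle_atlas A V B) A fst e z}"

definition prol_z :: "('p, real^'n) chart set \<Rightarrow> ('p \<Rightarrow> 'v set) \<Rightarrow> ('p, 'v, real^'r) triv set \<Rightarrow>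
    ('p \<Rightarrow> 'v \<Rightarrow> ('p, real^'n) tvec) \<Rightarrow> ('p, real^'n) chart \<Rightarrow> ('p, 'v, real^'r) triv \<Rightarrow> 'r \<Rightarrow>
    'p \<times> 'v \<Rightarrow> ('p, 'v, 'n, 'r) pvec" where
  "prol_z A V B \<rho> c t a e = (basis_section V t a (fst e),
     \<Sum>i\<in>UNIV. anchor_coeff V \<rho> c t i a (fst e) *\<^sub>R
       coord_vec (bundle_atlas A V B) (bundle_chart V c t) e (axis i 1, 0))"

definition prol_v :: "('p, real^'n) chart set \<Rightarrow> ('p \<Rightarrow> 'v::zero set) \<Rightarrow>
    ('p, 'v, real^'r) triv set \<Rightarrow> ('p, real^'n) chart \<Rightarrow> ('p, 'v, real^'r) triv \<Rightarrow> 'r \<Rightarrow>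
    'p \<times> 'v \<Rightarrow> ('p, 'v, 'n, 'r) pvec" where
  "prol_v A V B c t a e =
     (0, coord_vec (bundle_atlas A V B) (bundle_chart V c t) e (0, axis a 1))"

text \<open>The basis dual to \<^const>\<open>prol_z\<close>, \<^const>\<open>prol_v\<close>: the components of \<open>b\<close> in the basis \<open>v\<^sub>a\<close>,
  and the \<open>du\<^sup>a\<close>-components of \<open>z\<close>.\<close>

definition prol_z_dual :: "('p, 'v, real^'r) triv \<Rightarrow> 'r \<Rightarrow> 'p \<times> 'v \<Rightarrow>
    ('p, 'v, 'n, 'r) pvec \<Rightarrow> real" where
  "prol_z_dual t a e X = snd t (fst e) (fst X) $ a"

definition prol_v_dual :: "('p \<Rightarrow> 'v set) \<Rightarrow> ('p, real^'n) chart \<Rightarrow> ('p, 'v, real^'r) triv \<Rightarrow>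
    'r \<Rightarrow> ('p, 'v, 'n, 'r) pvec \<Rightarrow> real" where
  "prol_v_dual V c t a X = snd (snd X (bundle_chart V c t)) $ a"

text \<open>The trivialization of the prolongation given by this basis.\<close>

definition prol_triv :: "('p \<Rightarrow> 'v set) \<Rightarrow> ('p, real^'n) chart \<Rightarrow> ('p, 'v, real^'r) triv \<Rightarrow>
    ('p \<times> 'v, ('p, 'v, 'n, 'r) pvec, (real^'r) \<times> (real^'r)) triv" where
  "prol_triv V c t = (fst (bundle_chart V c t),
     \<lambda>e X. (\<chi> a. prol_z_dual t a e X, \<chi> a. prol_v_dual V c t a X))"

definition prol_trivs :: "('p, real^'n) chart set \<Rightarrow> ('p \<Rightarrow> 'v set) \<Rightarrow>
    ('p, 'v, real^'r) triv set \<Rightarrow>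
    ('p \<times> 'v, ('p, 'v, 'n, 'r) pvec, (real^'r) \<times> (real^'r)) triv set" where
  "prol_trivs A V B = {prol_triv V c t | c t. c \<in> A \<and> t \<in> B}"

text \<open>Here \<open>\<rho> x i a\<close> is \<open>\<rho>\<^sup>i\<^sub>a\<close> and \<open>C x e a b\<close> is \<open>C\<^sup>e\<^sub>a\<^sub>b\<close> as functions of the coordinates.\<close>

definition la_spray :: "(real^'n \<Rightarrow> 'n \<Rightarrow> 'r \<Rightarrow> real) \<Rightarrow> (real^'n \<Rightarrow> 'r \<Rightarrow> 'r \<Rightarrow> 'r \<Rightarrow> real) \<Rightarrow>
    ((real^'n) \<times> (real^'r) \<Rightarrow> real) \<Rightarrow> 'r \<Rightarrow> (real^'n) \<times> (real^'r) \<Rightarrow> real" where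
  "la_spray \<rho> C f a z = 1/2 * (1/2 * (\<Sum>b\<in>UNIV. matrix_inv (fibre_metric f z) $ a $ b *
     ((\<Sum>i\<in>UNIV. \<Sum>c\<in>UNIV. fibre_pd b (base_pd i f) z * \<rho> (fst z) i c * snd z $ c)
      + (\<Sum>c\<in>UNIV. \<Sum>e\<in>UNIV. C (fst z) e b c * snd z $ c * fibre_pd e f z)
      - (\<Sum>i\<in>UNIV. \<rho> (fst z) i b * base_pd i f z))))"

definition la_N :: "(real^'n \<Rightarrow> 'n \<Rightarrow> 'r \<Rightarrow> real) \<Rightarrow> (real^'n \<Rightarrow> 'r \<Rightarrow> 'r \<Rightarrow> 'r \<Rightarrow> real) \<Rightarrow>
    ((real^'n) \<times> (real^'r) \<Rightarrow> real) \<Rightarrow> 'r \<Rightarrow> 'r \<Rightarrow> (real^'n) \<times> (real^'r) \<Rightarrow> real" where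
  "la_N \<rho> C f a b = fibre_pd b (la_spray \<rho> C f a)"

definition la_N_at :: "('p \<Rightarrow> 'v set) \<Rightarrow> ('p \<Rightarrow> 'v \<Rightarrow> ('p, real^'n) tvec) \<Rightarrow>
    ('p set \<Rightarrow> ('p \<Rightarrow> 'v) \<Rightarrow> ('p \<Rightarrow> 'v) \<Rightarrow> ('p \<Rightarrow> 'v)) \<Rightarrow> ('p \<times> 'v \<Rightarrow> real) \<Rightarrow>
    ('p, real^'n) chart \<Rightarrow> ('p, 'v, real^'r) triv \<Rightarrow> 'r \<Rightarrow> 'r \<Rightarrow> 'p \<times> 'v \<Rightarrow> real" where
  "la_N_at V \<rho> br l c t a b e =
     la_N (\<lambda>x i a. local_rep c (anchor_coeff V \<rho> c t i a) x)
          (\<lambda>x e a b. local_rep c (bracket_coeff V br t e a b) x)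
          (local_rep (bundle_chart V c t) l) a b (snd (bundle_chart V c t) e)"

definition la_z :: "('p, real^'n) chart set \<Rightarrow> ('p \<Rightarrow> 'v::real_vector set) \<Rightarrow>
    ('p, 'v, real^'r) triv set \<Rightarrow> ('p \<Rightarrow> 'v \<Rightarrow> ('p, real^'n) tvec) \<Rightarrow>
    ('p set \<Rightarrow> ('p \<Rightarrow> 'v) \<Rightarrow> ('p \<Rightarrow> 'v) \<Rightarrow> ('p \<Rightarrow> 'v)) \<Rightarrow> ('p \<times> 'v \<Rightarrow> real) \<Rightarrow>
    ('p, real^'n) chart \<Rightarrow> ('p, 'v, real^'r) triv \<Rightarrow> 'r \<Rightarrow> 'p \<times> 'v \<Rightarrow> ('p, 'v, 'n, 'r) pvec" where
  "la_z A V B \<rho> br l c t a e = prol_z A V B \<rho> c t a e -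
     (\<Sum>b\<in>UNIV. la_N_at V \<rho> br l c t b a e *\<^sub>R prol_v A V B c t b e)"

definition la_v :: "('p, real^'n) chart set \<Rightarrow> ('p \<Rightarrow> 'v::real_vector set) \<Rightarrow>
    ('p, 'v, real^'r) triv set \<Rightarrow> ('p, real^'n) chart \<Rightarrow> ('p, 'v, real^'r) triv \<Rightarrow> 'r \<Rightarrow>
    'p \<times> 'v \<Rightarrow> ('p, 'v, 'n, 'r) pvec" where
  "la_v A V B c t a e = prol_v A V B c t a e"

definition la_z_dual :: "('p, 'v, real^'r) triv \<Rightarrow> 'r \<Rightarrow> 'p \<times> 'v \<Rightarrow>
    ('p, 'v, 'n, 'r) pvec \<Rightarrow> real" where
  "la_z_dual t a e X = prol_z_dual t a e X"

definition la_v_dual :: "('p \<Rightarrow> 'v set) \<Rightarrow> ('p \<Rightarrow> 'v \<Rightarrow> ('p, real^'n) tvec) \<Rightarrow>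
    ('p set \<Rightarrow> ('p \<Rightarrow> 'v) \<Rightarrow> ('p \<Rightarrow> 'v) \<Rightarrow> ('p \<Rightarrow> 'v)) \<Rightarrow> ('p \<times> 'v \<Rightarrow> real) \<Rightarrow>
    ('p, real^'n) chart \<Rightarrow> ('p, 'v, real^'r) triv \<Rightarrow> 'r \<Rightarrow> 'p \<times> 'v \<Rightarrow>
    ('p, 'v, 'n, 'r) pvec \<Rightarrow> real" where
  "la_v_dual V \<rho> br l c t a e X = prol_v_dual V c t a X +
     (\<Sum>b\<in>UNIV. la_N_at V \<rho> br l c t a b e * prol_z_dual t b e X)"

end

theory Submission
  imports Defs
begin

text \<open>In a chart with coordinate functions \<open>N\<close> of the N-connection, \<open>F\<close> sends the components \<open>(a, k)\<close>
  of a vector to \<open>(w, - a - N w)\<close> with \<open>w = k + N a\<close>, and the square of this map is \<open>- 1\<close>. It remains to see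
  that these local maps fit together and are smooth. Smoothness holds because \<open>N\<close> is obtained from the
  Lagrangian by differentiation and by inverting the fibre metric (Cramer's rule).

  For the tangent bundle, let \<open>f\<close> be the Lagrangian in coordinates. Then \<open>G = (G\<^sup>i)\<close> at \<open>z = (x, y)\<close> is
  characterized by the Euler-Lagrange equations: with the vector \<open>s = (y, - 2 G)\<close> held fixed, the
  derivative of \<open>D f s\<close> at \<open>z\<close> in direction \<open>(0, v)\<close> is \<open>D f (v, 0)\<close>, for all \<open>v\<close>. By the chain rule and the symmetry
  of \<open>D\<^sup>2 \<phi>\<close>, a change of coordinates \<open>\<phi>\<close> replaces \<open>G\<close> by \<open>D \<phi> G - D\<^sup>2 \<phi> (y, y) / 2\<close>; differentiating in \<open>y\<close> gives
  \<open>N' (D \<phi> v) = D \<phi> (N v) - D\<^sup>2 \<phi> (y, v)\<close>, and this is exactly what makes the local maps agree.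
  On the prolongation the basis \<open>v\<^sub>a\<close> is fixed, so only the coordinates of the base change, the fibre
  coordinates of points and vectors do not, and \<open>N\<close> itself is invariant.\<close>

section \<open>Smooth functions\<close>

text \<open>The Euler-Lagrange characterization keeps the change of coordinates short: it contains
  no inverse metric, and since it is tested on all directions \<open>v\<close>, surjectivity of
  \<open>D \<phi>\<close> carries it over. The vector is \<open>(y, - 2 G)\<close> because
  \<open>G\<close> is a quarter of the inverse metric applied to the Euler-Lagrange expression while
  the fibre Hessian is twice the metric, so the Hessian term of \<open>- 2 G\<close> cancels that
  expression.

  In terms of \<open>(a, w)\<close> the structure is the rotation
  \<open>(a, w) \<mapsto> (w, - a)\<close>, and the rule for \<open>N\<close> makes a change of
  coordinates act on \<open>a\<close> and on \<open>w\<close> by the same Jacobian.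

  For the algebroid, base derivatives enter \<open>G\<close> only contracted with the anchor, that
  is, as derivatives along vectors that transform by the Jacobian; everything else in
  \<open>G\<close> is independent of the base chart. Invariance is therefore verified directly.
  Since \<open>N\<close> is attached to a basis \<open>v_a\<close>, the second part yields one
  structure for each trivialization \<open>t\<close>, over the domain of \<open>t\<close>.\<close>

lemma frechet_derivativeI:
  "(f has_derivative f') (at x) \<Longrightarrow> frechet_derivative f (at x) h = f' h"
  by (metis frechet_derivative_at)

lemma has_derivative_frechet:
  "f differentiable (at x) \<Longrightarrow> (f has_derivative frechet_derivative f (at x)) (at x)"
  using frechet_derivative_works by blast

text \<open>A Frechet derivative at a point sees a whole neighbourhood, so agreement on
  \<open>S\<close> passes to derivatives because \<open>S\<close> is open. The smoothness proofs use
  this to replace a derivative by a formula that is valid on \<open>S\<close>.\<close>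

lemma times_differentiable_on_cong:
  assumes "open S" "times_differentiable_on k S f" "\<And>x. x \<in> S \<Longrightarrow> f x = g x"
  shows "times_differentiable_on k S g"
  using assms(2,3)
proof (induction k arbitrary: f g)
  case 0
  then show ?case by (simp cong: continuous_on_cong)
next
  case (Suc k)
  have "g differentiable (at x)" if "x \<in> S" for x
  proof -
    have "(f has_derivative frechet_derivative f (at x)) (at x)"
      using Suc.prems that by (auto intro: has_derivative_frechet)
    then show ?thesis
      using has_derivative_transform_within_open[OF _ assms(1) that] Suc.prems(2)
      by (blast intro: differentiableI)
  qed
  moreover have "times_differentiable_on k S (\<lambda>x. frechet_derivative g (at x) h)" for h
  proof (rule Suc.IH[of "\<lambda>x. frechet_derivative f (at x) h"])
    show "times_differentiable_on k S (\<lambda>x. frechet_derivative f (at x) h)"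
      using Suc.prems by simp
    show "frechet_derivative f (at x) h = frechet_derivative g (at x) h" if "x \<in> S" for x
      using frechet_derivative_transform_within_open[OF _ assms(1) that] Suc.prems that
      by (metis times_differentiable_on.simps(2))
  qed
  ultimately show ?case by simp
qed

lemma times_differentiable_on_subset:
  "times_differentiable_on k S f \<Longrightarrow> T \<subseteq> S \<Longrightarrow> times_differentiable_on k T f"
  by (induction k arbitrary: f) (auto intro: continuous_on_subset)

text \<open>Serves the derivative formulas that still contain the undifferentiated functions, as in
  the product and chain rules: these functions are known to order \<open>Suc k\<close>, and the
  induction hypothesis takes them to order \<open>k\<close>.\<close>

lemma times_differentiable_on_SucD:
  "times_differentiable_on (Suc k) S f \<Longrightarrow> times_differentiable_on k S f"
proof (induction k arbitrary: f)
  case 0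
  then show ?case
    by (auto intro!: differentiable_imp_continuous_on simp: differentiable_on_def
        intro: differentiable_at_imp_differentiable_on Derivative.differentiable_at_withinI)
next
  case (Suc k)
  then have "\<forall>x\<in>S. f differentiable (at x)"
    and "times_differentiable_on (Suc k) S (\<lambda>x. frechet_derivative f (at x) h)" for h
    by simp_all
  then have "times_differentiable_on k S (\<lambda>x. frechet_derivative f (at x) h)" for h
    by (intro Suc.IH)
  then show ?case using \<open>\<forall>x\<in>S. f differentiable (at x)\<close> by simp
qed

lemma times_differentiable_on_const: "times_differentiable_on k S (\<lambda>x. c)"
  by (induction k arbitrary: c) auto

lemma times_differentiable_on_add:
  assumes "open S" "times_differentiable_on k S f" "times_differentiable_on k S g"
  shows "times_differentiable_on k S (\<lambda>x. f x + g x)"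
  using assms(2,3)
proof (induction k arbitrary: f g)
  case (Suc k)
  have D: "((\<lambda>x. f x + g x) has_derivative
      (\<lambda>h. frechet_derivative f (at x) h + frechet_derivative g (at x) h)) (at x)" if "x \<in> S" for x
    using Suc.prems that by (auto intro!: has_derivative_add has_derivative_frechet)
  have "times_differentiable_on k S (\<lambda>x. frechet_derivative (\<lambda>x. f x + g x) (at x) h)" for h
    by (rule times_differentiable_on_cong[OF assms(1) Suc.IH])
      (use Suc.prems frechet_derivativeI[OF D] in auto)
  then show ?case using D by (auto intro: differentiableI)
next
  case 0
  then show ?case by (simp add: continuous_on_add)
qed

lemma times_differentiable_on_sum:
  assumes "open S" "\<And>i. i \<in> I \<Longrightarrow> times_differentiable_on k S (f i)"
  shows "times_differentiable_on k S (\<lambda>x. \<Sum>i\<in>I. f i x)"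
  using assms(2)
proof (induction I rule: infinite_finite_induct)
  case (insert i I)
  then show ?case
    using times_differentiable_on_add[OF assms(1), of k "f i" "\<lambda>x. \<Sum>i\<in>I. f i x"] by simp
next
  case (infinite I)
  then show ?case unfolding sum.infinite[OF infinite(1)] by (intro times_differentiable_on_const)
next
  case empty
  show ?case unfolding sum.empty by (rule times_differentiable_on_const)
qed

lemma times_differentiable_on_linear:
  assumes "bounded_linear L" "open S" "times_differentiable_on k S f"
  shows "times_differentiable_on k S (\<lambda>x. L (f x))"
  using assms(3)
proof (induction k arbitrary: f)
  case 0
  then show ?case
    by (auto intro: bounded_linear.continuous_on[OF assms(1)])
next
  case (Suc k)
  have D: "((\<lambda>x. L (f x)) has_derivative (\<lambda>h. L (frechet_derivative f (at x) h))) (at x)"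
    if "x \<in> S" for x
    using Suc.prems that by (auto intro!: bounded_linear.has_derivative[OF assms(1)] has_derivative_frechet)
  have "times_differentiable_on k S (\<lambda>x. frechet_derivative (\<lambda>x. L (f x)) (at x) h)" for h
    by (rule times_differentiable_on_cong[OF assms(2) Suc.IH])
      (use Suc.prems frechet_derivativeI[OF D] in auto)
  then show ?case using D by (auto intro: differentiableI)
qed

lemma times_differentiable_on_bilinear:
  assumes "bounded_bilinear m" "open S" "times_differentiable_on k S f" "times_differentiable_on k S g"
  shows "times_differentiable_on k S (\<lambda>x. m (f x) (g x))"
  using assms(3,4)
proof (induction k arbitrary: f g)
  case 0
  then show ?case
    by (auto intro: bounded_bilinear.continuous_on[OF assms(1)])
next
  case (Suc k)
  have D: "((\<lambda>x. m (f x) (g x)) has_derivative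
      (\<lambda>h. m (f x) (frechet_derivative g (at x) h) + m (frechet_derivative f (at x) h) (g x))) (at x)"
    if "x \<in> S" for x
    using Suc.prems that by (auto intro!: bounded_bilinear.FDERIV[OF assms(1)] has_derivative_frechet)
  have fg: "times_differentiable_on k S f" "times_differentiable_on k S g"
    using Suc.prems times_differentiable_on_SucD by blast+
  have "times_differentiable_on k S (\<lambda>x. frechet_derivative (\<lambda>x. m (f x) (g x)) (at x) h)" for h
    by (rule times_differentiable_on_cong[OF assms(2) times_differentiable_on_add[OF assms(2) Suc.IH Suc.IH],
          of f "\<lambda>x. frechet_derivative g (at x) h" "\<lambda>x. frechet_derivative f (at x) h" g])
      (use Suc.prems fg frechet_derivativeI[OF D] in auto)
  then show ?case using D by (auto intro: differentiableI)
qed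

text \<open>Higher differentiability is defined through fixed directions. When the direction varies
  with the point, this expansion turns the derivative into a sum of products with fixed
  directions.\<close>

lemma frechet_derivative_euclidean:
  fixes f :: "'a::euclidean_space \<Rightarrow> 'b::real_normed_vector"
  assumes "f differentiable (at x)"
  shows "frechet_derivative f (at x) h = (\<Sum>b\<in>Basis. (h \<bullet> b) *\<^sub>R frechet_derivative f (at x) b)"
proof -
  interpret linear "frechet_derivative f (at x)"
    using assms by (rule linear_frechet_derivative)
  have "frechet_derivative f (at x) h = frechet_derivative f (at x) (\<Sum>b\<in>Basis. (h \<bullet> b) *\<^sub>R b)"
    by (simp add: euclidean_representation)
  then show ?thesis by (simp add: sum scaleR)
qed

text \<open>The chain rule differentiates \<open>f\<close> along a direction that moves with
  \<open>x\<close>. Expanding it over \<open>Basis\<close> leaves components of the derivative of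
  \<open>g\<close> times directional derivatives of \<open>f\<close> composed with \<open>g\<close>;
  the induction hypothesis covers the latter because \<open>f\<close> is arbitrary in it.\<close>

lemma times_differentiable_on_compose:
  fixes g :: "'a::real_normed_vector \<Rightarrow> 'b::euclidean_space" and f :: "'b \<Rightarrow> 'c::real_normed_vector"
  assumes "open S" "open T" "g ` S \<subseteq> T" "times_differentiable_on k S g" "times_differentiable_on k T f"
  shows "times_differentiable_on k S (\<lambda>x. f (g x))"
  using assms(4,5)
proof (induction k arbitrary: f)
  case 0
  then show ?case
    using continuous_on_compose2[of T f S g] assms(3) by auto
next
  case (Suc k)
  have f: "f differentiable (at (g x))" and g: "g differentiable (at x)" if "x \<in> S" for x
    using Suc.prems that assms(3) by auto
  have D: "((\<lambda>x. f (g x)) has_derivative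
      (\<lambda>h. frechet_derivative f (at (g x)) (frechet_derivative g (at x) h))) (at x)" if "x \<in> S" for x
    by (rule has_derivative_compose[OF has_derivative_frechet[OF g] has_derivative_frechet[OF f]])
      (use that in auto)
  have "times_differentiable_on k S (\<lambda>x. frechet_derivative (\<lambda>x. f (g x)) (at x) h)" for h
  proof (rule times_differentiable_on_cong[OF assms(1)])
    show "times_differentiable_on k S (\<lambda>x. \<Sum>b\<in>Basis. (frechet_derivative g (at x) h \<bullet> b) *\<^sub>R
        frechet_derivative f (at (g x)) b)"
    proof (intro times_differentiable_on_sum[OF assms(1)]
        times_differentiable_on_bilinear[OF bounded_bilinear_scaleR assms(1)])
      fix b :: 'b
      show "times_differentiable_on k S (\<lambda>x. frechet_derivative g (at x) h \<bullet> b)"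
        using Suc.prems by (intro times_differentiable_on_linear[OF bounded_linear_inner_left assms(1)]) auto
      show "times_differentiable_on k S (\<lambda>x. frechet_derivative f (at (g x)) b)"
        using Suc.prems times_differentiable_on_SucD by (intro Suc.IH) auto
    qed
    show "(\<Sum>b\<in>Basis. (frechet_derivative g (at x) h \<bullet> b) *\<^sub>R frechet_derivative f (at (g x)) b) =
        frechet_derivative (\<lambda>x. f (g x)) (at x) h" if "x \<in> S" for x
      unfolding frechet_derivativeI[OF D[OF that]] by (rule frechet_derivative_euclidean[OF f[OF that], symmetric])
  qed
  then show ?case using D by (auto intro: differentiableI)
qed

text \<open>The derivative of \<open>1 / f\<close> is a product of \<open>1 / f\<close>, the
  derivative of \<open>f\<close> and \<open>1 / f\<close> again, so order \<open>k\<close> of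
  \<open>1 / f\<close> yields order \<open>Suc k\<close>.\<close>

lemma times_differentiable_on_inverse:
  fixes f :: "'a::real_normed_vector \<Rightarrow> real"
  assumes "open S" "times_differentiable_on k S f" "\<And>x. x \<in> S \<Longrightarrow> f x \<noteq> 0"
  shows "times_differentiable_on k S (\<lambda>x. inverse (f x))"
  using assms(2)
proof (induction k)
  case 0
  then show ?case using assms(3) by (auto intro: continuous_on_inverse)
next
  case (Suc k)
  have D: "((\<lambda>x. inverse (f x)) has_derivative
      (\<lambda>h. - (inverse (f x) * frechet_derivative f (at x) h * inverse (f x)))) (at x)" if "x \<in> S" for x
    using Suc.prems that assms(3) by (intro Deriv.has_derivative_inverse has_derivative_frechet) auto
  have IH: "times_differentiable_on k S (\<lambda>x. inverse (f x))"
    by (rule Suc.IH[OF times_differentiable_on_SucD[OF Suc.prems]])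
  note prod = times_differentiable_on_bilinear[OF bounded_bilinear_mult assms(1)]
  have "times_differentiable_on k S (\<lambda>x. frechet_derivative (\<lambda>x. inverse (f x)) (at x) h)" for h
    by (rule times_differentiable_on_cong[OF assms(1)
          times_differentiable_on_linear[OF bounded_linear_minus[OF bounded_linear_ident] assms(1)
            prod[OF prod[OF IH] IH], of "\<lambda>x. frechet_derivative f (at x) h"]])
      (use Suc.prems frechet_derivativeI[OF D] in auto)
  then show ?case using D by (auto intro: differentiableI)
qed

section \<open>Closure properties of smooth maps\<close>

lemma smooth_on_cong:
  "open S \<Longrightarrow> smooth_on S f \<Longrightarrow> (\<And>x. x \<in> S \<Longrightarrow> f x = g x) \<Longrightarrow> smooth_on S g"
  unfolding smooth_on_def
  by (rule allI, rule times_differentiable_on_cong[where f = f]) auto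

lemma smooth_on_subset: "smooth_on S f \<Longrightarrow> T \<subseteq> S \<Longrightarrow> smooth_on T f"
  unfolding smooth_on_def by (blast intro: times_differentiable_on_subset)

lemma smooth_on_differentiable: "smooth_on S f \<Longrightarrow> x \<in> S \<Longrightarrow> f differentiable (at x)"
  unfolding smooth_on_def by (drule spec[of _ "Suc 0"]) simp

lemma smooth_on_has_derivative:
  "smooth_on S f \<Longrightarrow> x \<in> S \<Longrightarrow> (f has_derivative frechet_derivative f (at x)) (at x)"
  by (blast intro: has_derivative_frechet smooth_on_differentiable)

lemma smooth_on_frechet: "smooth_on S f \<Longrightarrow> smooth_on S (\<lambda>x. frechet_derivative f (at x) h)"
  unfolding smooth_on_def
proof (intro allI)
  fix k
  assume "\<forall>k. times_differentiable_on k S f"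
  from this[THEN spec, of "Suc k"]
  show "times_differentiable_on k S (\<lambda>x. frechet_derivative f (at x) h)" by simp
qed

lemma smooth_on_const: "smooth_on S (\<lambda>x. c)"
  unfolding smooth_on_def by (blast intro: times_differentiable_on_const)

lemma smooth_on_add:
  "open S \<Longrightarrow> smooth_on S f \<Longrightarrow> smooth_on S g \<Longrightarrow> smooth_on S (\<lambda>x. f x + g x)"
  unfolding smooth_on_def
  by (rule allI, rule times_differentiable_on_add[where f = f and g = g]) auto

lemma smooth_on_sum:
  "open S \<Longrightarrow> (\<And>i. i \<in> I \<Longrightarrow> smooth_on S (f i)) \<Longrightarrow> smooth_on S (\<lambda>x. \<Sum>i\<in>I. f i x)"
  unfolding smooth_on_def
  by (rule allI, rule times_differentiable_on_sum[where f = f and I = I]) auto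

lemma smooth_on_linear:
  "bounded_linear L \<Longrightarrow> open S \<Longrightarrow> smooth_on S f \<Longrightarrow> smooth_on S (\<lambda>x. L (f x))"
  unfolding smooth_on_def
  by (rule allI, rule times_differentiable_on_linear[where L = L and f = f]) auto

lemma smooth_on_bilinear:
  "bounded_bilinear m \<Longrightarrow> open S \<Longrightarrow> smooth_on S f \<Longrightarrow> smooth_on S g \<Longrightarrow>
    smooth_on S (\<lambda>x. m (f x) (g x))"
  unfolding smooth_on_def
  by (rule allI, rule times_differentiable_on_bilinear[where m = m and f = f and g = g]) auto

lemmas smooth_on_scaleR = smooth_on_bilinear[OF bounded_bilinear_scaleR]

lemmas smooth_on_mult = smooth_on_bilinear[OF bounded_bilinear_mult]

lemmas smooth_on_minus = smooth_on_linear[OF bounded_linear_minus[OF bounded_linear_ident]]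

lemmas smooth_on_fst = smooth_on_linear[OF bounded_linear_fst]

lemmas smooth_on_snd = smooth_on_linear[OF bounded_linear_snd]

lemmas smooth_on_nth = smooth_on_linear[OF bounded_linear_vec_nth]

lemma smooth_on_diff:
  assumes "open S" "smooth_on S f" "smooth_on S g"
  shows "smooth_on S (\<lambda>x. f x - g x)"
  using smooth_on_add[OF assms(1,2) smooth_on_minus[OF assms(1,3)]] by simp

lemma smooth_on_id: "open S \<Longrightarrow> smooth_on S (\<lambda>x. x)"
  unfolding smooth_on_def
proof
  show "times_differentiable_on k S (\<lambda>x. x)" for k
    by (cases k) (auto intro: times_differentiable_on_const)
qed

lemma smooth_on_compose:
  fixes g :: "'a::real_normed_vector \<Rightarrow> 'b::euclidean_space"
  shows "open S \<Longrightarrow> open T \<Longrightarrow> g ` S \<subseteq> T \<Longrightarrow> smooth_on S g \<Longrightarrow> smooth_on T f \<Longrightarrow>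
    smooth_on S (\<lambda>x. f (g x))"
  unfolding smooth_on_def
  by (rule allI, rule times_differentiable_on_compose[where g = g and f = f and T = T]) auto

lemma smooth_on_inverse:
  fixes f :: "'a::real_normed_vector \<Rightarrow> real"
  shows "open S \<Longrightarrow> smooth_on S f \<Longrightarrow> (\<And>x. x \<in> S \<Longrightarrow> f x \<noteq> 0) \<Longrightarrow> smooth_on S (\<lambda>x. inverse (f x))"
  unfolding smooth_on_def
  by (rule allI, rule times_differentiable_on_inverse[where f = f]) auto

lemma smooth_on_prod:
  fixes f :: "'i \<Rightarrow> 'a::real_normed_vector \<Rightarrow> real"
  assumes "open S" "\<And>i. i \<in> I \<Longrightarrow> smooth_on S (f i)"
  shows "smooth_on S (\<lambda>x. \<Prod>i\<in>I. f i x)"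
  using assms(2)
proof (induction I rule: infinite_finite_induct)
  case (insert i I)
  then show ?case
    using smooth_on_mult[OF assms(1), of "f i" "\<lambda>x. \<Prod>i\<in>I. f i x"] by simp
next
  case (infinite I)
  then show ?case unfolding prod.infinite[OF infinite(1)] by (intro smooth_on_const)
next
  case empty
  show ?case unfolding prod.empty by (rule smooth_on_const)
qed

lemma smooth_on_Pair:
  assumes "open S" "smooth_on S f" "smooth_on S g"
  shows "smooth_on S (\<lambda>x. (f x, g x))"
proof -
  have "bounded_linear (\<lambda>x. (x, 0))" "bounded_linear (\<lambda>x. (0, x))"
    by (auto intro: bounded_linear_Pair bounded_linear_ident bounded_linear_zero)
  then show ?thesis
    using smooth_on_add[OF assms(1) smooth_on_linear[OF _ assms(1,2)] smooth_on_linear[OF _ assms(1,3)],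
        of "\<lambda>x. (x, 0)" "\<lambda>x. (0, x)"] by simp
qed

lemma smooth_on_euclidean:
  fixes f :: "'a::real_normed_vector \<Rightarrow> 'b::euclidean_space"
  assumes "open S" "\<And>b. b \<in> Basis \<Longrightarrow> smooth_on S (\<lambda>x. f x \<bullet> b)"
  shows "smooth_on S f"
proof -
  have "smooth_on S (\<lambda>x. \<Sum>b\<in>Basis. (f x \<bullet> b) *\<^sub>R b)"
    using assms by (intro smooth_on_sum smooth_on_scaleR smooth_on_const) auto
  then show ?thesis by (simp add: euclidean_representation)
qed

lemma smooth_on_vec:
  fixes f :: "'a::real_normed_vector \<Rightarrow> real^'b"
  assumes "open S" "\<And>i. smooth_on S (\<lambda>x. f x $ i)"
  shows "smooth_on S f"
proof (rule smooth_on_euclidean[OF assms(1)])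
  fix b :: "real^'b"
  assume "b \<in> Basis"
  then obtain i where b: "b = axis i 1"
    by (auto simp: Basis_vec_def)
  show "smooth_on S (\<lambda>x. f x \<bullet> b)"
    using assms(2)[of i] unfolding b inner_axis by simp
qed

text \<open>The case in which base point and direction both vary, as they do in the tangent map of a
  coordinate change.\<close>

lemma smooth_on_frechet_apply:
  fixes f :: "'a::euclidean_space \<Rightarrow> 'b::real_normed_vector"
  assumes "open S" "smooth_on S f" "open T" "smooth_on T g" "smooth_on T h" "g ` T \<subseteq> S"
  shows "smooth_on T (\<lambda>x. frechet_derivative f (at (g x)) (h x))"
proof (rule smooth_on_cong[OF assms(3)])
  show "smooth_on T (\<lambda>x. \<Sum>b\<in>Basis. (h x \<bullet> b) *\<^sub>R frechet_derivative f (at (g x)) b)"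
    by (intro smooth_on_sum smooth_on_scaleR assms smooth_on_linear[OF bounded_linear_inner_left]
        smooth_on_compose[OF assms(3,1,6,4) smooth_on_frechet[OF assms(2)]])
  show "(\<Sum>b\<in>Basis. (h x \<bullet> b) *\<^sub>R frechet_derivative f (at (g x)) b) =
      frechet_derivative f (at (g x)) (h x)" if "x \<in> T" for x
    by (rule frechet_derivative_euclidean[symmetric])
      (use assms(2,6) that in \<open>auto intro: smooth_on_differentiable\<close>)
qed

section \<open>Smoothness of determinants and of inverse matrices\<close>

lemma smooth_on_det:
  fixes A :: "'a::real_normed_vector \<Rightarrow> real^'n^'n"
  assumes "open S" "\<And>i j. smooth_on S (\<lambda>x. A x $ i $ j)"
  shows "smooth_on S (\<lambda>x. det (A x))"
  unfolding det_def by (intro smooth_on_sum smooth_on_mult smooth_on_prod smooth_on_const assms)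

lemma matrix_inv_mult:
  fixes A :: "real^'n^'n"
  assumes "invertible A"
  shows "A ** matrix_inv A = mat 1" "matrix_inv A ** A = mat 1"
  using someI_ex[OF assms[unfolded invertible_def]] by (auto simp: matrix_inv_def)

text \<open>Column \<open>l\<close> of the inverse solves \<open>A *v x = axis l 1\<close>, and
  Cramer's rule gives its entries as rational functions of the entries of \<open>A\<close>.\<close>

lemma matrix_inv_nth:
  fixes A :: "real^'n^'n"
  assumes "invertible A"
  shows "matrix_inv A $ k $ l = det (\<chi> i j. if j = k then axis l 1 $ i else A $ i $ j) * inverse (det A)"
proof -
  have "A *v (matrix_inv A *v axis l 1) = axis l 1"
    by (simp add: matrix_vector_mul_assoc matrix_inv_mult[OF assms])
  then have "matrix_inv A *v axis l 1 =
      (\<chi> k. det (\<chi> i j. if j = k then axis l 1 $ i else A $ i $ j) / det A)"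
    using cramer[of A] assms invertible_det_nz by blast
  moreover have "(matrix_inv A *v axis l 1) $ k = matrix_inv A $ k $ l"
    by (simp add: matrix_vector_mul_component inner_axis)
  ultimately show ?thesis by (simp add: divide_inverse)
qed

lemma smooth_on_matrix_inv:
  fixes A :: "'a::real_normed_vector \<Rightarrow> real^'n^'n"
  assumes "open S" "\<And>i j. smooth_on S (\<lambda>x. A x $ i $ j)" "\<And>x. x \<in> S \<Longrightarrow> invertible (A x)"
  shows "smooth_on S (\<lambda>x. matrix_inv (A x) $ k $ l)"
proof (rule smooth_on_cong[OF assms(1)])
  have "smooth_on S (\<lambda>x. (\<chi> i j. if j = k then axis l 1 $ i else A x $ i $ j) $ i $ j)" for i j
    using assms(2) smooth_on_const by (cases "j = k") auto
  then show "smooth_on S (\<lambda>x. det (\<chi> i j. if j = k then axis l 1 $ i else A x $ i $ j) * inverse (det (A x)))"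
    using assms by (intro smooth_on_mult smooth_on_inverse smooth_on_det) (auto simp: invertible_det_nz)
qed (simp add: matrix_inv_nth assms(3))

section \<open>Symmetry of second derivatives\<close>

lemma second_difference_mean_value:
  fixes f :: "'a::real_normed_vector \<Rightarrow> real"
  assumes "smooth_on S f" "0 \<le> t"
    and S: "\<And>s r. s \<in> {0..t} \<Longrightarrow> r \<in> {0..t} \<Longrightarrow> x + s *\<^sub>R u + r *\<^sub>R v \<in> S"
  shows "\<exists>s\<in>{0..t}. \<exists>r\<in>{0..t}. f (x + t *\<^sub>R u + t *\<^sub>R v) - f (x + t *\<^sub>R u) - f (x + t *\<^sub>R v) + f x =
    frechet_derivative (\<lambda>z. frechet_derivative f (at z) u) (at (x + s *\<^sub>R u + r *\<^sub>R v)) v * t * t"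
proof -
  note f = smooth_on_has_derivative[OF assms(1)]
  have lin: "linear (frechet_derivative f (at z))" if "z \<in> S" for z
    using f[OF that] has_derivative_linear by blast
  have D: "((\<lambda>s. f (x + s *\<^sub>R u + r *\<^sub>R v)) has_derivative
      (\<lambda>h. h * frechet_derivative f (at (x + s *\<^sub>R u + r *\<^sub>R v)) u)) (at s within {0..t})"
    if "s \<in> {0..t}" "r \<in> {0..t}" for s r
  proof -
    have "((\<lambda>s. x + s *\<^sub>R u + r *\<^sub>R v) has_derivative (\<lambda>h. h *\<^sub>R u)) (at s within {0..t})"
      by (auto intro!: derivative_eq_intros)
    from has_derivative_compose[OF this f[OF S[OF that]]]
    show ?thesis using lin[OF S[OF that]] by (simp add: linear_scale)
  qed
  have D2: "((\<lambda>r. frechet_derivative f (at (x + s *\<^sub>R u + r *\<^sub>R v)) u) has_derivative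
      (\<lambda>h. h * frechet_derivative (\<lambda>z. frechet_derivative f (at z) u) (at (x + s *\<^sub>R u + r *\<^sub>R v)) v))
      (at r within {0..t})"
    if "s \<in> {0..t}" "r \<in> {0..t}" for s r
  proof -
    note f2 = smooth_on_has_derivative[OF smooth_on_frechet[OF assms(1)] S[OF that], of u]
    have "((\<lambda>r. x + s *\<^sub>R u + r *\<^sub>R v) has_derivative (\<lambda>h. h *\<^sub>R v)) (at r within {0..t})"
      by (auto intro!: derivative_eq_intros)
    from has_derivative_compose[OF this f2]
    show ?thesis using has_derivative_linear[OF f2] by (simp add: linear_scale)
  qed
  \<comment> \<open>The increment of this function of \<open>s\<close> over \<open>[0, t]\<close> is
    the second difference. The mean value theorem in \<open>s\<close> brings out one factor
    \<open>t\<close> and a derivative along \<open>u\<close>; a second application, in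
    \<open>r\<close>, brings out the other factor and a derivative along \<open>v\<close>.\<close>
  have "((\<lambda>s. f (x + s *\<^sub>R u + t *\<^sub>R v) - f (x + s *\<^sub>R u)) has_derivative
      (\<lambda>h. h * frechet_derivative f (at (x + s *\<^sub>R u + t *\<^sub>R v)) u -
        h * frechet_derivative f (at (x + s *\<^sub>R u)) u)) (at s within {0..t})" if "s \<in> {0..t}" for s
    using has_derivative_diff[OF D[OF that, of t] D[OF that, of 0]] assms(2) by simp
  from mvt_very_simple[OF assms(2) this]
  obtain s where s: "s \<in> {0..t}"
    and 1: "f (x + t *\<^sub>R u + t *\<^sub>R v) - f (x + t *\<^sub>R u) - (f (x + t *\<^sub>R v) - f x) =
      t * frechet_derivative f (at (x + s *\<^sub>R u + t *\<^sub>R v)) u - t * frechet_derivative f (at (x + s *\<^sub>R u)) u"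
    by auto
  from mvt_very_simple[OF assms(2) D2[OF s]]
  obtain r where r: "r \<in> {0..t}"
    and 2: "frechet_derivative f (at (x + s *\<^sub>R u + t *\<^sub>R v)) u - frechet_derivative f (at (x + s *\<^sub>R u)) u =
      t * frechet_derivative (\<lambda>z. frechet_derivative f (at z) u) (at (x + s *\<^sub>R u + r *\<^sub>R v)) v"
    by auto
  have "f (x + t *\<^sub>R u + t *\<^sub>R v) - f (x + t *\<^sub>R u) - f (x + t *\<^sub>R v) + f x =
      t * (frechet_derivative f (at (x + s *\<^sub>R u + t *\<^sub>R v)) u - frechet_derivative f (at (x + s *\<^sub>R u)) u)"
    using 1 by (simp add: algebra_simps)
  then show ?thesis using s r unfolding 2 by (intro bexI[of _ s] bexI[of _ r]) auto
qed

lemma smooth_on_continuous: "smooth_on S f \<Longrightarrow> continuous_on S f"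
  unfolding smooth_on_def by (drule spec[of _ 0]) simp

text \<open>The second difference is symmetric in \<open>u\<close> and \<open>v\<close>, while the
  mean value form expresses it through either mixed derivative at a point close to \<open>x\<close>.
  Continuity of both mixed derivatives then forces equality at \<open>x\<close>.\<close>

lemma second_derivative_symmetric_real:
  fixes f :: "'a::real_normed_vector \<Rightarrow> real"
  assumes "open S" "smooth_on S f" "x \<in> S"
  shows "frechet_derivative (\<lambda>z. frechet_derivative f (at z) u) (at x) v =
    frechet_derivative (\<lambda>z. frechet_derivative f (at z) v) (at x) u" (is "?A x = ?B x")
proof (rule ccontr)
  define A where "A = ?A"
  define B where "B = ?B"
  assume "?A x \<noteq> ?B x"
  then have neq: "A x \<noteq> B x" by (simp add: A_def B_def)
  \<comment> \<open>Half of the gap: the open intervals of this radius around the two values are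
    disjoint.\<close>
  define \<epsilon> where "\<epsilon> = \<bar>A x - B x\<bar> / 2"
  have \<epsilon>: "0 < \<epsilon>" using neq by (simp add: \<epsilon>_def)
  have "isCont A x" "isCont B x"
    unfolding A_def B_def
    using smooth_on_continuous[OF smooth_on_frechet[OF smooth_on_frechet[OF assms(2)]]]
      assms(1,3) continuous_on_eq_continuous_at by blast+
  then obtain d1 d2 where d1: "0 < d1" "\<And>z. dist z x < d1 \<Longrightarrow> dist (A z) (A x) < \<epsilon>"
    and d2: "0 < d2" "\<And>z. dist z x < d2 \<Longrightarrow> dist (B z) (B x) < \<epsilon>"
    unfolding continuous_at_eps_delta using \<epsilon> by blast
  obtain d3 where d3: "0 < d3" "\<And>z. dist z x < d3 \<Longrightarrow> z \<in> S"
    using assms(1,3) unfolding open_dist by blast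
  define d where "d = min d1 (min d2 d3)"
  \<comment> \<open>Small enough that the parallelogram spanned by \<open>t u\<close> and
    \<open>t v\<close> at \<open>x\<close> stays within \<open>d / 2\<close> of \<open>x\<close>;
    the added 1 keeps the denominator positive when both vectors vanish.\<close>
  define t where "t = d / (2 * (norm u + norm v + 1))"
  have d: "0 < d" using d1 d2 d3 by (simp add: d_def)
  have t: "0 < t" unfolding t_def using d by (intro divide_pos_pos) (auto intro: add_nonneg_pos)
  have near: "dist (x + s *\<^sub>R u + r *\<^sub>R v) x < d" if "s \<in> {0..t}" "r \<in> {0..t}" for s r
  proof -
    have "dist (x + s *\<^sub>R u + r *\<^sub>R v) x \<le> norm (s *\<^sub>R u) + norm (r *\<^sub>R v)"
      using norm_triangle_ineq[of "s *\<^sub>R u" "r *\<^sub>R v"] by (simp add: dist_norm add.assoc)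
    also have "\<dots> \<le> t * norm u + t * norm v"
      using that by (auto intro!: add_mono mult_right_mono)
    also have "\<dots> \<le> t * (norm u + norm v + 1)"
      using t by (simp add: algebra_simps)
    also have "\<dots> = d / 2"
    proof -
      have "norm u + norm v + 1 \<noteq> 0"
        using norm_ge_zero[of u] norm_ge_zero[of v] by linarith
      moreover have "d / (2 * c) * c = d / 2" if "c \<noteq> 0" for c :: real
        using that by simp
      ultimately show ?thesis unfolding t_def by blast
    qed
    finally show ?thesis using d by simp
  qed
  have S: "x + s *\<^sub>R u + r *\<^sub>R v \<in> S" "x + s *\<^sub>R v + r *\<^sub>R u \<in> S" if "s \<in> {0..t}" "r \<in> {0..t}" for s r
    using d3(2)[of "x + s *\<^sub>R u + r *\<^sub>R v"] d3(2)[of "x + s *\<^sub>R v + r *\<^sub>R u"] near[OF that] near[OF that(2,1)]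
    by (simp_all add: d_def add_ac)
  obtain s r where sr: "s \<in> {0..t}" "r \<in> {0..t}"
    and 1: "f (x + t *\<^sub>R u + t *\<^sub>R v) - f (x + t *\<^sub>R u) - f (x + t *\<^sub>R v) + f x = A (x + s *\<^sub>R u + r *\<^sub>R v) * t * t"
    using second_difference_mean_value[OF assms(2) less_imp_le[OF t] S(1)] unfolding A_def by blast
  obtain s' r' where sr': "s' \<in> {0..t}" "r' \<in> {0..t}"
    and 2: "f (x + t *\<^sub>R v + t *\<^sub>R u) - f (x + t *\<^sub>R v) - f (x + t *\<^sub>R u) + f x = B (x + s' *\<^sub>R v + r' *\<^sub>R u) * t * t"
    using second_difference_mean_value[OF assms(2) less_imp_le[OF t] S(2)] unfolding B_def by blast
  have "x + t *\<^sub>R v + t *\<^sub>R u = x + t *\<^sub>R u + t *\<^sub>R v" by (simp add: algebra_simps)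
  then have "A (x + s *\<^sub>R u + r *\<^sub>R v) * t * t = B (x + s' *\<^sub>R v + r' *\<^sub>R u) * t * t"
    using 1 2 by (smt (verit))
  then have "A (x + s *\<^sub>R u + r *\<^sub>R v) = B (x + s' *\<^sub>R v + r' *\<^sub>R u)"
    using t by simp
  moreover have "dist (A (x + s *\<^sub>R u + r *\<^sub>R v)) (A x) < \<epsilon>"
    using near[OF sr] by (intro d1(2)) (simp add: d_def)
  moreover have "dist (B (x + s' *\<^sub>R v + r' *\<^sub>R u)) (B x) < \<epsilon>"
    using near[OF sr'(2,1)] by (intro d2(2)) (simp add: d_def add_ac)
  ultimately show False
    unfolding \<epsilon>_def dist_real_def by (auto simp: abs_if split: if_splits)
qed

text \<open>The inner product with a basis vector is bounded linear and commutes with both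
  differentiations, which reduces the claim to real-valued components.\<close>

proposition second_derivative_symmetric:
  fixes f :: "'a::real_normed_vector \<Rightarrow> 'b::euclidean_space"
  assumes "open S" "smooth_on S f" "x \<in> S"
  shows "frechet_derivative (\<lambda>z. frechet_derivative f (at z) u) (at x) v =
    frechet_derivative (\<lambda>z. frechet_derivative f (at z) v) (at x) u"
proof (rule euclidean_eqI)
  fix b :: 'b
  have "frechet_derivative (\<lambda>z. frechet_derivative (\<lambda>z. f z \<bullet> b) (at z) h) (at x) k =
      frechet_derivative (\<lambda>z. frechet_derivative f (at z) h) (at x) k \<bullet> b" for h k
  proof -
    have 1: "((\<lambda>z. frechet_derivative f (at z) h \<bullet> b) has_derivative
        (\<lambda>k. frechet_derivative (\<lambda>z. frechet_derivative f (at z) h) (at x) k \<bullet> b)) (at x)"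
      by (rule has_derivative_inner_left[OF smooth_on_has_derivative[OF smooth_on_frechet[OF assms(2)] assms(3)]])
    have 2: "frechet_derivative f (at z) h \<bullet> b = frechet_derivative (\<lambda>z. f z \<bullet> b) (at z) h" if "z \<in> S" for z
      by (rule frechet_derivativeI[symmetric])
        (rule has_derivative_inner_left[OF smooth_on_has_derivative[OF assms(2) that]])
    show ?thesis
      by (rule frechet_derivativeI) (rule has_derivative_transform_within_open[OF 1 assms(1,3) 2])
  qed
  then show "frechet_derivative (\<lambda>z. frechet_derivative f (at z) u) (at x) v \<bullet> b =
      frechet_derivative (\<lambda>z. frechet_derivative f (at z) v) (at x) u \<bullet> b"
    using second_derivative_symmetric_real[OF assms(1) smooth_on_linear[OF bounded_linear_inner_left assms(1,2)] assms(3)]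
    by metis
qed

section \<open>Charts and tangent vectors\<close>

lemma smooth_atlas_inj: "smooth_atlas M A \<Longrightarrow> c \<in> A \<Longrightarrow> inj_on (snd c) (fst c)"
  by (simp add: smooth_atlas_def)

lemma local_rep_apply: "inj_on (snd c) (fst c) \<Longrightarrow> p \<in> fst c \<Longrightarrow> local_rep c f (snd c p) = f p"
  by (simp add: local_rep_def)

lemma transition_apply:
  "smooth_atlas M A \<Longrightarrow> c \<in> A \<Longrightarrow> p \<in> fst c \<Longrightarrow> transition c d (snd c p) = snd d p"
  unfolding transition_def by (rule local_rep_apply[OF smooth_atlas_inj])

lemma transition_smooth:
  "smooth_atlas M A \<Longrightarrow> c \<in> A \<Longrightarrow> d \<in> A \<Longrightarrow>
    smooth_on (snd c ` (fst c \<inter> fst d)) (transition c d)"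
  by (simp add: smooth_atlas_def)

lemma openin_chart_domain:
  assumes "smooth_atlas M A" "c \<in> A"
  shows "openin (atlas_topology M A) (fst c)"
  using assms unfolding openin_atlas_topology[OF assms(1)] smooth_atlas_def by blast

lemma open_chart_image:
  "smooth_atlas M A \<Longrightarrow> c \<in> A \<Longrightarrow> openin (atlas_topology M A) S \<Longrightarrow> open (snd c ` (fst c \<inter> S))"
  using openin_atlas_topology by blast

lemma openin_subset_base: "smooth_atlas M A \<Longrightarrow> openin (atlas_topology M A) S \<Longrightarrow> S \<subseteq> M"
  using openin_atlas_topology by blast

lemma transition_has_derivative:
  assumes "smooth_atlas M A" "c \<in> A" "d \<in> A" "p \<in> fst c" "p \<in> fst d"
  shows "(transition c d has_derivative frechet_derivative (transition c d) (at (snd c p))) (at (snd c p))"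
  using assms by (intro smooth_on_has_derivative[OF transition_smooth[OF assms(1-3)]]) auto

text \<open>The cocycle rule for Jacobians. By it \<open>coord_vec\<close> is a compatible family of
  components, and the Jacobian of the reverse transition is an inverse. The composite is compared
  with the direct transition on the image of the triple overlap, which is open.\<close>

lemma frechet_transition_trans:
  assumes A: "smooth_atlas M A" and c: "c \<in> A" "d \<in> A" "e \<in> A"
    and p: "p \<in> fst c" "p \<in> fst d" "p \<in> fst e"
  shows "frechet_derivative (transition d e) (at (snd d p))
      (frechet_derivative (transition c d) (at (snd c p)) h) =
    frechet_derivative (transition c e) (at (snd c p)) h"
proof (rule frechet_derivativeI[symmetric])
  let ?U = "snd c ` (fst c \<inter> (fst d \<inter> fst e))"
  have U: "open ?U"
    by (intro open_chart_image[OF A c(1)] openin_Int openin_chart_domain[OF A] c)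
  show "(transition c e has_derivative (\<lambda>h. frechet_derivative (transition d e) (at (snd d p))
      (frechet_derivative (transition c d) (at (snd c p)) h))) (at (snd c p))"
  proof (rule has_derivative_transform_within_open[OF _ U])
    show "((\<lambda>x. transition d e (transition c d x)) has_derivative
        (\<lambda>h. frechet_derivative (transition d e) (at (snd d p))
          (frechet_derivative (transition c d) (at (snd c p)) h))) (at (snd c p))"
      using transition_has_derivative[OF A c(2,3) p(2,3)]
      by (intro has_derivative_compose[OF transition_has_derivative[OF A c(1,2) p(1,2)]])
        (simp add: transition_apply[OF A c(1) p(1)])
    show "transition d e (transition c d x) = transition c e x" if "x \<in> ?U" for x
      using that by (auto simp: transition_apply[OF A] c)
    show "snd c p \<in> ?U" using p by blast
  qed
qed

lemma tangent_spaceI: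
  assumes "\<And>c. \<not> (c \<in> A \<and> p \<in> fst c) \<Longrightarrow> X c = 0"
    and "\<And>c d. c \<in> A \<Longrightarrow> d \<in> A \<Longrightarrow> p \<in> fst c \<Longrightarrow> p \<in> fst d \<Longrightarrow>
      X d = frechet_derivative (transition c d) (at (snd c p)) (X c)"
  shows "X \<in> tangent_space A p"
  unfolding tangent_space_def using assms by blast

lemma tangent_vec_transition:
  "X \<in> tangent_space A p \<Longrightarrow> c \<in> A \<Longrightarrow> d \<in> A \<Longrightarrow> p \<in> fst c \<Longrightarrow> p \<in> fst d \<Longrightarrow>
    X d = frechet_derivative (transition c d) (at (snd c p)) (X c)"
  unfolding tangent_space_def by blast

lemma tangent_vec_outside: "X \<in> tangent_space A p \<Longrightarrow> \<not> (c \<in> A \<and> p \<in> fst c) \<Longrightarrow> X c = 0"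
  unfolding tangent_space_def by blast

lemma coord_vec_in_tangent_space:
  assumes A: "smooth_atlas M A" and c: "c \<in> A" "p \<in> fst c"
  shows "coord_vec A c p h \<in> tangent_space A p"
proof (rule tangent_spaceI)
  fix d e assume "d \<in> A" "e \<in> A" "p \<in> fst d" "p \<in> fst e"
  then show "coord_vec A c p h e = frechet_derivative (transition d e) (at (snd d p)) (coord_vec A c p h d)"
    unfolding coord_vec_def using frechet_transition_trans[OF A c(1) _ _ c(2)] by simp
qed (auto simp: coord_vec_def)

text \<open>The components in the other charts around \<open>p\<close> are images of the one in
  \<open>c\<close>, and at all remaining charts both families are 0.\<close>

lemma tangent_vec_eqI:
  assumes "X \<in> tangent_space A p" "Y \<in> tangent_space A p" "c \<in> A" "p \<in> fst c" "X c = Y c"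
  shows "X = Y"
proof
  fix d
  show "X d = Y d"
  proof (cases "d \<in> A \<and> p \<in> fst d")
    case True
    then show ?thesis
      using tangent_vec_transition[OF assms(1,3) _ assms(4)] tangent_vec_transition[OF assms(2,3) _ assms(4)]
        assms(5) by metis
  next
    case False
    then show ?thesis using tangent_vec_outside assms(1,2) by metis
  qed
qed

lemma subspace_tangent_space:
  assumes "smooth_atlas M A"
  shows "subspace (tangent_space A p)"
proof (rule subspaceI)
  note lin = has_derivative_linear[OF transition_has_derivative[OF assms]]
  show "0 \<in> tangent_space A p"
    by (rule tangent_spaceI) (simp_all add: linear_0[OF lin])
  show "X + Y \<in> tangent_space A p" if X: "X \<in> tangent_space A p" and Y: "Y \<in> tangent_space A p" for X Y
  proof (rule tangent_spaceI)
    fix c d assume c: "c \<in> A" "d \<in> A" "p \<in> fst c" "p \<in> fst d"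
    show "(X + Y) d = frechet_derivative (transition c d) (at (snd c p)) ((X + Y) c)"
      unfolding plus_fun_apply linear_add[OF lin[OF c]]
      using tangent_vec_transition[OF X c] tangent_vec_transition[OF Y c] by simp
  qed (simp add: tangent_vec_outside[OF X] tangent_vec_outside[OF Y])
  show "r *\<^sub>R X \<in> tangent_space A p" if X: "X \<in> tangent_space A p" for r X
  proof (rule tangent_spaceI)
    fix c d assume c: "c \<in> A" "d \<in> A" "p \<in> fst c" "p \<in> fst d"
    show "(r *\<^sub>R X) d = frechet_derivative (transition c d) (at (snd c p)) ((r *\<^sub>R X) c)"
      unfolding scaleR_fun_def linear_scale[OF lin[OF c]]
      using tangent_vec_transition[OF X c] by simp
  qed (simp add: tangent_vec_outside[OF X] scaleR_fun_def)
qed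

text \<open>\<open>smooth_fun\<close> speaks of all charts. Inside the domain of a single chart
  \<open>c\<close> the other local representatives differ from \<open>g\<close> by a smooth
  transition map, so the formula in \<open>c\<close> is enough.\<close>

lemma smooth_fun_in_chart:
  assumes A: "smooth_atlas M A" and c: "c \<in> A" and S: "openin (atlas_topology M A) S" "S \<subseteq> fst c"
    and g: "open T" "smooth_on T g" "\<And>p. p \<in> S \<Longrightarrow> snd c p \<in> T" "\<And>p. p \<in> S \<Longrightarrow> f p = g (snd c p)"
  shows "smooth_fun A S f"
  unfolding smooth_fun_def
proof
  fix d assume d: "d \<in> A"
  have U: "open (snd d ` (fst d \<inter> S))" by (rule open_chart_image[OF A d S(1)])
  show "smooth_on (snd d ` (fst d \<inter> S)) (local_rep d f)"
  proof (rule smooth_on_cong[OF U])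
    show "smooth_on (snd d ` (fst d \<inter> S)) (\<lambda>x. g (transition d c x))"
    proof (rule smooth_on_compose[OF U g(1) _ _ g(2)])
      show "transition d c ` snd d ` (fst d \<inter> S) \<subseteq> T"
        using g(3) by (auto simp: transition_apply[OF A d])
      show "smooth_on (snd d ` (fst d \<inter> S)) (transition d c)"
        by (rule smooth_on_subset[OF transition_smooth[OF A d c]]) (use S(2) in auto)
    qed
    show "g (transition d c x) = local_rep d f x" if "x \<in> snd d ` (fst d \<inter> S)" for x
      using that g(4) by (auto simp: transition_apply[OF A d] local_rep_apply[OF smooth_atlas_inj[OF A d]])
  qed
qed


section \<open>Coordinates on the total space of a vector bundle\<close>

lemma vector_bundleD:
  assumes "vector_bundle M A V B"
  shows "\<And>p. p \<in> M \<Longrightarrow> subspace (V p)"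
    and "(\<Union>t\<in>B. fst t) = M"
    and "\<And>t. t \<in> B \<Longrightarrow> openin (atlas_topology M A) (fst t)"
    and "\<And>t p. t \<in> B \<Longrightarrow> p \<in> fst t \<Longrightarrow> linear_between (V p) UNIV (snd t p)"
    and "\<And>t p. t \<in> B \<Longrightarrow> p \<in> fst t \<Longrightarrow> bij_betw (snd t p) (V p) UNIV"
    and "\<And>t t' \<xi>. t \<in> B \<Longrightarrow> t' \<in> B \<Longrightarrow>
      smooth_fun A (fst t \<inter> fst t') (\<lambda>p. snd t' p (triv_vec V t \<xi> p))"
  using assms unfolding vector_bundle_def by blast+

text \<open>The part of \<open>vector_bundle\<close> that concerns one trivialization at one point.
  It is what the gluing argument asks of the fibres, and the prolongation is handled through
  it.\<close>

definition triv_at :: "('p \<Rightarrow> 'v::real_vector set) \<Rightarrow> ('p, 'v, 'f::euclidean_space) triv \<Rightarrow> 'p \<Rightarrow> bool" where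
  "triv_at V t p \<longleftrightarrow> subspace (V p) \<and> linear_between (V p) UNIV (snd t p) \<and> bij_betw (snd t p) (V p) UNIV"

lemma vector_bundle_triv_at:
  assumes "vector_bundle M A V B" "t \<in> B" "p \<in> fst t"
  shows "triv_at V t p"
proof -
  have "p \<in> M" using vector_bundleD(2)[OF assms(1)] assms(2,3) by blast
  then show ?thesis
    unfolding triv_at_def
    using vector_bundleD(1)[OF assms(1)] vector_bundleD(4,5)[OF assms] by blast
qed

lemma triv_vec_in: "triv_at V t p \<Longrightarrow> triv_vec V t \<xi> p \<in> V p"
  unfolding triv_vec_def triv_at_def by (metis UNIV_I bij_betw_def inv_into_into)

lemma triv_triv_vec: "triv_at V t p \<Longrightarrow> snd t p (triv_vec V t \<xi> p) = \<xi>"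
  unfolding triv_vec_def triv_at_def by (metis UNIV_I bij_betw_def f_inv_into_f)

lemma triv_vec_triv: "triv_at V t p \<Longrightarrow> v \<in> V p \<Longrightarrow> triv_vec V t (snd t p v) p = v"
  unfolding triv_vec_def triv_at_def by (metis bij_betw_def inv_into_f_f)

lemma triv_eqI:
  "triv_at V t p \<Longrightarrow> v \<in> V p \<Longrightarrow> w \<in> V p \<Longrightarrow> snd t p v = snd t p w \<Longrightarrow> v = w"
  by (metis triv_vec_triv)

lemma triv_at_subspace: "triv_at V t p \<Longrightarrow> subspace (V p)"
  by (simp add: triv_at_def)

lemma triv_add: "triv_at V t p \<Longrightarrow> v \<in> V p \<Longrightarrow> w \<in> V p \<Longrightarrow> snd t p (v + w) = snd t p v + snd t p w"
  by (simp add: triv_at_def linear_between_def)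

lemma triv_scaleR: "triv_at V t p \<Longrightarrow> v \<in> V p \<Longrightarrow> snd t p (r *\<^sub>R v) = r *\<^sub>R snd t p v"
  by (simp add: triv_at_def linear_between_def)

lemma triv_vec_add: "triv_at V t p \<Longrightarrow> triv_vec V t (\<xi> + \<eta>) p = triv_vec V t \<xi> p + triv_vec V t \<eta> p"
  by (rule triv_eqI[of V t p])
    (simp_all add: triv_vec_in triv_triv_vec triv_add subspace_add triv_at_subspace)

lemma triv_vec_scaleR: "triv_at V t p \<Longrightarrow> triv_vec V t (r *\<^sub>R \<xi>) p = r *\<^sub>R triv_vec V t \<xi> p"
  by (rule triv_eqI[of V t p])
    (simp_all add: triv_vec_in triv_triv_vec triv_scaleR subspace_scale triv_at_subspace)

lemma linear_triv_change:
  "triv_at V t p \<Longrightarrow> triv_at V s p \<Longrightarrow> linear (\<lambda>\<xi>. snd s p (triv_vec V t \<xi> p))"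
  by (rule linearI) (simp_all add: triv_vec_add triv_vec_scaleR triv_add triv_scaleR triv_vec_in)

lemma fst_bundle_chart: "(p, v) \<in> fst (bundle_chart V c t) \<longleftrightarrow> p \<in> fst c \<and> p \<in> fst t \<and> v \<in> V p"
  by (auto simp: bundle_chart_def)

lemma snd_bundle_chart: "snd (bundle_chart V c t) (p, v) = (snd c p, snd t p v)"
  by (simp add: bundle_chart_def)

lemma inj_on_bundle_chart:
  assumes "smooth_atlas M A" "vector_bundle M A V B" "c \<in> A" "t \<in> B"
  shows "inj_on (snd (bundle_chart V c t)) (fst (bundle_chart V c t))"
proof (rule inj_onI, clarify)
  fix p v q w
  assume p: "(p, v) \<in> fst (bundle_chart V c t)" and q: "(q, w) \<in> fst (bundle_chart V c t)"
    and eq: "snd (bundle_chart V c t) (p, v) = snd (bundle_chart V c t) (q, w)"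
  then have "p = q"
    using smooth_atlas_inj[OF assms(1,3)] by (auto simp: fst_bundle_chart snd_bundle_chart dest: inj_onD)
  moreover have "v = w" if "p = q"
    using p q eq that triv_eqI[OF vector_bundle_triv_at[OF assms(2,4)], of q v w]
    by (simp add: fst_bundle_chart snd_bundle_chart)
  ultimately show "p = q \<and> v = w" by blast
qed

text \<open>The fibre coordinates take all values because a trivialization is onto, so the image is
  a product. The set \<open>S\<close> lets the same formula describe the overlap of two
  charts.\<close>

lemma bundle_chart_image:
  assumes "vector_bundle M A V B" "t \<in> B"
  shows "snd (bundle_chart V c t) ` {(p, v). p \<in> fst c \<and> p \<in> fst t \<and> p \<in> S \<and> v \<in> V p} =
    snd c ` (fst c \<inter> (fst t \<inter> S)) \<times> UNIV" (is "?L = ?R")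
proof
  show "?L \<subseteq> ?R" by (auto simp: snd_bundle_chart)
  show "?R \<subseteq> ?L"
  proof (clarsimp)
    fix p \<xi> assume p: "p \<in> fst c" "p \<in> fst t" "p \<in> S"
    note b = vector_bundle_triv_at[OF assms p(2)]
    have "(snd c p, \<xi>) = snd (bundle_chart V c t) (p, triv_vec V t \<xi> p)"
      by (simp add: snd_bundle_chart triv_triv_vec[OF b])
    then show "(snd c p, \<xi>) \<in> ?L"
      using p triv_vec_in[OF b] by blast
  qed
qed

lemma bundle_transition:
  assumes A: "smooth_atlas M A" and V: "vector_bundle M A V B"
    and c: "c \<in> A" "t \<in> B" "d \<in> A" "s \<in> B" and p: "p \<in> fst c" "p \<in> fst t" "p \<in> fst d" "p \<in> fst s"
  shows "transition (bundle_chart V c t) (bundle_chart V d s) (snd c p, \<xi>) =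
    (transition c d (snd c p), snd s p (triv_vec V t \<xi> p))"
proof -
  note b = vector_bundle_triv_at[OF V c(2) p(2)]
  have "transition (bundle_chart V c t) (bundle_chart V d s)
      (snd (bundle_chart V c t) (p, triv_vec V t \<xi> p)) = snd (bundle_chart V d s) (p, triv_vec V t \<xi> p)"
    unfolding transition_def
    by (rule local_rep_apply[OF inj_on_bundle_chart[OF A V c(1,2)]])
      (simp add: fst_bundle_chart p triv_vec_in[OF b])
  then show ?thesis
    by (simp add: snd_bundle_chart triv_triv_vec[OF b] transition_apply[OF A c(1) p(1)])
qed

lemma smooth_atlas_bundle:
  assumes A: "smooth_atlas M A" and V: "vector_bundle M A V B"
  shows "smooth_atlas {(p, v). p \<in> M \<and> v \<in> V p} (bundle_atlas A V B)"
proof -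
  note VB = vector_bundleD[OF V]
  have "(\<Union>C\<in>bundle_atlas A V B. fst C) = {(p, v). p \<in> M \<and> v \<in> V p}" (is "?L = ?R")
  proof
    have "fst C \<subseteq> ?R" if "C \<in> bundle_atlas A V B" for C
      using that VB(2) by (auto simp: bundle_atlas_def fst_bundle_chart)
    then show "?L \<subseteq> ?R" by blast
    show "?R \<subseteq> ?L"
    proof (clarify)
      fix p v assume "p \<in> M" "v \<in> V p"
      moreover from this A VB(2) obtain c t where "c \<in> A" "p \<in> fst c" "t \<in> B" "p \<in> fst t"
        unfolding smooth_atlas_def by blast
      ultimately show "(p, v) \<in> ?L"
        unfolding bundle_atlas_def using fst_bundle_chart[of p v V c t] by blast
    qed
  qed
  moreover have overlap: "open (snd C ` (fst C \<inter> fst D))"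
    and "smooth_on (snd C ` (fst C \<inter> fst D)) (transition C D)"
    if CD: "C \<in> bundle_atlas A V B" "D \<in> bundle_atlas A V B" for C D
  proof -
    obtain c t d s where c: "c \<in> A" "t \<in> B" "d \<in> A" "s \<in> B"
      and C: "C = bundle_chart V c t" and D: "D = bundle_chart V d s"
      using CD by (auto simp: bundle_atlas_def)
    let ?S = "fst t \<inter> (fst d \<inter> fst s)"
    let ?U = "snd c ` (fst c \<inter> ?S)"
    have "fst C \<inter> fst D = {(p, v). p \<in> fst c \<and> p \<in> fst t \<and> p \<in> fst d \<inter> fst s \<and> v \<in> V p}"
      by (auto simp: C D fst_bundle_chart)
    then have img: "snd C ` (fst C \<inter> fst D) = ?U \<times> UNIV"
      using bundle_chart_image[OF V c(2), of c "fst d \<inter> fst s"] by (simp add: C)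
    have U: "open ?U"
      by (intro open_chart_image[OF A c(1)] openin_Int VB(3) c openin_chart_domain[OF A])
    then have U2: "open (?U \<times> (UNIV :: 'd set))" by (intro open_Times) auto
    then show "open (snd C ` (fst C \<inter> fst D))" unfolding img .
    show "smooth_on (snd C ` (fst C \<inter> fst D)) (transition C D)"
      unfolding img
    proof (rule smooth_on_cong[OF U2])
      have 1: "smooth_on (?U \<times> UNIV) (\<lambda>z::'b \<times> 'd. transition c d (fst z))"
        by (rule smooth_on_compose[OF U2 U _ smooth_on_fst[OF U2 smooth_on_id[OF U2]]
              smooth_on_subset[OF transition_smooth[OF A c(1,3)]]]) auto
      \<comment> \<open>The bundle axiom gives smoothness in the base point for each fixed
        \<open>\<xi>\<close>. Joint smoothness comes from linearity in the fibre:
        \<open>\<xi>\<close> is expanded over \<open>Basis\<close>, and only the basis vectors are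
        fed to the axiom.\<close>
      have 2: "smooth_on (?U \<times> UNIV) (\<lambda>z::'b \<times> 'd. \<Sum>b\<in>Basis. (snd z \<bullet> b) *\<^sub>R
          local_rep c (\<lambda>p. snd s p (triv_vec V t b p)) (fst z))"
      proof (intro smooth_on_sum[OF U2] smooth_on_scaleR[OF U2])
        fix b :: 'd assume "b \<in> Basis"
        show "smooth_on (?U \<times> UNIV) (\<lambda>z::'b \<times> 'd. snd z \<bullet> b)"
          by (rule smooth_on_linear[OF bounded_linear_inner_left U2 smooth_on_snd[OF U2 smooth_on_id[OF U2]]])
        have "smooth_on ?U (local_rep c (\<lambda>p. snd s p (triv_vec V t b p)))"
          using VB(6)[OF c(2,4), of b] c(1) unfolding smooth_fun_def
          by (rule_tac smooth_on_subset) auto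
        then show "smooth_on (?U \<times> UNIV)
            (\<lambda>z::'b \<times> 'd. local_rep c (\<lambda>p. snd s p (triv_vec V t b p)) (fst z))"
          by (rule smooth_on_compose[OF U2 U _ smooth_on_fst[OF U2 smooth_on_id[OF U2]], rotated]) auto
      qed
      show "smooth_on (?U \<times> UNIV) (\<lambda>z::'b \<times> 'd. (transition c d (fst z), \<Sum>b\<in>Basis. (snd z \<bullet> b) *\<^sub>R
          local_rep c (\<lambda>p. snd s p (triv_vec V t b p)) (fst z)))"
        by (rule smooth_on_Pair[OF U2 1 2])
      fix z :: "'b \<times> 'd" assume "z \<in> ?U \<times> UNIV"
      then obtain p \<xi> where z: "z = (snd c p, \<xi>)" and p: "p \<in> fst c" "p \<in> fst t" "p \<in> fst d" "p \<in> fst s"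
        by (cases z) auto
      interpret linear "\<lambda>\<xi>. snd s p (triv_vec V t \<xi> p)"
        by (rule linear_triv_change[OF vector_bundle_triv_at[OF V c(2) p(2)] vector_bundle_triv_at[OF V c(4) p(4)]])
      have "snd s p (triv_vec V t \<xi> p) = snd s p (triv_vec V t (\<Sum>b\<in>Basis. (\<xi> \<bullet> b) *\<^sub>R b) p)"
        by (simp add: euclidean_representation)
      also have "\<dots> = (\<Sum>b\<in>Basis. (\<xi> \<bullet> b) *\<^sub>R snd s p (triv_vec V t b p))"
        by (simp add: sum scaleR)
      finally show "(transition c d (fst z), \<Sum>b\<in>Basis. (snd z \<bullet> b) *\<^sub>R
          local_rep c (\<lambda>p. snd s p (triv_vec V t b p)) (fst z)) = transition C D z"
        unfolding C D z bundle_transition[OF A V c p]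
        by (simp add: local_rep_apply[OF smooth_atlas_inj[OF A c(1)] p(1)])
    qed
  qed
  moreover have "inj_on (snd C) (fst C) \<and> open (snd C ` fst C)" if "C \<in> bundle_atlas A V B" for C
    using that overlap[OF that that] inj_on_bundle_chart[OF A V] by (auto simp: bundle_atlas_def)
  ultimately show ?thesis unfolding smooth_atlas_def by blast
qed

section \<open>The tangent bundle as a vector bundle\<close>

lemma linear_between_tangent_component: "linear_between (tangent_space A p) UNIV (\<lambda>X. X c)"
  by (simp add: linear_between_def scaleR_fun_def)

lemma bij_betw_tangent_component:
  assumes "smooth_atlas M A" "c \<in> A" "p \<in> fst c"
  shows "bij_betw (\<lambda>X. X c) (tangent_space A p) UNIV"
proof (rule bij_betw_imageI)
  show "inj_on (\<lambda>X. X c) (tangent_space A p)"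
    by (rule inj_onI) (rule tangent_vec_eqI[OF _ _ assms(2,3)])
  have "h \<in> (\<lambda>X. X c) ` tangent_space A p" for h
    by (rule image_eqI[of _ _ "coord_vec A c p h"])
      (simp_all add: coord_vec_same_chart[OF assms] coord_vec_in_tangent_space[OF assms])
  then show "(\<lambda>X. X c) ` tangent_space A p = UNIV" by auto
qed

lemma triv_at_tangent:
  assumes "smooth_atlas M A" "c \<in> A" "p \<in> fst c"
  shows "triv_at (tangent_space A) (tangent_triv c) p"
  using bij_betw_tangent_component[OF assms] linear_between_tangent_component subspace_tangent_space[OF assms(1)]
  by (simp add: tangent_triv_def triv_at_def)

lemma triv_vec_tangent_triv:
  assumes "smooth_atlas M A" "c \<in> A" "p \<in> fst c"
  shows "triv_vec (tangent_space A) (tangent_triv c) \<xi> p = coord_vec A c p \<xi>"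
proof -
  note b = triv_at_tangent[OF assms]
  show ?thesis
    using triv_triv_vec[OF b, of \<xi>] coord_vec_same_chart[OF assms, of \<xi>]
    by (intro triv_eqI[OF b] triv_vec_in[OF b] coord_vec_in_tangent_space[OF assms])
      (simp add: tangent_triv_def)
qed

text \<open>Makes the general results on total spaces available for the tangent bundle. The change
  of trivialization is the Jacobian of the transition map, which is smooth in the point for a fixed
  vector \<open>\<xi>\<close>.\<close>

lemma vector_bundle_tangent:
  assumes A: "smooth_atlas M A"
  shows "vector_bundle M A (tangent_space A) (tangent_triv ` A)"
proof -
  have "smooth_fun A (fst c \<inter> fst d) (\<lambda>p. triv_vec (tangent_space A) (tangent_triv c) \<xi> p d)"
    if cd: "c \<in> A" "d \<in> A" for c d \<xi>
  proof (rule smooth_fun_in_chart[OF A cd(1)])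
    show "openin (atlas_topology M A) (fst c \<inter> fst d)"
      by (intro openin_Int openin_chart_domain[OF A] cd)
    show "open (snd c ` (fst c \<inter> fst d))"
      by (intro open_chart_image[OF A cd(1)] openin_chart_domain[OF A] cd)
    show "smooth_on (snd c ` (fst c \<inter> fst d)) (\<lambda>x. frechet_derivative (transition c d) (at x) \<xi>)"
      by (rule smooth_on_frechet[OF transition_smooth[OF A cd]])
    show "triv_vec (tangent_space A) (tangent_triv c) \<xi> p d =
        frechet_derivative (transition c d) (at (snd c p)) \<xi>" if "p \<in> fst c \<inter> fst d" for p
      using that cd by (subst triv_vec_tangent_triv[OF A]) (auto simp: coord_vec_def)
  qed auto
  moreover have "(\<Union>c\<in>A. fst c) = M" using A by (simp add: smooth_atlas_def)
  moreover have "linear_between (tangent_space A p) UNIV (snd (tangent_triv c) p)" for p c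
    using linear_between_tangent_component by (simp add: tangent_triv_def)
  moreover have "bij_betw (snd (tangent_triv c) p) (tangent_space A p) UNIV" if "c \<in> A" "p \<in> fst c" for c p
    using bij_betw_tangent_component[OF A that] by (simp add: tangent_triv_def)
  moreover have "fst (tangent_triv c) = fst c" "snd (tangent_triv c) p X = X c"
    for c :: "('a, 'b) chart" and p X
    by (simp_all add: tangent_triv_def)
  ultimately show ?thesis
    unfolding vector_bundle_def
    using subspace_tangent_space[OF A] openin_chart_domain[OF A] by simp
qed

text \<open>\<open>tangent_atlas\<close> pairs each chart with its own trivialization, whereas the
  bundle atlas also has mixed pairs, hence an inclusion. The conditions on charts and overlaps pass
  to the smaller atlas; that it covers the total space is checked separately.\<close>

lemma tangent_atlas_subset: "tangent_atlas A \<subseteq> bundle_atlas A (tangent_space A) (tangent_triv ` A)"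
  unfolding tangent_atlas_def tangent_chart_def bundle_atlas_def by blast

lemma fst_tangent_chart: "(p, X) \<in> fst (tangent_chart A c) \<longleftrightarrow> p \<in> fst c \<and> X \<in> tangent_space A p"
  by (auto simp: tangent_chart_def fst_bundle_chart tangent_triv_def)

lemma snd_tangent_chart: "snd (tangent_chart A c) (p, X) = (snd c p, X c)"
  by (simp add: tangent_chart_def snd_bundle_chart tangent_triv_def)

lemma smooth_atlas_tangent:
  assumes A: "smooth_atlas M A"
  shows "smooth_atlas {(p, X). p \<in> M \<and> X \<in> tangent_space A p} (tangent_atlas A)"
proof -
  have "(\<Union>C\<in>tangent_atlas A. fst C) = {(p, X). p \<in> M \<and> X \<in> tangent_space A p}"
    using A unfolding smooth_atlas_def
    by (auto simp: tangent_atlas_def fst_tangent_chart)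
  then show ?thesis
    using smooth_atlas_bundle[OF A vector_bundle_tangent[OF A]] tangent_atlas_subset[of A]
    unfolding smooth_atlas_def by blast
qed

lemma tangent_transition:
  assumes A: "smooth_atlas M A" and c: "c \<in> A" "d \<in> A" and p: "p \<in> fst c" "p \<in> fst d"
  shows "transition (tangent_chart A c) (tangent_chart A d) (snd c p, \<xi>) =
    (transition c d (snd c p), frechet_derivative (transition c d) (at (snd c p)) \<xi>)"
proof -
  have "transition (tangent_chart A c) (tangent_chart A d) (snd c p, \<xi>) =
      (transition c d (snd c p), snd (tangent_triv d) p (triv_vec (tangent_space A) (tangent_triv c) \<xi> p))"
    unfolding tangent_chart_def
    by (rule bundle_transition[OF A vector_bundle_tangent[OF A]])
      (use c p in \<open>simp_all add: tangent_triv_def\<close>)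
  then show ?thesis
    unfolding triv_vec_tangent_triv[OF A c(1) p(1)] using c p by (simp add: tangent_triv_def coord_vec_def)
qed

section \<open>The almost complex structure of a nonlinear connection\<close>

text \<open>The map with \<open>(a, - N a) \<mapsto> (0, - a)\<close> and \<open>(0, a) \<mapsto> (a, - N a)\<close>.\<close>

definition adapted_J :: "real^'r^'r \<Rightarrow> (real^'r) \<times> (real^'r) \<Rightarrow> (real^'r) \<times> (real^'r)" where
  "adapted_J N x = (snd x + N *v fst x, - fst x - N *v (snd x + N *v fst x))"

text \<open>With \<open>w = k + N a\<close> in place of \<open>k\<close>, the map sends
  \<open>(a, w)\<close> to \<open>(w, - a)\<close>, the standard rotation with square
  \<open>- 1\<close>.\<close>

lemma adapted_J_adapted_J: "adapted_J N (adapted_J N x) = - x"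
  by (simp add: adapted_J_def prod_eq_iff linear_neg[OF matrix_vector_mul_linear]
      linear_add[OF matrix_vector_mul_linear] linear_diff[OF matrix_vector_mul_linear])

lemma linear_adapted_J: "linear (adapted_J N)"
  by (rule linearI)
    (simp_all add: adapted_J_def linear_add[OF matrix_vector_mul_linear]
      linear_scale[OF matrix_vector_mul_linear] scaleR_right_distrib scaleR_right_diff_distrib)

lemma smooth_on_matrix_vector_mult:
  fixes N :: "'a::real_normed_vector \<Rightarrow> real^'n^'m"
  assumes "open S" "\<And>i j. smooth_on S (\<lambda>x. N x $ i $ j)" "smooth_on S y"
  shows "smooth_on S (\<lambda>x. N x *v y x)"
  unfolding matrix_vector_mult_def
  by (rule smooth_on_vec[OF assms(1)])
    (simp only: vec_lambda_beta, intro smooth_on_sum[OF assms(1)]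
      smooth_on_mult[OF assms(1) assms(2) smooth_on_nth[OF assms(1,3)]])

lemma smooth_on_adapted_J:
  assumes "open S" "\<And>i j. smooth_on S (\<lambda>x. N x $ i $ j)"
  shows "smooth_on S (\<lambda>x. adapted_J (N x) \<xi>)"
  unfolding adapted_J_def
  by (intro smooth_on_Pair[OF assms(1)] smooth_on_add[OF assms(1)] smooth_on_diff[OF assms(1)]
      smooth_on_matrix_vector_mult[OF assms] smooth_on_const)

text \<open>The gluing argument shared by both parts. Compatibility is phrased as a relation between
  two vectors: if \<open>Y\<close> is the image of \<open>X\<close> according to \<open>T i\<close>,
  then also according to \<open>T j\<close>. In this form no formula for the change of
  trivialization is required.\<close>

lemma almost_complex_structure_of_connection:
  fixes A :: "('p, 'e::euclidean_space) chart set" and V :: "'p \<Rightarrow> 'v::real_vector set"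
    and B :: "('p, 'v, (real^'r) \<times> (real^'r)) triv set" and N :: "'i \<Rightarrow> 'p \<Rightarrow> real^'r^'r"
  assumes A: "smooth_atlas E A" and W: "openin (atlas_topology E A) W"
    and T: "\<And>i. i \<in> I \<Longrightarrow> T i \<in> B" "\<And>i. i \<in> I \<Longrightarrow> openin (atlas_topology E A) (fst (T i))"
      "\<And>i p. i \<in> I \<Longrightarrow> p \<in> W \<Longrightarrow> p \<in> fst (T i) \<Longrightarrow> triv_at V (T i) p"
      "\<And>p. p \<in> W \<Longrightarrow> \<exists>i\<in>I. p \<in> fst (T i)"
    and N: "\<And>i a b. i \<in> I \<Longrightarrow> smooth_fun A (W \<inter> fst (T i)) (\<lambda>p. N i p $ a $ b)"
    and compat: "\<And>i j p X Y. i \<in> I \<Longrightarrow> j \<in> I \<Longrightarrow> p \<in> W \<Longrightarrow> p \<in> fst (T i) \<Longrightarrow> p \<in> fst (T j) \<Longrightarrow>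
      X \<in> V p \<Longrightarrow> Y \<in> V p \<Longrightarrow> snd (T i) p Y = adapted_J (N i p) (snd (T i) p X) \<Longrightarrow>
      snd (T j) p Y = adapted_J (N j p) (snd (T j) p X)"
  obtains F where "almost_complex_structure A W V B F"
    and "\<And>p X. p \<in> W \<Longrightarrow> X \<in> V p \<Longrightarrow> F p X \<in> V p"
    and "\<And>i p X. i \<in> I \<Longrightarrow> p \<in> W \<Longrightarrow> p \<in> fst (T i) \<Longrightarrow> X \<in> V p \<Longrightarrow>
      snd (T i) p (F p X) = adapted_J (N i p) (snd (T i) p X)"
proof -
  define k where "k p = (SOME i. i \<in> I \<and> p \<in> fst (T i))" for p
  have k: "k p \<in> I" "p \<in> fst (T (k p))" if "p \<in> W" for p
    using someI_ex[of "\<lambda>i. i \<in> I \<and> p \<in> fst (T i)"] T(4)[OF that] unfolding k_def by blast+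
  define F where "F p X = triv_vec V (T (k p)) (adapted_J (N (k p) p) (snd (T (k p)) p X)) p" for p X
  have tk: "triv_at V (T (k p)) p" if "p \<in> W" for p
    by (rule T(3)[OF k(1)[OF that] that k(2)[OF that]])
  have F_in: "F p X \<in> V p" if "p \<in> W" for p X
    unfolding F_def by (rule triv_vec_in[OF tk[OF that]])
  \<comment> \<open>Although \<open>k\<close> chooses an index at each point without any regularity,
    compatibility gives \<open>F\<close> the expected formula in every trivialization. Smoothness is
    read off from that formula.\<close>
  have F_T: "snd (T i) p (F p X) = adapted_J (N i p) (snd (T i) p X)"
    if "i \<in> I" "p \<in> W" "p \<in> fst (T i)" "X \<in> V p" for i p X
    by (rule compat[OF k(1)[OF that(2)] that(1,2) k(2)[OF that(2)] that(3,4) F_in[OF that(2)]])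
      (unfold F_def, rule triv_triv_vec[OF tk[OF that(2)]])
  have F2: "F p (F p X) = - X" if p: "p \<in> W" "X \<in> V p" for p X
  proof (rule triv_eqI[OF tk[OF p(1)] F_in[OF p(1)]])
    note t = tk[OF p(1)]
    show "- X \<in> V p" by (rule subspace_neg[OF triv_at_subspace[OF t] p(2)])
    have "snd (T (k p)) p (- X) = - snd (T (k p)) p X"
      using triv_scaleR[OF t p(2), of "-1"] by simp
    then show "snd (T (k p)) p (F p (F p X)) = snd (T (k p)) p (- X)"
      using F_T[OF k(1)[OF p(1)] p(1) k(2)[OF p(1)]] F_in[OF p(1)] p(2) by (simp add: adapted_J_adapted_J)
  qed
  have lin: "linear_between (V p) (V p) (F p)" if p: "p \<in> W" for p
    unfolding linear_between_def F_def
    by (simp add: triv_vec_in[OF tk[OF p]] triv_add[OF tk[OF p]] triv_scaleR[OF tk[OF p]]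
        linear_add[OF linear_adapted_J] linear_scale[OF linear_adapted_J]
        triv_vec_add[OF tk[OF p]] triv_vec_scaleR[OF tk[OF p]])
  have smooth: "smooth_fun A (W \<inter> fst (T i)) (\<lambda>q. snd (T i) q (F q (triv_vec V (T i) \<xi> q)))"
    if i: "i \<in> I" for i \<xi>
    unfolding smooth_fun_def
  proof
    fix d assume d: "d \<in> A"
    have U: "open (snd d ` (fst d \<inter> (W \<inter> fst (T i))))"
      by (intro open_chart_image[OF A d] openin_Int W T(2)[OF i])
    show "smooth_on (snd d ` (fst d \<inter> (W \<inter> fst (T i))))
        (local_rep d (\<lambda>q. snd (T i) q (F q (triv_vec V (T i) \<xi> q))))"
    proof (rule smooth_on_cong[OF U])
      show "smooth_on (snd d ` (fst d \<inter> (W \<inter> fst (T i)))) (\<lambda>x. adapted_J (local_rep d (N i) x) \<xi>)"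
      proof (rule smooth_on_adapted_J[OF U])
        fix a b
        have "(\<lambda>x. local_rep d (N i) x $ a $ b) = local_rep d (\<lambda>p. N i p $ a $ b)"
          by (simp add: local_rep_def fun_eq_iff)
        then show "smooth_on (snd d ` (fst d \<inter> (W \<inter> fst (T i)))) (\<lambda>x. local_rep d (N i) x $ a $ b)"
          using N[OF i, of a b] d unfolding smooth_fun_def by simp
      qed
      fix x assume "x \<in> snd d ` (fst d \<inter> (W \<inter> fst (T i)))"
      then obtain p where p: "p \<in> fst d" "p \<in> W" "p \<in> fst (T i)" and x: "x = snd d p" by blast
      note t = T(3)[OF i p(2,3)]
      show "adapted_J (local_rep d (N i) x) \<xi> =
          local_rep d (\<lambda>q. snd (T i) q (F q (triv_vec V (T i) \<xi> q))) x"
        unfolding x local_rep_apply[OF smooth_atlas_inj[OF A d] p(1)]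
          F_T[OF i p(2,3) triv_vec_in[OF t]] triv_triv_vec[OF t] by (rule refl)
    qed
  qed
  have "bundle_endomorphism A W V B F"
    unfolding bundle_endomorphism_def
  proof (intro conjI ballI)
    fix p assume p: "p \<in> W"
    show "linear_between (V p) (V p) (F p)" by (rule lin[OF p])
    show "\<exists>t\<in>B. p \<in> fst t \<and> (\<forall>\<xi>. smooth_fun A (W \<inter> fst t) (\<lambda>q. snd t q (F q (triv_vec V t \<xi> q))))"
      using T(1)[OF k(1)[OF p]] k(2)[OF p] smooth[OF k(1)[OF p]] by blast
  qed
  then have "almost_complex_structure A W V B F"
    unfolding almost_complex_structure_def using F2 by blast
  then show thesis using that F_in F_T by blast
qed

section \<open>Second derivatives under a change of coordinates\<close>

text \<open>Linearity in the outer direction \<open>h\<close> is automatic. The inner direction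
  \<open>s\<close> sits inside the function being differentiated, so its linearity has to be used on
  a neighbourhood of \<open>x\<close> before differentiating.\<close>

lemma second_frechet_expand:
  fixes f :: "'a::euclidean_space \<Rightarrow> 'b::real_normed_vector"
  assumes "open S" "smooth_on S f" "x \<in> S"
  shows "frechet_derivative (\<lambda>z. frechet_derivative f (at z) s) (at x) h =
    (\<Sum>b\<in>Basis. (s \<bullet> b) *\<^sub>R frechet_derivative (\<lambda>z. frechet_derivative f (at z) b) (at x) h)"
proof (rule frechet_derivativeI, rule has_derivative_transform_within_open[OF _ assms(1,3)])
  show "((\<lambda>z. \<Sum>b\<in>Basis. (s \<bullet> b) *\<^sub>R frechet_derivative f (at z) b) has_derivative
      (\<lambda>h. \<Sum>b\<in>Basis. (s \<bullet> b) *\<^sub>R frechet_derivative (\<lambda>z. frechet_derivative f (at z) b) (at x) h)) (at x)"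
    by (intro has_derivative_sum has_derivative_scaleR_right
        smooth_on_has_derivative[OF smooth_on_frechet[OF assms(2)] assms(3)])
  show "(\<Sum>b\<in>Basis. (s \<bullet> b) *\<^sub>R frechet_derivative f (at z) b) = frechet_derivative f (at z) s"
    if "z \<in> S" for z
    by (rule frechet_derivative_euclidean[OF smooth_on_differentiable[OF assms(2) that], symmetric])
qed

lemma bilinear_second_frechet:
  fixes f :: "'a::euclidean_space \<Rightarrow> 'b::real_normed_vector"
  assumes "open S" "smooth_on S f" "x \<in> S"
  shows "bilinear (\<lambda>h s. frechet_derivative (\<lambda>z. frechet_derivative f (at z) s) (at x) h)"
  unfolding bilinear_def
proof (intro conjI allI)
  fix s
  show "linear (\<lambda>h. frechet_derivative (\<lambda>z. frechet_derivative f (at z) s) (at x) h)"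
    by (rule has_derivative_linear[OF smooth_on_has_derivative[OF smooth_on_frechet[OF assms(2)] assms(3)]])
next
  fix h
  show "linear (\<lambda>s. frechet_derivative (\<lambda>z. frechet_derivative f (at z) s) (at x) h)"
    by (subst second_frechet_expand[OF assms], rule linearI)
      (simp_all add: inner_add_left scaleR_left_distrib sum.distrib scaleR_sum_right)
qed

lemma frechet_derivative_compose_on:
  assumes "open U" "smooth_on U \<Phi>" "\<Phi> ` U \<subseteq> S" "smooth_on S g" "\<And>z. z \<in> U \<Longrightarrow> f z = g (\<Phi> z)" "z \<in> U"
  shows "frechet_derivative f (at z) h = frechet_derivative g (at (\<Phi> z)) (frechet_derivative \<Phi> (at z) h)"
proof (rule frechet_derivativeI, rule has_derivative_transform_within_open[OF _ assms(1,6)])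
  have "\<Phi> z \<in> S" using assms(3,6) by blast
  then show "((\<lambda>z. g (\<Phi> z)) has_derivative
      (\<lambda>h. frechet_derivative g (at (\<Phi> z)) (frechet_derivative \<Phi> (at z) h))) (at z)"
    by (intro has_derivative_compose[OF smooth_on_has_derivative[OF assms(2,6)]
          smooth_on_has_derivative[OF assms(4)]])
qed (simp add: assms(5))

text \<open>The chain rule for second derivatives. In the first term the transported direction is
  frozen at its value at \<open>x\<close>; the second term accounts for its motion. The proof is the
  product rule after expansion over \<open>Basis\<close>.\<close>

lemma second_frechet_compose:
  fixes \<Phi> :: "'a::real_normed_vector \<Rightarrow> 'b::euclidean_space" and f :: "'a \<Rightarrow> 'c::real_normed_vector"
  assumes U: "open U" "smooth_on U \<Phi>" "\<Phi> ` U \<subseteq> S" and S: "open S" "smooth_on S g"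
    and f: "\<And>z. z \<in> U \<Longrightarrow> f z = g (\<Phi> z)" and x: "x \<in> U"
  shows "frechet_derivative (\<lambda>z. frechet_derivative f (at z) s) (at x) h =
    frechet_derivative (\<lambda>w. frechet_derivative g (at w) (frechet_derivative \<Phi> (at x) s)) (at (\<Phi> x))
      (frechet_derivative \<Phi> (at x) h) +
    frechet_derivative g (at (\<Phi> x)) (frechet_derivative (\<lambda>z. frechet_derivative \<Phi> (at z) s) (at x) h)"
    (is "_ = ?R")
proof -
  have \<Phi>x: "\<Phi> x \<in> S" using U(3) x by blast
  let ?k = "\<lambda>z. frechet_derivative \<Phi> (at z) s"
  let ?D = "\<lambda>h. \<Sum>b\<in>Basis. (?k x \<bullet> b) *\<^sub>R
      frechet_derivative (\<lambda>w. frechet_derivative g (at w) b) (at (\<Phi> x)) (frechet_derivative \<Phi> (at x) h) +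
      (frechet_derivative ?k (at x) h \<bullet> b) *\<^sub>R frechet_derivative g (at (\<Phi> x)) b"
  have "frechet_derivative (\<lambda>z. frechet_derivative f (at z) s) (at x) h = ?D h"
  proof (rule frechet_derivativeI, rule has_derivative_transform_within_open[OF _ U(1) x])
    show "((\<lambda>z. \<Sum>b\<in>Basis. (?k z \<bullet> b) *\<^sub>R frechet_derivative g (at (\<Phi> z)) b) has_derivative ?D) (at x)"
      by (intro has_derivative_sum has_derivative_scaleR has_derivative_inner_left
          smooth_on_has_derivative[OF smooth_on_frechet[OF U(2)] x]
          has_derivative_compose[OF smooth_on_has_derivative[OF U(2) x]
            smooth_on_has_derivative[OF smooth_on_frechet[OF S(2)] \<Phi>x]])
    fix z assume z: "z \<in> U"
    then have "\<Phi> z \<in> S" using U(3) by blast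
    then show "(\<Sum>b\<in>Basis. (?k z \<bullet> b) *\<^sub>R frechet_derivative g (at (\<Phi> z)) b) = frechet_derivative f (at z) s"
      using frechet_derivative_compose_on[OF U S(2) f z, of s]
        frechet_derivative_euclidean[OF smooth_on_differentiable[OF S(2)], of "\<Phi> z" "?k z"] by metis
  qed
  also have "\<dots> = ?R"
    unfolding second_frechet_expand[OF S \<Phi>x, of "?k x"]
      frechet_derivative_euclidean[OF smooth_on_differentiable[OF S(2) \<Phi>x], of "frechet_derivative ?k (at x) h"]
    by (rule sum.distrib)
  finally show ?thesis .
qed

text \<open>Lets a derivative along \<open>(0, v)\<close> be computed with the base point held
  fixed, where the functions concerned have a simple form in \<open>y\<close>.\<close>

lemma frechet_derivative_snd_direction:
  assumes "k differentiable (at (x, y))"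
  shows "((\<lambda>y. k (x, y)) has_derivative (\<lambda>v. frechet_derivative k (at (x, y)) (0, v))) (at y)"
proof -
  have "((\<lambda>y. (x, y)) has_derivative (\<lambda>v. (0, v))) (at y)"
    by (auto intro!: derivative_eq_intros)
  from has_derivative_compose[OF this has_derivative_frechet[OF assms]] show ?thesis .
qed

lemma smooth_on_base_pd: "smooth_on U f \<Longrightarrow> smooth_on U (base_pd i f)"
  using smooth_on_frechet[of U f "(axis i 1, 0)"] by (simp add: base_pd_def[abs_def])

lemma smooth_on_fibre_pd: "smooth_on U f \<Longrightarrow> smooth_on U (fibre_pd a f)"
  using smooth_on_frechet[of U f "(0, axis a 1)"] by (simp add: fibre_pd_def[abs_def])

lemma frechet_derivative_pd:
  fixes f :: "(real^'n) \<times> (real^'r) \<Rightarrow> real"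
  assumes "f differentiable (at z)"
  shows "frechet_derivative f (at z) (a, b) =
    (\<Sum>i\<in>UNIV. a $ i * base_pd i f z) + (\<Sum>j\<in>UNIV. b $ j * fibre_pd j f z)"
proof -
  interpret linear "frechet_derivative f (at z)"
    by (rule linear_frechet_derivative[OF assms])
  have eq: "(a, b) = (\<Sum>i\<in>UNIV. a $ i *\<^sub>R (axis i 1, 0)) + (\<Sum>j\<in>UNIV. b $ j *\<^sub>R (0, axis j 1))"
    using basis_expansion[of a] basis_expansion[of b]
    by (simp add: prod_eq_iff fst_sum snd_sum scalar_mult_eq_scaleR)
  show ?thesis
    by (subst eq) (simp only: add sum scaleR real_scaleR_def base_pd_def fibre_pd_def)
qed

lemma second_frechet_pd:
  fixes f :: "(real^'n) \<times> (real^'r) \<Rightarrow> real"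
  assumes "open U" "smooth_on U f" "z \<in> U"
  shows "frechet_derivative (\<lambda>w. frechet_derivative f (at w) (a, b)) (at z) h =
    (\<Sum>i\<in>UNIV. a $ i * frechet_derivative (base_pd i f) (at z) h) +
    (\<Sum>j\<in>UNIV. b $ j * frechet_derivative (fibre_pd j f) (at z) h)"
proof (rule frechet_derivativeI, rule has_derivative_transform_within_open[OF _ assms(1,3)])
  show "((\<lambda>z. (\<Sum>i\<in>UNIV. a $ i * base_pd i f z) + (\<Sum>j\<in>UNIV. b $ j * fibre_pd j f z)) has_derivative
     (\<lambda>h. (\<Sum>i\<in>UNIV. a $ i * frechet_derivative (base_pd i f) (at z) h) +
    (\<Sum>j\<in>UNIV. b $ j * frechet_derivative (fibre_pd j f) (at z) h))) (at z)"
    by (intro has_derivative_add has_derivative_sum has_derivative_mult_right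
        smooth_on_has_derivative[OF smooth_on_base_pd[OF assms(2)] assms(3)]
        smooth_on_has_derivative[OF smooth_on_fibre_pd[OF assms(2)] assms(3)])
  show "(\<Sum>i\<in>UNIV. a $ i * base_pd i f w) + (\<Sum>j\<in>UNIV. b $ j * fibre_pd j f w) =
      frechet_derivative f (at w) (a, b)" if "w \<in> U" for w
    by (rule frechet_derivative_pd[OF smooth_on_differentiable[OF assms(2) that], symmetric])
qed

lemma smooth_on_fibre_metric:
  assumes "open U" "smooth_on U f"
  shows "smooth_on U (\<lambda>z. fibre_metric f z $ a $ b)"
  unfolding fibre_metric_def vec_lambda_beta
  by (intro smooth_on_mult smooth_on_const smooth_on_fibre_pd assms)


section \<open>The canonical N-connection under a change of coordinates\<close>

definition tm_spray_vec :: "((real^'n) \<times> (real^'n) \<Rightarrow> real) \<Rightarrow> (real^'n) \<times> (real^'n) \<Rightarrow> real^'n" where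
  "tm_spray_vec f z = (\<chi> i. tm_spray f i z)"

definition tm_N_matrix :: "((real^'n) \<times> (real^'n) \<Rightarrow> real) \<Rightarrow> (real^'n) \<times> (real^'n) \<Rightarrow> real^'n^'n" where
  "tm_N_matrix f z = (\<chi> i j. tm_N f i j z)"

lemma smooth_on_tm_spray:
  assumes "open U" "smooth_on U f" "\<And>z. z \<in> U \<Longrightarrow> invertible (fibre_metric f z)"
  shows "smooth_on U (tm_spray f i)"
proof -
  have "smooth_on U (\<lambda>z. tm_spray f i z)"
    unfolding tm_spray_def
    by (intro smooth_on_mult smooth_on_sum smooth_on_diff smooth_on_const smooth_on_matrix_inv
        smooth_on_fibre_metric smooth_on_fibre_pd smooth_on_base_pd smooth_on_nth smooth_on_snd smooth_on_id
        assms)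
  then show ?thesis by simp
qed

lemma smooth_on_tm_spray_vec:
  assumes "open U" "smooth_on U f" "\<And>z. z \<in> U \<Longrightarrow> invertible (fibre_metric f z)"
  shows "smooth_on U (tm_spray_vec f)"
  by (rule smooth_on_vec[OF assms(1)]) (simp add: tm_spray_vec_def smooth_on_tm_spray[OF assms])

lemma smooth_on_tm_N_matrix:
  assumes "open U" "smooth_on U f" "\<And>z. z \<in> U \<Longrightarrow> invertible (fibre_metric f z)"
  shows "smooth_on U (\<lambda>z. tm_N_matrix f z $ i $ j)"
  using smooth_on_fibre_pd[OF smooth_on_tm_spray[OF assms]] by (simp add: tm_N_matrix_def tm_N_def)

text \<open>\<open>y\<^sup>k \<partial>/\<partial>x\<^sup>k - 2 G\<^sup>i \<partial>/\<partial>y\<^sup>i\<close> is the vector field of the Euler-Lagrange equations, which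
  determine it.\<close>

lemma tm_spray_vec_eq_iff:
  fixes f :: "(real^'n) \<times> (real^'n) \<Rightarrow> real"
  assumes U: "open U" "smooth_on U f" "z \<in> U" and g: "invertible (fibre_metric f z)"
  shows "tm_spray_vec f z = G \<longleftrightarrow>
    (\<forall>v. frechet_derivative (\<lambda>w. frechet_derivative f (at w) (snd z, - 2 *\<^sub>R G)) (at z) (0, v) =
      frechet_derivative f (at z) (v, 0))" (is "_ \<longleftrightarrow> (\<forall>v. ?L v = ?R v)")
proof -
  let ?g = "fibre_metric f z"
  define e where "e = (\<chi> j. (\<Sum>k\<in>UNIV. fibre_pd j (base_pd k f) z * snd z $ k) - base_pd j f z)"
  have "tm_spray_vec f z = (1/4) *\<^sub>R (matrix_inv ?g *v e)"
    by (simp add: vec_eq_iff tm_spray_vec_def tm_spray_def matrix_vector_mult_def e_def)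
  then have "tm_spray_vec f z = G \<longleftrightarrow> matrix_inv ?g *v e = 4 *\<^sub>R G"
    by auto
  also have "\<dots> \<longleftrightarrow> e = ?g *v (4 *\<^sub>R G)"
  proof
    assume "matrix_inv ?g *v e = 4 *\<^sub>R G"
    then have "?g *v (4 *\<^sub>R G) = (?g ** matrix_inv ?g) *v e"
      by (metis matrix_vector_mul_assoc)
    then show "e = ?g *v (4 *\<^sub>R G)" by (simp add: matrix_inv_mult[OF g])
  next
    assume "e = ?g *v (4 *\<^sub>R G)"
    then show "matrix_inv ?g *v e = 4 *\<^sub>R G"
      by (simp add: matrix_vector_mul_assoc matrix_inv_mult[OF g])
  qed
  also have "\<dots> \<longleftrightarrow> (\<forall>j. ?L (axis j 1) = ?R (axis j 1))"
  proof -
    \<comment> \<open>The Hessian is twice \<open>fibre_metric\<close>, so the fibre part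
      \<open>- 2 G\<close> of the direction contributes \<open>- 4\<close> times the metric applied
      to \<open>G\<close>, which matches the factor 1/4 of the spray.\<close>
    have "?L (axis j 1) - ?R (axis j 1) = e $ j - (?g *v (4 *\<^sub>R G)) $ j" for j
      unfolding second_frechet_pd[OF U] base_pd_def[of j f z, symmetric]
        fibre_pd_def[of j _ z, symmetric]
      by (simp add: e_def matrix_vector_mult_def fibre_metric_def sum_negf mult_ac)
    then show ?thesis unfolding vec_eq_iff by (metis eq_iff_diff_eq_0)
  qed
  also have "\<dots> \<longleftrightarrow> (\<forall>v. ?L v = ?R v)"
  proof
    assume *: "\<forall>j. ?L (axis j 1) = ?R (axis j 1)"
    have L: "linear (frechet_derivative (\<lambda>w. frechet_derivative f (at w) (snd z, - 2 *\<^sub>R G)) (at z))"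
      and R: "linear (frechet_derivative f (at z))"
      using has_derivative_linear[OF smooth_on_has_derivative] smooth_on_frechet U by blast+
    have "linear ?L" "linear ?R"
      using linear_compose[OF _ L, of "\<lambda>v. (0, v)"] linear_compose[OF _ R, of "\<lambda>v. (v, 0)"]
      by (simp_all add: o_def linear_iff)
    then have "?L = ?R"
      by (rule linear_eq_stdbasis) (use * in \<open>auto simp: Basis_vec_def\<close>)
    then show "\<forall>v. ?L v = ?R v" by metis
  qed blast
  finally show ?thesis .
qed

lemma tm_N_matrix_mult:
  assumes "open U" "smooth_on U f" "\<And>z. z \<in> U \<Longrightarrow> invertible (fibre_metric f z)" "z \<in> U"
  shows "tm_N_matrix f z *v v = frechet_derivative (tm_spray_vec f) (at z) (0, v)"
proof -
  note G = smooth_on_has_derivative[OF smooth_on_tm_spray_vec[OF assms(1-3)] assms(4)]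
  have "frechet_derivative (tm_spray_vec f) (at z) (0, v) $ i = (tm_N_matrix f z *v v) $ i" for i
  proof -
    have "frechet_derivative (tm_spray_vec f) (at z) (0, v) $ i = frechet_derivative (tm_spray f i) (at z) (0, v)"
      using frechet_derivativeI[OF bounded_linear.has_derivative[OF bounded_linear_vec_nth G], of i "(0, v)"]
      by (simp add: tm_spray_vec_def)
    also have "\<dots> = (\<Sum>j\<in>UNIV. v $ j * fibre_pd j (tm_spray f i) z)"
      using frechet_derivative_pd[OF smooth_on_differentiable[OF smooth_on_tm_spray[OF assms(1-3)] assms(4)]]
      by simp
    finally show ?thesis
      by (simp add: matrix_vector_mult_def tm_N_matrix_def tm_N_def mult.commute)
  qed
  then show ?thesis by (simp add: vec_eq_iff)
qed

section \<open>The tangent map of a coordinate change and its action on sprays and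
  connections\<close>

definition tangent_lift :: "('a::real_normed_vector \<Rightarrow> 'b::real_normed_vector) \<Rightarrow> 'a \<times> 'a \<Rightarrow> 'b \<times> 'b" where
  "tangent_lift \<phi> z = (\<phi> (fst z), frechet_derivative \<phi> (at (fst z)) (snd z))"

text \<open>The fibre part of the lift is the Jacobian at a moving point applied to a moving vector,
  so its derivative has a second-derivative term besides the Jacobian. The inhomogeneous terms for
  the spray and for the connection come from it.\<close>

lemma frechet_tangent_lift:
  fixes \<phi> :: "real^'n \<Rightarrow> real^'m"
  assumes "open S" "smooth_on S \<phi>" "x \<in> S"
  shows "frechet_derivative (tangent_lift \<phi>) (at (x, y)) (a, b) =
    (frechet_derivative \<phi> (at x) a,
     frechet_derivative (\<lambda>x. frechet_derivative \<phi> (at x) y) (at x) a + frechet_derivative \<phi> (at x) b)"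
  unfolding tangent_lift_def[abs_def]
proof (rule frechet_derivativeI[where f' = "\<lambda>h. (frechet_derivative \<phi> (at x) (fst h),
     frechet_derivative (\<lambda>x. frechet_derivative \<phi> (at x) y) (at x) (fst h) + frechet_derivative \<phi> (at x) (snd h))"
      and h = "(a, b)", simplified])
  have op: "open (S \<times> UNIV)" and xy: "(x, y) \<in> S \<times> UNIV"
    using assms by (auto intro: open_Times)
  have F: "(fst has_derivative fst) (at (x, y))" by (rule has_derivative_fst[OF has_derivative_ident])
  have "((\<lambda>z. \<Sum>b\<in>Basis. (snd z \<bullet> b) *\<^sub>R frechet_derivative \<phi> (at (fst z)) b) has_derivative
      (\<lambda>h. \<Sum>b\<in>Basis. (y \<bullet> b) *\<^sub>R frechet_derivative (\<lambda>x. frechet_derivative \<phi> (at x) b) (at x) (fst h) +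
        (snd h \<bullet> b) *\<^sub>R frechet_derivative \<phi> (at x) b)) (at (x, y))"
  proof (intro has_derivative_sum)
    fix b :: "real^'n"
    have 1: "((\<lambda>z. snd z \<bullet> b) has_derivative (\<lambda>h. snd h \<bullet> b)) (at (x, y))"
      by (intro has_derivative_inner_left has_derivative_snd has_derivative_ident)
    have 2: "((\<lambda>z. frechet_derivative \<phi> (at (fst z)) b) has_derivative
        (\<lambda>h. frechet_derivative (\<lambda>x. frechet_derivative \<phi> (at x) b) (at x) (fst h))) (at (x, y))"
      using smooth_on_has_derivative[OF smooth_on_frechet[OF assms(2)] assms(3), of b]
      by (intro has_derivative_compose[OF F]) simp
    show "((\<lambda>z. (snd z \<bullet> b) *\<^sub>R frechet_derivative \<phi> (at (fst z)) b) has_derivative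
        (\<lambda>h. (y \<bullet> b) *\<^sub>R frechet_derivative (\<lambda>x. frechet_derivative \<phi> (at x) b) (at x) (fst h) +
          (snd h \<bullet> b) *\<^sub>R frechet_derivative \<phi> (at x) b)) (at (x, y))"
      using has_derivative_scaleR[OF 1 2] by simp
  qed
  then have "((\<lambda>z. frechet_derivative \<phi> (at (fst z)) (snd z)) has_derivative
      (\<lambda>h. \<Sum>b\<in>Basis. (y \<bullet> b) *\<^sub>R frechet_derivative (\<lambda>x. frechet_derivative \<phi> (at x) b) (at x) (fst h) +
        (snd h \<bullet> b) *\<^sub>R frechet_derivative \<phi> (at x) b)) (at (x, y))"
  proof (rule has_derivative_transform_within_open[OF _ op xy])
    fix z :: "(real^'n) \<times> (real^'n)" assume "z \<in> S \<times> UNIV"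
    then have "fst z \<in> S" by auto
    then show "(\<Sum>b\<in>Basis. (snd z \<bullet> b) *\<^sub>R frechet_derivative \<phi> (at (fst z)) b) =
        frechet_derivative \<phi> (at (fst z)) (snd z)"
      by (intro frechet_derivative_euclidean[symmetric] smooth_on_differentiable[OF assms(2)])
  qed
  also have "(\<lambda>h. \<Sum>b\<in>Basis. (y \<bullet> b) *\<^sub>R frechet_derivative (\<lambda>x. frechet_derivative \<phi> (at x) b) (at x) (fst h) +
        (snd h \<bullet> b) *\<^sub>R frechet_derivative \<phi> (at x) b) =
      (\<lambda>h. frechet_derivative (\<lambda>x. frechet_derivative \<phi> (at x) y) (at x) (fst h) +
        frechet_derivative \<phi> (at x) (snd h))"
  proof
    fix h :: "(real^'n) \<times> (real^'n)"
    show "(\<Sum>b\<in>Basis. (y \<bullet> b) *\<^sub>R frechet_derivative (\<lambda>x. frechet_derivative \<phi> (at x) b) (at x) (fst h) +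
        (snd h \<bullet> b) *\<^sub>R frechet_derivative \<phi> (at x) b) =
      frechet_derivative (\<lambda>x. frechet_derivative \<phi> (at x) y) (at x) (fst h) + frechet_derivative \<phi> (at x) (snd h)"
      unfolding second_frechet_expand[OF assms, of y]
        frechet_derivative_euclidean[OF smooth_on_differentiable[OF assms(2,3)], of "snd h"]
      by (rule sum.distrib)
  qed
  finally have 2: "((\<lambda>z. frechet_derivative \<phi> (at (fst z)) (snd z)) has_derivative \<dots>) (at (x, y))" .
  have 1: "((\<lambda>z. \<phi> (fst z)) has_derivative (\<lambda>h. frechet_derivative \<phi> (at x) (fst h))) (at (x, y))"
    using smooth_on_has_derivative[OF assms(2,3)] by (intro has_derivative_compose[OF F]) simp
  show "((\<lambda>z. (\<phi> (fst z), frechet_derivative \<phi> (at (fst z)) (snd z))) has_derivative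
      (\<lambda>h. (frechet_derivative \<phi> (at x) (fst h),
        frechet_derivative (\<lambda>x. frechet_derivative \<phi> (at x) y) (at x) (fst h) +
        frechet_derivative \<phi> (at x) (snd h)))) (at (x, y))"
    by (rule has_derivative_Pair[OF 1 2])
qed

lemma tangent_lift_Pair: "tangent_lift \<phi> (x, y) = (\<phi> x, frechet_derivative \<phi> (at x) y)"
  by (simp add: tangent_lift_def)

lemma smooth_on_tangent_lift:
  fixes \<phi> :: "'a::euclidean_space \<Rightarrow> 'b::real_normed_vector"
  assumes "open S" "smooth_on S \<phi>" "open U" "U \<subseteq> S \<times> UNIV"
  shows "smooth_on U (tangent_lift \<phi>)"
proof -
  have f: "fst ` U \<subseteq> S" using assms(4) by auto
  note fst = smooth_on_fst[OF assms(3) smooth_on_id[OF assms(3)]]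
  have "smooth_on U (\<lambda>z. (\<phi> (fst z), frechet_derivative \<phi> (at (fst z)) (snd z)))"
    by (intro smooth_on_Pair[OF assms(3)] smooth_on_compose[OF assms(3,1) f fst assms(2)]
        smooth_on_frechet_apply[OF assms(1,2,3) fst smooth_on_snd[OF assms(3) smooth_on_id[OF assms(3)]] f])
  then show ?thesis by (simp add: tangent_lift_def[abs_def])
qed

lemma has_derivative_linear_apply:
  fixes L :: "'a::euclidean_space \<Rightarrow> 'b::real_normed_vector"
  shows "linear L \<Longrightarrow> (L has_derivative L) F"
  by (intro bounded_linear_imp_has_derivative) (simp add: linear_conv_bounded_linear)

text \<open>The spray is carried to the spray; the term with the second derivative of \<open>\<phi>\<close> is the
  inhomogeneous part of the action of \<open>\<phi>\<close> on second-order vector fields.\<close>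

lemma tm_spray_vec_transform:
  fixes \<phi> :: "real^'n \<Rightarrow> real^'n" and f f' :: "(real^'n) \<times> (real^'n) \<Rightarrow> real"
  assumes S: "open S" "smooth_on S \<phi>"
    and U: "open U" "U \<subseteq> S \<times> UNIV" "smooth_on U f" "\<And>z. z \<in> U \<Longrightarrow> invertible (fibre_metric f z)"
    and U': "open U'" "smooth_on U' f'" "\<And>z. z \<in> U' \<Longrightarrow> invertible (fibre_metric f' z)"
    and f: "tangent_lift \<phi> ` U \<subseteq> U'" "\<And>z. z \<in> U \<Longrightarrow> f z = f' (tangent_lift \<phi> z)"
    and xy: "(x, y) \<in> U" and surj: "surj (frechet_derivative \<phi> (at x))"
  shows "tm_spray_vec f' (tangent_lift \<phi> (x, y)) =
    frechet_derivative \<phi> (at x) (tm_spray_vec f (x, y)) -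
    (1/2) *\<^sub>R frechet_derivative (\<lambda>x. frechet_derivative \<phi> (at x) y) (at x) y"
proof -
  let ?\<Phi> = "tangent_lift \<phi>" and ?J = "frechet_derivative \<phi> (at x)"
  let ?Q = "\<lambda>a b. frechet_derivative (\<lambda>x. frechet_derivative \<phi> (at x) b) (at x) a"
  let ?G = "tm_spray_vec f (x, y)"
  let ?G' = "?J ?G - (1/2) *\<^sub>R ?Q y y"
  have x: "x \<in> S" using U(2) xy by blast
  have \<Phi>: "smooth_on U ?\<Phi>" by (rule smooth_on_tangent_lift[OF S U(1,2)])
  have \<Phi>xy: "?\<Phi> (x, y) \<in> U'" using f(1) xy by blast
  have J: "linear ?J" by (rule has_derivative_linear[OF smooth_on_has_derivative[OF S(2) x]])
  have Q: "linear (?Q a)" for a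
    using bilinear_second_frechet[OF S x] by (auto simp: bilinear_def)
  have D\<Phi>: "frechet_derivative ?\<Phi> (at (x, y)) (a, b) = (?J a, ?Q a y + ?J b)" for y a b
    by (rule frechet_tangent_lift[OF S x])
  have D\<Phi>0: "frechet_derivative ?\<Phi> (at (x, y)) (0, v) = (0, ?J v)" for v
    unfolding D\<Phi> by (simp add: linear_0[OF J] bilinear_lzero[OF bilinear_second_frechet[OF S x]])
  note lin' = has_derivative_linear[OF smooth_on_has_derivative[OF U'(2) \<Phi>xy]]
  let ?s = "(y, - 2 *\<^sub>R ?G)" and ?s' = "(?J y, - 2 *\<^sub>R ?G')"
  \<comment> \<open>The lift carries \<open>(y, - 2 G)\<close> to the candidate at the image point:
    the term \<open>?Q y y\<close> is absorbed into \<open>- 2 G'\<close>, and this fixes the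
    coefficient 1/2 in \<open>?G'\<close>.\<close>
  have s': "frechet_derivative ?\<Phi> (at (x, y)) ?s = ?s'"
    unfolding D\<Phi> by (simp add: linear_scale[OF J] linear_neg[OF J] algebra_simps)
  \<comment> \<open>With the base point and the direction \<open>?s\<close> fixed, the derivative of
    the lift is affine in the fibre point, with linear part \<open>?Q y\<close> in the second
    component.\<close>
  have D2\<Phi>: "frechet_derivative (\<lambda>z. frechet_derivative ?\<Phi> (at z) ?s) (at (x, y)) (0, v) = (0, ?Q y v)" for v
  proof -
    have 1: "((\<lambda>w. frechet_derivative ?\<Phi> (at (x, w)) ?s) has_derivative
        (\<lambda>v. frechet_derivative (\<lambda>z. frechet_derivative ?\<Phi> (at z) ?s) (at (x, y)) (0, v))) (at y)"
      by (rule frechet_derivative_snd_direction[OF smooth_on_differentiable[OF smooth_on_frechet[OF \<Phi>] xy]])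
    have 2: "((\<lambda>w. (?J y, ?Q y w + ?J (- 2 *\<^sub>R ?G))) has_derivative (\<lambda>v. (0, ?Q y v + 0))) (at y)"
      by (intro has_derivative_Pair has_derivative_add has_derivative_const has_derivative_linear_apply Q)
    from has_derivative_unique[OF 1[unfolded D\<Phi>] 2] show ?thesis
      by (drule_tac fun_cong[of _ _ v]) simp
  qed
  have "frechet_derivative (\<lambda>w. frechet_derivative f' (at w) ?s') (at (?\<Phi> (x, y))) (0, w) =
      frechet_derivative f' (at (?\<Phi> (x, y))) (w, 0)" for w
  proof -
    \<comment> \<open>Every test direction at the image point comes from one at
      \<open>(x, y)\<close>, so the whole system of Euler-Lagrange equations is transported.\<close>
    obtain v where w: "w = ?J v" using surj by (metis surjD)
    have "frechet_derivative (\<lambda>z. frechet_derivative f (at z) ?s) (at (x, y)) (0, v) =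
        frechet_derivative f (at (x, y)) (v, 0)"
      using tm_spray_vec_eq_iff[OF U(1,3) xy U(4)[OF xy], of ?G] by simp
    also have "frechet_derivative (\<lambda>z. frechet_derivative f (at z) ?s) (at (x, y)) (0, v) =
        frechet_derivative (\<lambda>w. frechet_derivative f' (at w) ?s') (at (?\<Phi> (x, y))) (0, w) +
        frechet_derivative f' (at (?\<Phi> (x, y))) (0, ?Q y v)"
      using second_frechet_compose[OF U(1) \<Phi> f(1) U'(1,2) f(2) xy, of ?s "(0, v)"]
      unfolding s' D2\<Phi> D\<Phi>0 w .
    also have "frechet_derivative f (at (x, y)) (v, 0) = frechet_derivative f' (at (?\<Phi> (x, y))) (w, ?Q v y)"
      using frechet_derivative_compose_on[OF U(1) \<Phi> f(1) U'(2) f(2) xy, of "(v, 0)"]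
      unfolding D\<Phi> w by (simp add: linear_0[OF J])
    \<comment> \<open>The second-order side has acquired the vertical term \<open>?Q y v\<close>,
      the first-order side \<open>?Q v y\<close>. By symmetry they cancel.\<close>
    also have "?Q v y = ?Q y v"
      by (rule second_derivative_symmetric[OF S x])
    also have "frechet_derivative f' (at (?\<Phi> (x, y))) (w, ?Q y v) =
        frechet_derivative f' (at (?\<Phi> (x, y))) (w, 0) + frechet_derivative f' (at (?\<Phi> (x, y))) (0, ?Q y v)"
      using linear_add[OF lin', of "(w, 0)" "(0, ?Q y v)"] by simp
    finally show ?thesis by simp
  qed
  then show ?thesis
    using tm_spray_vec_eq_iff[OF U'(1,2) \<Phi>xy U'(3)[OF \<Phi>xy], of ?G'] by (simp add: tangent_lift_Pair)
qed

text \<open>The transformation rule of the spray holds at all fibre points near \<open>y\<close>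
  over the same \<open>x\<close>, so its two sides have the same derivative in the fibre variable.
  The left side is differentiated by the chain rule, the right side term by term.\<close>

lemma tm_N_matrix_transform:
  fixes \<phi> :: "real^'n \<Rightarrow> real^'n" and f f' :: "(real^'n) \<times> (real^'n) \<Rightarrow> real"
  assumes S: "open S" "smooth_on S \<phi>"
    and U: "open U" "U \<subseteq> S \<times> UNIV" "smooth_on U f" "\<And>z. z \<in> U \<Longrightarrow> invertible (fibre_metric f z)"
    and U': "open U'" "smooth_on U' f'" "\<And>z. z \<in> U' \<Longrightarrow> invertible (fibre_metric f' z)"
    and f: "tangent_lift \<phi> ` U \<subseteq> U'" "\<And>z. z \<in> U \<Longrightarrow> f z = f' (tangent_lift \<phi> z)"
    and xy: "(x, y) \<in> U" and surj: "surj (frechet_derivative \<phi> (at x))"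
  shows "tm_N_matrix f' (tangent_lift \<phi> (x, y)) *v frechet_derivative \<phi> (at x) v =
    frechet_derivative \<phi> (at x) (tm_N_matrix f (x, y) *v v) -
    frechet_derivative (\<lambda>x. frechet_derivative \<phi> (at x) y) (at x) v"
proof -
  let ?\<Phi> = "tangent_lift \<phi>" and ?J = "frechet_derivative \<phi> (at x)"
  let ?Q = "\<lambda>a b. frechet_derivative (\<lambda>x. frechet_derivative \<phi> (at x) b) (at x) a"
  have x: "x \<in> S" using U(2) xy by blast
  have \<Phi>xy: "?\<Phi> (x, y) \<in> U'" using f(1) xy by blast
  have J: "linear ?J" by (rule has_derivative_linear[OF smooth_on_has_derivative[OF S(2) x]])
  have Q: "bounded_bilinear ?Q"
    using bilinear_second_frechet[OF S x] by (simp add: bilinear_conv_bounded_bilinear)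
  let ?V = "Pair x -` U"
  have "continuous_on UNIV (Pair x :: real^'n \<Rightarrow> (real^'n) \<times> (real^'n))"
    by (intro continuous_intros)
  then have V: "open ?V" "y \<in> ?V"
    using xy open_vimage[OF U(1)] by auto
  have "((\<lambda>y. tm_spray_vec f' (\<phi> x, ?J y)) has_derivative
      (\<lambda>v. frechet_derivative (tm_spray_vec f') (at (?\<Phi> (x, y))) (0, ?J v))) (at y)"
  proof (rule has_derivative_compose[of "\<lambda>y. (\<phi> x, ?J y)"])
    show "((\<lambda>y. (\<phi> x, ?J y)) has_derivative (\<lambda>v. (0, ?J v))) (at y)"
      by (intro has_derivative_Pair has_derivative_const has_derivative_linear_apply J)
    show "(tm_spray_vec f' has_derivative frechet_derivative (tm_spray_vec f') (at (?\<Phi> (x, y))))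
        (at (\<phi> x, ?J y))"
      using smooth_on_has_derivative[OF smooth_on_tm_spray_vec[OF U'] \<Phi>xy] by (simp add: tangent_lift_Pair)
  qed
  moreover have "((\<lambda>y. tm_spray_vec f' (\<phi> x, ?J y)) has_derivative
      (\<lambda>v. ?J (frechet_derivative (tm_spray_vec f) (at (x, y)) (0, v)) -
        (1/2) *\<^sub>R (?Q y v + ?Q v y))) (at y)"
  proof (rule has_derivative_transform_within_open[OF _ V])
    show "((\<lambda>y. ?J (tm_spray_vec f (x, y)) - (1/2) *\<^sub>R ?Q y y) has_derivative
        (\<lambda>v. ?J (frechet_derivative (tm_spray_vec f) (at (x, y)) (0, v)) - (1/2) *\<^sub>R (?Q y v + ?Q v y))) (at y)"
      by (intro has_derivative_diff has_derivative_scaleR_right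
          bounded_bilinear.FDERIV[OF Q has_derivative_ident has_derivative_ident]
          has_derivative_compose[OF _ has_derivative_linear_apply[OF J]]
          frechet_derivative_snd_direction[OF smooth_on_differentiable[OF smooth_on_tm_spray_vec[OF U(1,3,4)] xy]])
    show "?J (tm_spray_vec f (x, y)) - (1/2) *\<^sub>R ?Q y y = tm_spray_vec f' (\<phi> x, ?J y)" if "y \<in> ?V" for y
      using tm_spray_vec_transform[OF S U U' f _ surj, of y] that by (simp add: tangent_lift_Pair)
  qed
  ultimately have "frechet_derivative (tm_spray_vec f') (at (?\<Phi> (x, y))) (0, ?J v) =
      ?J (frechet_derivative (tm_spray_vec f) (at (x, y)) (0, v)) - (1/2) *\<^sub>R (?Q y v + ?Q v y)"
    by (rule has_derivative_unique[THEN fun_cong])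
  \<comment> \<open>Half of the quadratic term \<open>?Q y y\<close> differentiates to half the sum
    of two mixed terms, which symmetry merges into one \<open>?Q v y\<close>.\<close>
  moreover have "?Q y v = ?Q v y" by (rule second_derivative_symmetric[OF S x])
  moreover have "tm_N_matrix f' (?\<Phi> (x, y)) *v ?J v = frechet_derivative (tm_spray_vec f') (at (?\<Phi> (x, y))) (0, ?J v)"
    by (rule tm_N_matrix_mult[OF U' \<Phi>xy])
  moreover have "tm_N_matrix f (x, y) *v v = frechet_derivative (tm_spray_vec f) (at (x, y)) (0, v)"
    by (rule tm_N_matrix_mult[OF U(1,3,4) xy])
  ultimately show ?thesis by (simp flip: scaleR_2)
qed

text \<open>In \<open>b + N a\<close> the second-derivative term of the lift cancels against the
  inhomogeneous term of \<open>N'\<close>. Hence \<open>a\<close> and \<open>b + N a\<close> are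
  both mapped by the Jacobian of \<phi>, which commutes with the rotation of this pair.\<close>

lemma adapted_J_tangent_lift:
  fixes \<phi> :: "real^'n \<Rightarrow> real^'n"
  assumes S: "open S" "smooth_on S \<phi>" "x \<in> S"
    and N: "\<And>v. N' *v frechet_derivative \<phi> (at x) v =
      frechet_derivative \<phi> (at x) (N *v v) - frechet_derivative (\<lambda>x. frechet_derivative \<phi> (at x) y) (at x) v"
  shows "frechet_derivative (tangent_lift \<phi>) (at (x, y)) (adapted_J N h) =
    adapted_J N' (frechet_derivative (tangent_lift \<phi>) (at (x, y)) h)"
proof -
  obtain a b where h: "h = (a, b)" by (cases h)
  let ?J = "frechet_derivative \<phi> (at x)"
  have J: "linear ?J" by (rule has_derivative_linear[OF smooth_on_has_derivative[OF S(2,3)]])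
  have 1: "frechet_derivative (\<lambda>x. frechet_derivative \<phi> (at x) y) (at x) a + ?J b + N' *v ?J a = ?J (b + N *v a)"
    unfolding N by (simp add: linear_add[OF J])
  show ?thesis
    unfolding h adapted_J_def fst_conv snd_conv frechet_tangent_lift[OF S] 1
    by (simp add: N linear_diff[OF J] linear_neg[OF J])
qed

section \<open>Change of the base chart with the fibre coordinates kept fixed\<close>

definition base_lift :: "('a \<Rightarrow> 'b) \<Rightarrow> 'a \<times> 'c \<Rightarrow> 'b \<times> 'c" where
  "base_lift \<phi> z = (\<phi> (fst z), snd z)"

lemma smooth_on_base_lift:
  fixes \<phi> :: "'a::euclidean_space \<Rightarrow> 'b::real_normed_vector"
    and U :: "('a \<times> 'c::real_normed_vector) set"
  assumes "open S" "smooth_on S \<phi>" "open U" "U \<subseteq> S \<times> UNIV"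
  shows "smooth_on U (base_lift \<phi>)"
proof -
  have f: "fst ` U \<subseteq> S" using assms(4) by auto
  have "smooth_on U (\<lambda>z. (\<phi> (fst z), snd z))"
    by (intro smooth_on_Pair[OF assms(3)] smooth_on_snd[OF assms(3) smooth_on_id[OF assms(3)]]
        smooth_on_compose[OF assms(3,1) f smooth_on_fst[OF assms(3) smooth_on_id[OF assms(3)]] assms(2)])
  then show ?thesis by (simp add: base_lift_def[abs_def])
qed

lemma frechet_base_lift:
  fixes y :: "'c::real_normed_vector"
  assumes "smooth_on S \<phi>" "x \<in> S"
  shows "frechet_derivative (base_lift \<phi>) (at (x, y)) (a, b) = (frechet_derivative \<phi> (at x) a, b)"
proof -
  have "((\<lambda>z::'a \<times> 'c. \<phi> (fst z)) has_derivative (\<lambda>h. frechet_derivative \<phi> (at x) (fst h))) (at (x, y))"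
    using smooth_on_has_derivative[OF assms]
    by (intro has_derivative_compose[OF has_derivative_fst[OF has_derivative_ident]]) simp
  then have "((\<lambda>z::'a \<times> 'c. (\<phi> (fst z), snd z)) has_derivative
      (\<lambda>h. (frechet_derivative \<phi> (at x) (fst h), snd h))) (at (x, y))"
    by (intro has_derivative_Pair has_derivative_snd has_derivative_ident)
  from frechet_derivativeI[OF this, of "(a, b)"] show ?thesis
    by (simp add: base_lift_def[abs_def])
qed

text \<open>Sums over base indices become derivatives along one vector, on which the chain rule can
  act.\<close>

lemma frechet_eq_sum_base_pd:
  fixes f :: "(real^'n) \<times> (real^'r) \<Rightarrow> real"
  assumes "f differentiable (at z)"
  shows "(\<Sum>i\<in>UNIV. r i * base_pd i f z) = frechet_derivative f (at z) (\<chi> i. r i, 0)"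
  by (simp add: frechet_derivative_pd[OF assms])

lemma sum_fibre_pd_base_pd:
  fixes f :: "(real^'n) \<times> (real^'r) \<Rightarrow> real"
  assumes "open U" "smooth_on U f" "z \<in> U"
  shows "(\<Sum>i\<in>UNIV. r i * fibre_pd b (base_pd i f) z) =
    frechet_derivative (\<lambda>w. frechet_derivative f (at w) (\<chi> i. r i, 0)) (at z) (0, axis b 1)"
  by (simp add: second_frechet_pd[OF assms] fibre_pd_def)

text \<open>Fibre derivatives, and with them the metric, do not notice a change of base coordinates.
  Base derivatives occur only along the anchors of \<open>v_b\<close> and of the point
  \<open>u\<close>, and the Jacobian carries these vectors to their counterparts at the image
  point.\<close>

lemma la_spray_transform:
  fixes \<phi> :: "real^'n \<Rightarrow> real^'n" and f f' :: "(real^'n) \<times> (real^'r) \<Rightarrow> real"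
  assumes S: "open S" "smooth_on S \<phi>" and U: "open U" "U \<subseteq> S \<times> UNIV"
    and U': "open U'" "smooth_on U' f'" and sf: "smooth_on U f"
    and f: "base_lift \<phi> ` U \<subseteq> U'" "\<And>z. z \<in> U \<Longrightarrow> f z = f' (base_lift \<phi> z)" and z: "(x, u) \<in> U"
    and \<rho>: "\<And>i c. \<rho>' (\<phi> x) i c = frechet_derivative \<phi> (at x) (\<chi> k. \<rho> x k c) $ i"
    and C: "C' (\<phi> x) = C x"
  shows "la_spray \<rho>' C' f' a (base_lift \<phi> (x, u)) = la_spray \<rho> C f a (x, u)"
proof -
  let ?\<Phi> = "base_lift \<phi>" and ?J = "frechet_derivative \<phi> (at x)"
  let ?z = "(x, u)" and ?w = "base_lift \<phi> (x, u)"
  have x: "x \<in> S" using U(2) z by blast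
  have \<Phi>: "smooth_on U ?\<Phi>" by (rule smooth_on_base_lift[OF S U])
  have w: "?w \<in> U'" using f(1) z by blast
  have w_eq: "?w = (\<phi> x, u)" by (simp add: base_lift_def)
  have J: "linear ?J" by (rule has_derivative_linear[OF smooth_on_has_derivative[OF S(2) x]])
  have D\<Phi>: "frechet_derivative ?\<Phi> (at (x, v)) (a, b) = (?J a, b)" for v a b
    by (rule frechet_base_lift[OF S(2) x])
  \<comment> \<open>The derivative of \<open>base_lift\<close> does not depend on the fibre point,
    so it is constant along vertical directions and the second-order chain rule has no extra
    term.\<close>
  have D2\<Phi>: "frechet_derivative (\<lambda>z. frechet_derivative ?\<Phi> (at z) (a, b)) (at ?z) (0, v) = 0" for a b v
  proof -
    have "((\<lambda>v. frechet_derivative ?\<Phi> (at (x, v)) (a, b)) has_derivative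
        (\<lambda>v. frechet_derivative (\<lambda>z. frechet_derivative ?\<Phi> (at z) (a, b)) (at ?z) (0, v))) (at u)"
      by (rule frechet_derivative_snd_direction[OF smooth_on_differentiable[OF smooth_on_frechet[OF \<Phi>] z]])
    from has_derivative_unique[OF this[unfolded D\<Phi>] has_derivative_const] show ?thesis
      by (drule_tac fun_cong[of _ _ v]) simp
  qed
  have D: "frechet_derivative f (at ?z) (a, b) = frechet_derivative f' (at ?w) (?J a, b)" for a b
    using frechet_derivative_compose_on[OF U(1) \<Phi> f(1) U'(2) f(2) z] by (simp add: D\<Phi>)
  have D2: "frechet_derivative (\<lambda>z. frechet_derivative f (at z) (a, b)) (at ?z) (0, v) =
      frechet_derivative (\<lambda>w. frechet_derivative f' (at w) (?J a, b)) (at ?w) (0, v)" for a b v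
    using second_frechet_compose[OF U(1) \<Phi> f(1) U' f(2) z, of "(a, b)" "(0, v)"]
      linear_0[OF has_derivative_linear[OF smooth_on_has_derivative[OF U'(2) w]]]
    unfolding D2\<Phi> D\<Phi> by (simp add: linear_0[OF J])
  have pd: "fibre_pd e f ?z = fibre_pd e f' ?w" for e
    unfolding fibre_pd_def D by (simp add: linear_0[OF J])
  have "fibre_pd b (fibre_pd e f) ?z = fibre_pd b (fibre_pd e f') ?w" for b e
    using D2[of 0 "axis e 1" "axis b 1"] by (simp add: fibre_pd_def[abs_def] linear_0[OF J])
  then have g: "fibre_metric f ?z = fibre_metric f' ?w"
    by (simp add: fibre_metric_def)
  have dx: "(\<Sum>i\<in>UNIV. \<rho> x i b * base_pd i f ?z) = (\<Sum>i\<in>UNIV. \<rho>' (\<phi> x) i b * base_pd i f' ?w)" for b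
    unfolding frechet_eq_sum_base_pd[OF smooth_on_differentiable[OF sf z]]
      frechet_eq_sum_base_pd[OF smooth_on_differentiable[OF U'(2) w]] D \<rho> by simp
  have dux: "(\<Sum>i\<in>UNIV. \<Sum>c\<in>UNIV. fibre_pd b (base_pd i f) ?z * \<rho> x i c * u $ c) =
      (\<Sum>i\<in>UNIV. \<Sum>c\<in>UNIV. fibre_pd b (base_pd i f') ?w * \<rho>' (\<phi> x) i c * u $ c)" for b
  proof -
    have *: "(\<Sum>i\<in>UNIV. \<Sum>c\<in>UNIV. h i * r i c * u $ c) = (\<Sum>i\<in>UNIV. (\<Sum>c\<in>UNIV. r i c * u $ c) * h i)"
      for h :: "'n \<Rightarrow> real" and r :: "'n \<Rightarrow> 'r \<Rightarrow> real"
      by (simp add: sum_distrib_left mult_ac)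
    \<comment> \<open>This vector represents the anchor of \<open>u\<close>. The double sum is a
      second derivative, taken once along this vector and once along the fibre.\<close>
    have "(\<chi> i. \<Sum>c\<in>UNIV. \<rho> x i c * u $ c) = (\<Sum>c\<in>UNIV. u $ c *\<^sub>R (\<chi> k. \<rho> x k c))"
      by (simp add: vec_eq_iff mult.commute)
    then have "?J (\<chi> i. \<Sum>c\<in>UNIV. \<rho> x i c * u $ c) = (\<Sum>c\<in>UNIV. u $ c *\<^sub>R ?J (\<chi> k. \<rho> x k c))"
      by (simp only: linear_sum[OF J] linear_scale[OF J])
    also have "\<dots> = (\<chi> i. \<Sum>c\<in>UNIV. \<rho>' (\<phi> x) i c * u $ c)"
      by (simp add: vec_eq_iff \<rho> mult.commute)
    finally show ?thesis
      unfolding * sum_fibre_pd_base_pd[OF U(1) sf z] sum_fibre_pd_base_pd[OF U' w] D2 by simp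
  qed
  show ?thesis
    unfolding la_spray_def g[symmetric] using dx dux pd C by (simp add: w_eq)
qed

lemma smooth_on_la_spray:
  fixes f :: "(real^'n) \<times> (real^'r) \<Rightarrow> real"
  assumes "open S" "\<And>i c. smooth_on S (\<lambda>x. \<rho> x i c)" "\<And>e a b. smooth_on S (\<lambda>x. C x e a b)"
    and U: "open U" "U \<subseteq> S \<times> UNIV" and f: "smooth_on U f" "\<And>z. z \<in> U \<Longrightarrow> invertible (fibre_metric f z)"
  shows "smooth_on U (la_spray \<rho> C f a)"
proof -
  have fst: "smooth_on U (\<lambda>z. g (fst z))" if "smooth_on S g" for g :: "real^'n \<Rightarrow> real"
    by (rule smooth_on_compose[OF U(1) assms(1) _ smooth_on_fst[OF U(1) smooth_on_id[OF U(1)]] that])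
      (use U(2) in auto)
  have "smooth_on U (\<lambda>z. la_spray \<rho> C f a z)"
    unfolding la_spray_def
    by (intro smooth_on_mult smooth_on_sum smooth_on_diff smooth_on_add smooth_on_const smooth_on_matrix_inv
        smooth_on_fibre_metric smooth_on_fibre_pd smooth_on_base_pd fst[OF assms(2)] fst[OF assms(3)]
        smooth_on_nth smooth_on_snd smooth_on_id U(1) f)
  then show ?thesis by simp
qed

text \<open>The spray coefficients agree on the whole open set \<open>U\<close>, and the derivative
  of \<open>base_lift\<close> fixes vertical vectors. The fibre derivatives of the coefficients
  therefore agree entry by entry.\<close>

lemma la_N_transform:
  fixes \<phi> :: "real^'n \<Rightarrow> real^'n" and f f' :: "(real^'n) \<times> (real^'r) \<Rightarrow> real"
  assumes S: "open S" "smooth_on S \<phi>" and U: "open U" "U \<subseteq> S \<times> UNIV"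
    and U': "open U'" "smooth_on U' f'" and sf: "smooth_on U f"
    and f: "base_lift \<phi> ` U \<subseteq> U'" "\<And>z. z \<in> U \<Longrightarrow> f z = f' (base_lift \<phi> z)" and z: "z \<in> U"
    and \<rho>: "\<And>x i c. x \<in> S \<Longrightarrow> \<rho>' (\<phi> x) i c = frechet_derivative \<phi> (at x) (\<chi> k. \<rho> x k c) $ i"
    and C: "\<And>x. x \<in> S \<Longrightarrow> C' (\<phi> x) = C x"
    and G: "smooth_on U' (la_spray \<rho>' C' f' a)"
  shows "la_N \<rho>' C' f' a b (base_lift \<phi> z) = la_N \<rho> C f a b z"
proof -
  have eq: "la_spray \<rho> C f a w = la_spray \<rho>' C' f' a (base_lift \<phi> w)" if w: "w \<in> U" for w
  proof (cases w)
    case (Pair x u)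
    have "x \<in> S" using U(2) w Pair by blast
    with w show ?thesis
      unfolding Pair
      by (intro la_spray_transform[OF S U U' sf f, symmetric] \<rho> C)
  qed
  obtain x u where xu: "z = (x, u)" by (cases z)
  have x: "x \<in> S" using U(2) z xu by blast
  have "frechet_derivative (la_spray \<rho> C f a) (at z) (0, axis b 1) =
      frechet_derivative (la_spray \<rho>' C' f' a) (at (base_lift \<phi> z)) (frechet_derivative (base_lift \<phi>) (at z) (0, axis b 1))"
    by (rule frechet_derivative_compose_on[OF U(1) smooth_on_base_lift[OF S U] f(1) G eq z])
  also have "frechet_derivative (base_lift \<phi>) (at z) (0, axis b 1) = (0, axis b 1)"
    unfolding xu frechet_base_lift[OF S(2) x]
    by (simp add: linear_0[OF has_derivative_linear[OF smooth_on_has_derivative[OF S(2) x]]])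
  finally show ?thesis by (simp add: la_N_def fibre_pd_def)
qed


section \<open>Adapted frames\<close>

lemma triv_zero_iff: "triv_at V t p \<Longrightarrow> v \<in> V p \<Longrightarrow> snd t p v = 0 \<longleftrightarrow> v = 0"
  using triv_scaleR[of V t p v 0] triv_eqI[of V t p v 0] subspace_0[OF triv_at_subspace, of V t p]
    triv_scaleR[of V t p 0 0] by auto

lemma triv_minus: "triv_at V t p \<Longrightarrow> v \<in> V p \<Longrightarrow> snd t p (- v) = - snd t p v"
  using triv_scaleR[of V t p v "-1"] by simp

lemma triv_sum:
  assumes t: "triv_at V t p" and "\<And>i. i \<in> I \<Longrightarrow> v i \<in> V p"
  shows "snd t p (\<Sum>i\<in>I. r i *\<^sub>R v i) = (\<Sum>i\<in>I. r i *\<^sub>R snd t p (v i))"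
  using assms(2)
proof (induction I rule: infinite_finite_induct)
  case (insert i I)
  then have "v i \<in> V p" "(\<Sum>i\<in>I. r i *\<^sub>R v i) \<in> V p"
    by (auto intro!: subspace_sum subspace_scale triv_at_subspace[OF t])
  with insert show ?case
    by (simp add: triv_add[OF t] triv_scaleR[OF t] subspace_scale[OF triv_at_subspace[OF t]])
qed (simp_all add: triv_zero_iff[OF t] subspace_0[OF triv_at_subspace[OF t]])

text \<open>A trivialization is injective on the fibre, so all three equations are compared in
  components. The coefficients in the expansion, \<open>a\<close> and \<open>k + N a\<close> for
  components \<open>(a, k)\<close>, are the values of the dual coframe.\<close>

lemma adapted_frame:
  fixes N :: "real^'r^'r"
  assumes t: "triv_at V t p"
    and v: "\<And>a. v a \<in> V p" "\<And>a. snd t p (v a) = (0, axis a 1)"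
    and e: "\<And>a. e a \<in> V p" "\<And>a. snd t p (e a) = (axis a 1, - (N *v axis a 1))"
    and F: "\<And>X. X \<in> V p \<Longrightarrow> F X \<in> V p" "\<And>X. X \<in> V p \<Longrightarrow> snd t p (F X) = adapted_J N (snd t p X)"
  shows "F (e a) = - v a" "F (v a) = e a"
    and "X \<in> V p \<Longrightarrow> F X = - (\<Sum>a\<in>UNIV. fst (snd t p X) $ a *\<^sub>R v a) +
      (\<Sum>a\<in>UNIV. (snd (snd t p X) + N *v fst (snd t p X)) $ a *\<^sub>R e a)"
proof -
  note V = triv_at_subspace[OF t]
  show "F (e a) = - v a"
    by (rule triv_eqI[OF t]) (simp_all add: F e v subspace_neg[OF V] triv_minus[OF t] adapted_J_def)
  show "F (v a) = e a"
    by (rule triv_eqI[OF t]) (simp_all add: F e v adapted_J_def)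
  assume X: "X \<in> V p"
  let ?a = "fst (snd t p X)" and ?w = "snd (snd t p X) + N *v fst (snd t p X)"
  have s: "(\<Sum>a\<in>UNIV. ?a $ a *\<^sub>R v a) \<in> V p" "(\<Sum>a\<in>UNIV. ?w $ a *\<^sub>R e a) \<in> V p"
    by (auto intro!: subspace_sum[OF V] subspace_scale[OF V] v e)
  show "F X = - (\<Sum>a\<in>UNIV. ?a $ a *\<^sub>R v a) + (\<Sum>a\<in>UNIV. ?w $ a *\<^sub>R e a)"
  proof (rule triv_eqI[OF t])
    have exp: "(\<Sum>a\<in>UNIV. x $ a *\<^sub>R axis a 1) = x" for x :: "real^'r"
      using basis_expansion[of x] by (simp add: scalar_mult_eq_scaleR)
    have expN: "(\<Sum>a\<in>UNIV. x $ a *\<^sub>R (N *v axis a 1)) = N *v x" for x :: "real^'r"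
    proof -
      have "N *v (\<Sum>a\<in>UNIV. x $ a *\<^sub>R axis a 1) = (\<Sum>a\<in>UNIV. x $ a *\<^sub>R (N *v axis a 1))"
        by (simp only: linear_sum[OF matrix_vector_mul_linear] linear_scale[OF matrix_vector_mul_linear])
      then show ?thesis by (simp add: exp)
    qed
    have "snd t p (\<Sum>a\<in>UNIV. ?a $ a *\<^sub>R v a) = (0, ?a)"
      unfolding triv_sum[OF t v(1)] v(2) by (simp add: prod_eq_iff fst_sum snd_sum exp)
    moreover have "snd t p (\<Sum>a\<in>UNIV. ?w $ a *\<^sub>R e a) = (?w, - (N *v ?w))"
      unfolding triv_sum[OF t e(1)] e(2)
      by (simp only: prod_eq_iff fst_sum snd_sum exp fst_conv snd_conv fst_scaleR snd_scaleR
          scaleR_minus_right sum_negf expN)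
    ultimately show "snd t p (F X) =
        snd t p (- (\<Sum>a\<in>UNIV. ?a $ a *\<^sub>R v a) + (\<Sum>a\<in>UNIV. ?w $ a *\<^sub>R e a))"
      unfolding triv_add[OF t subspace_neg[OF V s(1)] s(2)] triv_minus[OF t s(1)] F(2)[OF X] adapted_J_def
      by simp
  qed (rule F(1)[OF X], rule subspace_add[OF V subspace_neg[OF V s(1)] s(2)])
qed

section \<open>The slit tangent bundle\<close>

text \<open>The adapted frames subtract a sum over the upper index of the connection, which is a
  column of its matrix.\<close>

lemma matrix_column_sum:
  fixes N :: "real^'n^'n"
  shows "(\<Sum>j\<in>UNIV. N $ j $ i *\<^sub>R axis j 1) = N *v axis i 1"
proof -
  have "(\<Sum>j\<in>UNIV. N $ j $ i *\<^sub>R axis j 1) $ k = N $ k $ i" for k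
    by (simp add: axis_def if_distrib cong: if_cong)
  moreover have "(N *v axis i 1) $ k = N $ k $ i" for k
    by (simp add: matrix_vector_mul_component inner_axis)
  ultimately show ?thesis by (simp add: vec_eq_iff)
qed

lemma slit_total_iff: "(p, v) \<in> slit_total M V \<longleftrightarrow> p \<in> M \<and> v \<in> V p \<and> v \<noteq> 0"
  by (simp add: slit_total_def)

lemma openin_base:
  assumes "smooth_atlas M A"
  shows "openin (atlas_topology M A) M"
proof -
  have "fst c \<inter> M = fst c" if "c \<in> A" for c
    using assms that unfolding smooth_atlas_def by blast
  then show ?thesis
    using assms unfolding openin_atlas_topology[OF assms] by (simp add: smooth_atlas_def)
qed

text \<open>A trivialization is linear and injective on each fibre, so leaving out the zero section
  leaves out exactly 0 among the fibre coordinates.\<close>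

lemma bundle_chart_image_slit:
  assumes "vector_bundle M A V B" "t \<in> B"
  shows "snd (bundle_chart V c t) ` (fst (bundle_chart V c t) \<inter> slit_total S V) =
    snd c ` (fst c \<inter> (fst t \<inter> S)) \<times> (UNIV - {0})" (is "?L = ?R")
proof
  show "?L \<subseteq> ?R"
  proof
    fix z assume "z \<in> ?L"
    then obtain p v where z: "z = snd (bundle_chart V c t) (p, v)"
      and "(p, v) \<in> fst (bundle_chart V c t)" "(p, v) \<in> slit_total S V"
      by auto
    then show "z \<in> ?R" unfolding z
      using triv_zero_iff[OF vector_bundle_triv_at[OF assms, of p], of v]
      by (auto simp: fst_bundle_chart snd_bundle_chart slit_total_iff)
  qed
  show "?R \<subseteq> ?L"
  proof
    fix z assume "z \<in> ?R"
    then obtain p \<xi> where z: "z = (snd c p, \<xi>)" and p: "p \<in> fst c" "p \<in> fst t" "p \<in> S" and \<xi>: "\<xi> \<noteq> 0"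
      by auto
    note b = vector_bundle_triv_at[OF assms p(2)]
    have eq: "(snd c p, \<xi>) = snd (bundle_chart V c t) (p, triv_vec V t \<xi> p)"
      by (simp add: snd_bundle_chart triv_triv_vec[OF b])
    have "triv_vec V t \<xi> p \<noteq> 0"
      using \<xi> triv_zero_iff[OF b triv_vec_in[OF b], of \<xi>] by (simp add: triv_triv_vec[OF b])
    then have "(p, triv_vec V t \<xi> p) \<in> fst (bundle_chart V c t) \<inter> slit_total S V"
      by (simp add: fst_bundle_chart slit_total_iff p triv_vec_in[OF b])
    then show "z \<in> ?L" unfolding z eq by (rule imageI)
  qed
qed

lemma open_slit_coordinates:
  assumes A: "smooth_atlas M A" and c: "c \<in> A" and S: "openin (atlas_topology M A) S"
  shows "open (snd c ` (fst c \<inter> S) \<times> (UNIV - {0 :: 'f::euclidean_space}))"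
  by (intro open_Times open_chart_image[OF A c S]) auto

lemma openin_slit_total:
  assumes A: "smooth_atlas M A" and V: "vector_bundle M A V B" and S: "openin (atlas_topology M A) S"
    and A': "A' \<subseteq> bundle_atlas A V B" "smooth_atlas {(p, v). p \<in> M \<and> v \<in> V p} A'"
  shows "openin (atlas_topology {(p, v). p \<in> M \<and> v \<in> V p} A') (slit_total S V)"
  unfolding openin_atlas_topology[OF A'(2)]
proof (intro conjI ballI)
  show "slit_total S V \<subseteq> {(p, v). p \<in> M \<and> v \<in> V p}"
    using openin_subset_base[OF A S] by (auto simp: slit_total_def)
  fix C assume "C \<in> A'"
  then obtain c t where c: "c \<in> A" "t \<in> B" and C: "C = bundle_chart V c t"
    using A'(1) unfolding bundle_atlas_def by blast
  show "open (snd C ` (fst C \<inter> slit_total S V))"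
    unfolding C bundle_chart_image_slit[OF V c(2)]
    by (intro open_slit_coordinates[OF A c(1)] openin_Int vector_bundleD(3)[OF V c(2)] S)
qed

lemma frechet_transition_same:
  assumes "smooth_atlas M A" "c \<in> A" "p \<in> fst c"
  shows "frechet_derivative (transition c c) (at (snd c p)) h = h"
  using coord_vec_same_chart[OF assms, of h] assms(2,3) by (simp add: coord_vec_def)

lemma surj_frechet_transition:
  assumes A: "smooth_atlas M A" and c: "c \<in> A" "d \<in> A" and p: "p \<in> fst c" "p \<in> fst d"
  shows "surj (frechet_derivative (transition c d) (at (snd c p)))"
proof (rule surjI)
  fix h
  show "frechet_derivative (transition c d) (at (snd c p)) (frechet_derivative (transition d c) (at (snd d p)) h) = h"
    unfolding frechet_transition_trans[OF A c(2,1,2) p(2,1,2)] by (rule frechet_transition_same[OF A c(2) p(2)])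
qed

text \<open>The transition map of the induced charts coincides with the lift over the overlap of
  \<open>c\<close> and \<open>d\<close>; that set is open, so the derivatives coincide as
  well.\<close>

lemma frechet_tangent_transition:
  assumes A: "smooth_atlas M A" and c: "c \<in> A" "d \<in> A" and p: "p \<in> fst c" "p \<in> fst d"
  shows "frechet_derivative (transition (tangent_chart A c) (tangent_chart A d)) (at (snd c p, y)) =
    frechet_derivative (tangent_lift (transition c d)) (at (snd c p, y))"
proof (rule frechet_derivative_transform_within_open[symmetric])
  let ?S = "snd c ` (fst c \<inter> fst d)"
  have S: "open ?S" by (intro open_chart_image[OF A c(1)] openin_chart_domain[OF A] c)
  show U: "open (?S \<times> UNIV)" by (intro open_Times S) auto
  show in_U: "(snd c p, y) \<in> ?S \<times> UNIV" using p by blast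
  show "tangent_lift (transition c d) differentiable (at (snd c p, y))"
    by (rule smooth_on_differentiable[OF smooth_on_tangent_lift[OF S transition_smooth[OF A c] U] in_U]) auto
  show "tangent_lift (transition c d) z = transition (tangent_chart A c) (tangent_chart A d) z"
    if "z \<in> ?S \<times> UNIV" for z
    using that tangent_transition[OF A c] by (auto simp: tangent_lift_Pair)
qed

section \<open>The connection matrix on the slit tangent bundle and its compatibility between
  charts\<close>

definition tm_connection :: "('p, real^'n) chart set \<Rightarrow> ('p \<times> ('p, real^'n) tvec \<Rightarrow> real) \<Rightarrow>
    ('p, real^'n) chart \<Rightarrow> 'p \<times> ('p, real^'n) tvec \<Rightarrow> real^'n^'n" where
  "tm_connection A L c w = tm_N_matrix (local_rep (tangent_chart A c) L) (snd (tangent_chart A c) w)"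

lemma tm_connection_nth: "tm_connection A L c w $ i $ j = tm_N_at A L c i j w"
  by (simp add: tm_connection_def tm_N_matrix_def tm_N_at_def)

lemma regular_lagrangianD:
  assumes "regular_lagrangian A W L" "c \<in> A"
  shows "smooth_on (snd c ` (fst c \<inter> W)) (local_rep c L)"
    and "z \<in> snd c ` (fst c \<inter> W) \<Longrightarrow> invertible (fibre_metric (local_rep c L) z)"
  using assms unfolding regular_lagrangian_def smooth_fun_def by blast+

lemma tangent_chart_image_slit:
  assumes "smooth_atlas M A" "c \<in> A"
  shows "snd (tangent_chart A c) ` (fst (tangent_chart A c) \<inter> slit_total M (tangent_space A)) =
    snd c ` fst c \<times> (UNIV - {0})"
proof -
  have "fst c \<inter> (fst c \<inter> M) = fst c" using assms by (auto simp: smooth_atlas_def)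
  then show ?thesis
    using bundle_chart_image_slit[OF vector_bundle_tangent[OF assms(1)] imageI[OF assms(2)], of c M]
    by (simp add: tangent_chart_def tangent_triv_def)
qed

lemma tm_connection_compat:
  fixes A :: "('m, real^'n) chart set"
  assumes A: "smooth_atlas M A" and L: "regular_lagrangian (tangent_atlas A) (slit_total M (tangent_space A)) L"
    and c: "c \<in> A" "d \<in> A" and w: "w \<in> slit_total M (tangent_space A)" "fst w \<in> fst c" "fst w \<in> fst d"
  shows "frechet_derivative (transition (tangent_chart A c) (tangent_chart A d)) (at (snd (tangent_chart A c) w))
      (adapted_J (tm_connection A L c w) h) =
    adapted_J (tm_connection A L d w)
      (frechet_derivative (transition (tangent_chart A c) (tangent_chart A d)) (at (snd (tangent_chart A c) w)) h)"
proof -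
  let ?C = "tangent_chart A c" and ?D = "tangent_chart A d" and ?\<phi> = "transition c d"
  let ?S = "snd c ` (fst c \<inter> fst d)" and ?W = "slit_total M (tangent_space A)"
  let ?U' = "snd ?D ` (fst ?D \<inter> ?W)" and ?U = "?S \<times> (UNIV - {0 :: real^'n})"
  have CD: "?C \<in> tangent_atlas A" "?D \<in> tangent_atlas A"
    using c by (auto simp: tangent_atlas_def)
  note TM = smooth_atlas_tangent[OF A]
  obtain p X where w_eq: "w = (p, X)" by (cases w)
  have p: "p \<in> fst c" "p \<in> fst d" and X: "X \<in> tangent_space A p" "X \<noteq> 0"
    using w by (auto simp: w_eq slit_total_iff)
  have S: "open ?S" by (intro open_chart_image[OF A c(1)] openin_chart_domain[OF A] c)
  have sub: "?U \<subseteq> snd ?C ` (fst ?C \<inter> ?W)"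
    unfolding tangent_chart_image_slit[OF A c(1)] by blast
  have U1: "open ?U" by (rule open_slit_coordinates[OF A c(1) openin_chart_domain[OF A c(2)]])
  have U2: "?U \<subseteq> ?S \<times> UNIV" by blast
  note U = U1 U2
  have f: "smooth_on ?U (local_rep ?C L)" "\<And>z. z \<in> ?U \<Longrightarrow> invertible (fibre_metric (local_rep ?C L) z)"
    using smooth_on_subset[OF regular_lagrangianD(1)[OF L CD(1)] sub] regular_lagrangianD(2)[OF L CD(1)] sub
    by blast+
  have U': "open ?U'"
    using open_slit_coordinates[OF A c(2) openin_chart_domain[OF A c(2)], where 'f = "real^'n"]
    unfolding tangent_chart_image_slit[OF A c(2)] by simp
  \<comment> \<open>A coordinate point of \<open>?U\<close> first yields a vector over the domain of
    \<open>c\<close>; injectivity of the chart then puts its base point into the domain of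
    \<open>d\<close> too.\<close>
  have pt: "\<exists>v. v \<in> fst ?C \<inter> fst ?D \<inter> ?W \<and> z = snd ?C v" if z: "z \<in> ?U" for z
  proof -
    obtain v where v: "v \<in> fst ?C" "v \<in> ?W" "z = snd ?C v" using sub z by blast
    obtain q Y where qY: "v = (q, Y)" by (cases v)
    have "snd c q \<in> ?S" using z v(3) by (auto simp: qY snd_tangent_chart)
    then have "q \<in> fst d"
      using v(1) smooth_atlas_inj[OF A c(1)] by (auto simp: qY fst_tangent_chart dest: inj_onD)
    then show ?thesis using v by (auto simp: qY fst_tangent_chart)
  qed
  \<comment> \<open>The component of a tangent vector in \<open>d\<close> is the Jacobian applied to
    its component in \<open>c\<close>, so the lift passes from the coordinates of \<open>?C\<close>
    to those of \<open>?D\<close>.\<close>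
  have lift: "tangent_lift ?\<phi> (snd ?C v) = snd ?D v" if v: "v \<in> fst ?C" "v \<in> fst ?D" for v
  proof -
    obtain q Y where qY: "v = (q, Y)" by (cases v)
    then have q: "q \<in> fst c" "q \<in> fst d" "Y \<in> tangent_space A q"
      using v by (auto simp: fst_tangent_chart)
    show ?thesis
      unfolding qY snd_tangent_chart tangent_lift_Pair transition_apply[OF A c(1) q(1)]
        tangent_vec_transition[OF q(3) c q(1,2), symmetric] by (rule refl)
  qed
  have lift_U: "tangent_lift ?\<phi> ` ?U \<subseteq> ?U'"
  proof (rule image_subsetI)
    fix z assume "z \<in> ?U"
    then obtain v where v: "v \<in> fst ?C" "v \<in> fst ?D" "v \<in> ?W" "z = snd ?C v" using pt by blast
    then show "tangent_lift ?\<phi> z \<in> ?U'" unfolding v(4) lift[OF v(1,2)] by blast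
  qed
  have L_eq: "local_rep ?C L z = local_rep ?D L (tangent_lift ?\<phi> z)" if "z \<in> ?U" for z
  proof -
    obtain v where v: "v \<in> fst ?C" "v \<in> fst ?D" "z = snd ?C v" using pt[OF \<open>z \<in> ?U\<close>] by blast
    show ?thesis
      unfolding v(3) lift[OF v(1,2)] local_rep_apply[OF smooth_atlas_inj[OF TM CD(1)] v(1)]
        local_rep_apply[OF smooth_atlas_inj[OF TM CD(2)] v(2)] by (rule refl)
  qed
  have Xc: "X c \<noteq> 0"
    using triv_zero_iff[OF triv_at_tangent[OF A c(1) p(1)] X(1)] X(2) by (simp add: tangent_triv_def)
  then have z: "(snd c p, X c) \<in> ?U" using p by blast
  have w_C: "snd ?C w = (snd c p, X c)" "snd ?D w = tangent_lift ?\<phi> (snd c p, X c)"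
    using lift[of w] p X(1) by (simp_all add: w_eq snd_tangent_chart fst_tangent_chart)
  show ?thesis
    unfolding tm_connection_def w_C frechet_tangent_transition[OF A c p]
    by (intro adapted_J_tangent_lift[OF S transition_smooth[OF A c] imageI]
        tm_N_matrix_transform[OF S transition_smooth[OF A c] U f U' regular_lagrangianD[OF L CD(2)] lift_U L_eq z]
        surj_frechet_transition[OF A c p]) (use p in auto)
qed

lemma smooth_fun_tm_connection:
  fixes A :: "('m, real^'n) chart set"
  assumes A: "smooth_atlas M A" and L: "regular_lagrangian (tangent_atlas A) (slit_total M (tangent_space A)) L"
    and c: "c \<in> A"
  shows "smooth_fun (tangent_atlas A) (slit_total M (tangent_space A) \<inter> fst (tangent_chart A c))
    (\<lambda>w. tm_connection A L c w $ i $ j)"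
proof (rule smooth_fun_in_chart[OF smooth_atlas_tangent[OF A]])
  let ?C = "tangent_chart A c" and ?W = "slit_total M (tangent_space A)"
  let ?E = "{(p, X). p \<in> M \<and> X \<in> tangent_space A p}"
  let ?U = "snd ?C ` (fst ?C \<inter> ?W)"
  show C: "?C \<in> tangent_atlas A" using c by (simp add: tangent_atlas_def)
  show "openin (atlas_topology ?E (tangent_atlas A)) (?W \<inter> fst ?C)"
    by (intro openin_Int openin_slit_total[OF A vector_bundle_tangent[OF A] openin_base[OF A]]
        tangent_atlas_subset smooth_atlas_tangent[OF A] openin_chart_domain C)
  show U: "open ?U"
    using open_slit_coordinates[OF A c openin_chart_domain[OF A c], where 'f = "real^'n"]
    unfolding tangent_chart_image_slit[OF A c] by simp
  show "smooth_on ?U (\<lambda>z. tm_N_matrix (local_rep ?C L) z $ i $ j)"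
    by (rule smooth_on_tm_N_matrix[OF U regular_lagrangianD[OF L C]])
qed (auto simp: tm_connection_def)

proposition tangent_almost_complex_structure:
  fixes A :: "('m, real^'n) chart set"
  assumes A: "smooth_atlas M A" and L: "regular_lagrangian (tangent_atlas A) (slit_total M (tangent_space A)) L"
  shows "\<exists>F. almost_complex_structure (tangent_atlas A) (slit_total M (tangent_space A))
      (tangent_space (tangent_atlas A)) (tangent_triv ` tangent_atlas A) F \<and>
    (\<forall>c\<in>A. \<forall>w \<in> slit_total M (tangent_space A). fst w \<in> fst c \<longrightarrow>
      (\<forall>i. F w (tm_e A L c i w) = - tm_v A c i w \<and> F w (tm_v A c i w) = tm_e A L c i w) \<and>
      (\<forall>X \<in> tangent_space (tangent_atlas A) w.
        F w X = - (\<Sum>i\<in>UNIV. tm_e_dual A c i w X *\<^sub>R tm_v A c i w)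
                + (\<Sum>i\<in>UNIV. tm_v_dual A L c i w X *\<^sub>R tm_e A L c i w)))"
proof -
  let ?TA = "tangent_atlas A" and ?W = "slit_total M (tangent_space A)"
  let ?E = "{(p, X). p \<in> M \<and> X \<in> tangent_space A p}"
  let ?V = "tangent_space ?TA" and ?T = "\<lambda>c. tangent_triv (tangent_chart A c)"
  note TM = smooth_atlas_tangent[OF A]
  have C: "tangent_chart A c \<in> ?TA" if "c \<in> A" for c
    using that by (simp add: tangent_atlas_def)
  have fst_T: "fst (?T c) = fst (tangent_chart A c)" for c
    by (simp add: tangent_triv_def)
  have snd_T: "snd (?T c) w X = X (tangent_chart A c)" for c w X
    by (simp add: tangent_triv_def)
  have in_C: "w \<in> fst (tangent_chart A c)" if "w \<in> ?W" "fst w \<in> fst c" for w c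
    using that by (cases w) (simp add: fst_tangent_chart slit_total_iff)
  obtain F where F: "almost_complex_structure ?TA ?W ?V (tangent_triv ` ?TA) F"
    and F_in: "\<And>w X. w \<in> ?W \<Longrightarrow> X \<in> ?V w \<Longrightarrow> F w X \<in> ?V w"
    and F_T: "\<And>c w X. c \<in> A \<Longrightarrow> w \<in> ?W \<Longrightarrow> w \<in> fst (?T c) \<Longrightarrow> X \<in> ?V w \<Longrightarrow>
      snd (?T c) w (F w X) = adapted_J (tm_connection A L c w) (snd (?T c) w X)"
  proof (rule almost_complex_structure_of_connection[OF TM,
        of ?W A ?T "tangent_triv ` ?TA" ?V "tm_connection A L"])
    show "openin (atlas_topology ?E ?TA) ?W"
      by (rule openin_slit_total[OF A vector_bundle_tangent[OF A] openin_base[OF A] tangent_atlas_subset TM])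
    show "?T c \<in> tangent_triv ` ?TA" if "c \<in> A" for c using C[OF that] by blast
    show "openin (atlas_topology ?E ?TA) (fst (?T c))" if "c \<in> A" for c
      unfolding fst_T by (rule openin_chart_domain[OF TM C[OF that]])
    show "triv_at ?V (?T c) w" if "c \<in> A" "w \<in> fst (?T c)" for c w
      using that(2) unfolding fst_T by (rule triv_at_tangent[OF TM C[OF that(1)]])
    show "\<exists>c\<in>A. w \<in> fst (?T c)" if w: "w \<in> ?W" for w
    proof -
      have "fst w \<in> M" using w by (cases w) (simp add: slit_total_iff)
      then obtain c where "c \<in> A" "fst w \<in> fst c" using A unfolding smooth_atlas_def by blast
      then show ?thesis using in_C[OF w] unfolding fst_T by blast
    qed
    show "smooth_fun ?TA (?W \<inter> fst (?T c)) (\<lambda>w. tm_connection A L c w $ i $ j)" if "c \<in> A" for c i j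
      unfolding fst_T by (rule smooth_fun_tm_connection[OF A L that])
    show "snd (?T d) w Y = adapted_J (tm_connection A L d w) (snd (?T d) w X)"
      if cd: "c \<in> A" "d \<in> A" and w: "w \<in> ?W" "w \<in> fst (?T c)" "w \<in> fst (?T d)" and XY: "X \<in> ?V w" "Y \<in> ?V w"
        and eq: "snd (?T c) w Y = adapted_J (tm_connection A L c w) (snd (?T c) w X)" for c d w X Y
    proof -
      have "fst w \<in> fst c" "fst w \<in> fst d"
        using w(2,3) unfolding fst_T by (cases w, simp add: fst_tangent_chart)+
      \<comment> \<open>Components of \<open>X\<close> and \<open>Y\<close> in the two charts are
        related by the Jacobian of the transition, so the gluing condition says that this Jacobian
        intertwines the two local structures.\<close>
      from tm_connection_compat[OF A L cd w(1) this] show ?thesis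
        using tangent_vec_transition[OF XY(1) C[OF cd(1)] C[OF cd(2)]]
          tangent_vec_transition[OF XY(2) C[OF cd(1)] C[OF cd(2)]] w(2,3) eq
        unfolding snd_T fst_T by metis
    qed
  qed blast
  have "(\<forall>i. F w (tm_e A L c i w) = - tm_v A c i w \<and> F w (tm_v A c i w) = tm_e A L c i w) \<and>
      (\<forall>X \<in> ?V w. F w X = - (\<Sum>i\<in>UNIV. tm_e_dual A c i w X *\<^sub>R tm_v A c i w)
        + (\<Sum>i\<in>UNIV. tm_v_dual A L c i w X *\<^sub>R tm_e A L c i w))"
    if c: "c \<in> A" and w: "w \<in> ?W" "fst w \<in> fst c" for c w
  proof -
    let ?N = "tm_connection A L c w"
    note wC = in_C[OF w]
    have wT: "w \<in> fst (?T c)" using wC by (simp add: fst_T)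
    note t = triv_at_tangent[OF TM C[OF c] wC]
    note V = triv_at_subspace[OF t]
    have dx: "tm_dx A c i w \<in> ?V w" "snd (?T c) w (tm_dx A c i w) = (axis i 1, 0)"
      and dy: "tm_dy A c i w \<in> ?V w" "snd (?T c) w (tm_dy A c i w) = (0, axis i 1)" for i
      unfolding tm_dx_def tm_dy_def snd_T
      by (simp_all add: coord_vec_in_tangent_space[OF TM C[OF c] wC] coord_vec_same_chart[OF TM C[OF c] wC])
    let ?s = "\<lambda>i. \<Sum>j\<in>UNIV. tm_N_at A L c j i w *\<^sub>R tm_dy A c j w"
    have s: "?s i \<in> ?V w" for i
      by (intro subspace_sum[OF V] subspace_scale[OF V] dy(1))
    have s_T: "snd (?T c) w (?s i) = (0, ?N *v axis i 1)" for i
      unfolding triv_sum[OF t dy(1)] dy(2)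
      by (simp add: prod_eq_iff fst_sum snd_sum tm_connection_nth flip: matrix_column_sum)
    have v: "tm_v A c i w \<in> ?V w" "snd (?T c) w (tm_v A c i w) = (0, axis i 1)" for i
      unfolding tm_v_def by (rule dy)+
    have e: "tm_e A L c i w \<in> ?V w" "snd (?T c) w (tm_e A L c i w) = (axis i 1, - (?N *v axis i 1))" for i
    proof -
      have eq: "tm_e A L c i w = tm_dx A c i w + - ?s i" by (simp add: tm_e_def)
      show "tm_e A L c i w \<in> ?V w" unfolding eq by (intro subspace_add[OF V] subspace_neg[OF V] dx s)
      show "snd (?T c) w (tm_e A L c i w) = (axis i 1, - (?N *v axis i 1))"
        unfolding eq triv_add[OF t dx(1) subspace_neg[OF V s]] triv_minus[OF t s] dx(2) s_T by simp
    qed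
    note F' = F_in[OF w(1)] F_T[OF c w(1) wT]
    have "F w (tm_e A L c i w) = - tm_v A c i w" for i
      by (rule adapted_frame(1)[OF t v e F'])
    moreover have "F w (tm_v A c i w) = tm_e A L c i w" for i
      by (rule adapted_frame(2)[OF t v e F'])
    moreover have "F w X = - (\<Sum>i\<in>UNIV. tm_e_dual A c i w X *\<^sub>R tm_v A c i w)
        + (\<Sum>i\<in>UNIV. tm_v_dual A L c i w X *\<^sub>R tm_e A L c i w)" if "X \<in> ?V w" for X
      using adapted_frame(3)[OF t v e F' that]
      by (simp add: tm_e_dual_def tm_v_dual_def snd_T matrix_vector_mult_def tm_connection_nth)
    ultimately show ?thesis by blast
  qed
  then show ?thesis using F by blast
qed

section \<open>The prolongation of a Lie algebroid\<close>

lemma scaleR_fun_apply: "(r *\<^sub>R f) x = r *\<^sub>R f x"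
  by (simp add: scaleR_fun_def)

lemma bundle_chart_in_atlas: "c \<in> A \<Longrightarrow> t \<in> B \<Longrightarrow> bundle_chart V c t \<in> bundle_atlas A V B"
  unfolding bundle_atlas_def by blast

lemma bundle_transition_has_derivative:
  assumes A: "smooth_atlas M A" and V: "vector_bundle M A V B"
    and c: "c \<in> A" "t \<in> B" "d \<in> A" "s \<in> B"
    and e: "e \<in> fst (bundle_chart V c t)" "e \<in> fst (bundle_chart V d s)"
  shows "(transition (bundle_chart V c t) (bundle_chart V d s) has_derivative
    frechet_derivative (transition (bundle_chart V c t) (bundle_chart V d s)) (at (snd (bundle_chart V c t) e)))
    (at (snd (bundle_chart V c t) e))"
  by (rule transition_has_derivative[OF smooth_atlas_bundle[OF A V] _ _ e])
    (intro bundle_chart_in_atlas c)+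

text \<open>The base part of a bundle transition depends on the base point alone. This makes the
  condition that relates anchor and projection in the prolongation independent of the chart.\<close>

lemma frechet_bundle_transition_fst:
  assumes A: "smooth_atlas M A" and V: "vector_bundle M A V B"
    and c: "c \<in> A" "t \<in> B" "d \<in> A" "s \<in> B"
    and e: "(p, v) \<in> fst (bundle_chart V c t)" "(p, v) \<in> fst (bundle_chart V d s)"
  shows "fst (frechet_derivative (transition (bundle_chart V c t) (bundle_chart V d s))
      (at (snd (bundle_chart V c t) (p, v))) h) =
    frechet_derivative (transition c d) (at (snd c p)) (fst h)"
proof -
  let ?D = "frechet_derivative (transition (bundle_chart V c t) (bundle_chart V d s)) (at (snd (bundle_chart V c t) (p, v)))"
  let ?S = "snd c ` (fst c \<inter> (fst t \<inter> (fst d \<inter> fst s)))"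
  have p: "p \<in> fst c" "p \<in> fst t" "p \<in> fst d" "p \<in> fst s"
    using e by (auto simp: fst_bundle_chart)
  have U: "open (?S \<times> UNIV)"
    by (intro open_Times open_chart_image[OF A c(1)] openin_Int vector_bundleD(3)[OF V]
        openin_chart_domain[OF A] c) auto
  have "((\<lambda>z. transition c d (fst z)) has_derivative (\<lambda>h. frechet_derivative (transition c d) (at (snd c p)) (fst h)))
      (at (snd (bundle_chart V c t) (p, v)))"
    using transition_has_derivative[OF A c(1,3) p(1,3)]
    by (intro has_derivative_compose[OF has_derivative_fst[OF has_derivative_ident]]) (simp add: snd_bundle_chart)
  then have "((\<lambda>z. fst (transition (bundle_chart V c t) (bundle_chart V d s) z)) has_derivative
      (\<lambda>h. frechet_derivative (transition c d) (at (snd c p)) (fst h))) (at (snd (bundle_chart V c t) (p, v)))"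
  proof (rule has_derivative_transform_within_open[OF _ U])
    show "snd (bundle_chart V c t) (p, v) \<in> ?S \<times> UNIV" using p by (simp add: snd_bundle_chart)
    fix z :: "'b \<times> 'd" assume "z \<in> ?S \<times> UNIV"
    then obtain q \<xi> where z: "z = (snd c q, \<xi>)" and q: "q \<in> fst c" "q \<in> fst t" "q \<in> fst d" "q \<in> fst s"
      by (cases z) auto
    show "transition c d (fst z) = fst (transition (bundle_chart V c t) (bundle_chart V d s) z)"
      unfolding z bundle_transition[OF A V c q] by simp
  qed
  from has_derivative_unique[OF has_derivative_fst[OF bundle_transition_has_derivative[OF A V c e]] this]
  show ?thesis by (rule fun_cong)
qed

text \<open>With the same trivialization on both sides the fibre coordinate is untouched, so the
  vertical component of a vector is the same in both charts.\<close>

lemma frechet_bundle_transition_same_triv: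
  assumes A: "smooth_atlas M A" and V: "vector_bundle M A V B"
    and c: "c \<in> A" "t \<in> B" "d \<in> A"
    and e: "(p, v) \<in> fst (bundle_chart V c t)" "(p, v) \<in> fst (bundle_chart V d t)"
  shows "snd (frechet_derivative (transition (bundle_chart V c t) (bundle_chart V d t))
      (at (snd (bundle_chart V c t) (p, v))) h) = snd h"
proof -
  let ?S = "snd c ` (fst c \<inter> (fst t \<inter> fst d))"
  have p: "p \<in> fst c" "p \<in> fst t" "p \<in> fst d"
    using e by (auto simp: fst_bundle_chart)
  have U: "open (?S \<times> UNIV)"
    by (intro open_Times open_chart_image[OF A c(1)] openin_Int vector_bundleD(3)[OF V]
        openin_chart_domain[OF A] c) auto
  have "((\<lambda>z. snd (transition (bundle_chart V c t) (bundle_chart V d t) z)) has_derivative snd)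
      (at (snd (bundle_chart V c t) (p, v)))"
  proof (rule has_derivative_transform_within_open[OF has_derivative_snd[OF has_derivative_ident] U])
    show "snd (bundle_chart V c t) (p, v) \<in> ?S \<times> UNIV" using p by (simp add: snd_bundle_chart)
    fix z :: "'b \<times> 'd" assume "z \<in> ?S \<times> UNIV"
    then obtain q \<xi> where z: "z = (snd c q, \<xi>)" and q: "q \<in> fst c" "q \<in> fst t" "q \<in> fst d"
      by (cases z) auto
    show "snd z = snd (transition (bundle_chart V c t) (bundle_chart V d t) z)"
      unfolding z bundle_transition[OF A V c(1,2,3,2) q(1,2,3,2)]
      by (simp add: triv_triv_vec[OF vector_bundle_triv_at[OF V c(2) q(2)]])
  qed
  from has_derivative_unique[OF has_derivative_snd[OF bundle_transition_has_derivative[OF A V c(1,2,3,2) e]] this]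
  show ?thesis by (rule fun_cong)
qed

text \<open>\<open>tangent_map\<close> computes in an arbitrarily chosen chart of the total space.
  Passing from it to the bundle chart of \<open>d\<close> and \<open>s\<close> shows that the value
  is the base part of \<open>z\<close> there, whatever the choice.\<close>

lemma tangent_map_fst:
  assumes A: "smooth_atlas M A" and V: "vector_bundle M A V B" and d: "d \<in> A" "s \<in> B"
    and e: "(p, v) \<in> fst (bundle_chart V d s)" and z: "z \<in> tangent_space (bundle_atlas A V B) (p, v)"
  shows "tangent_map (bundle_atlas A V B) A fst (p, v) z d = fst (z (bundle_chart V d s))"
proof -
  let ?D = "bundle_chart V d s"
  define C where "C = (SOME C. C \<in> bundle_atlas A V B \<and> (p, v) \<in> fst C)"
  have D: "?D \<in> bundle_atlas A V B" by (rule bundle_chart_in_atlas[OF d])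
  then have C: "C \<in> bundle_atlas A V B" "(p, v) \<in> fst C"
    using someI[of "\<lambda>C. C \<in> bundle_atlas A V B \<and> (p, v) \<in> fst C" ?D] e unfolding C_def by blast+
  have "local_rep C (snd d \<circ> fst) = (\<lambda>x. fst (transition C ?D x))"
    by (simp add: fun_eq_iff transition_def local_rep_def bundle_chart_def case_prod_beta)
  then have "frechet_derivative (local_rep C (snd d \<circ> fst)) (at (snd C (p, v))) (z C) =
      fst (frechet_derivative (transition C ?D) (at (snd C (p, v))) (z C))"
    using frechet_derivativeI[OF has_derivative_fst[OF transition_has_derivative[OF smooth_atlas_bundle[OF A V] C(1) D C(2) e]]]
    by simp
  then show ?thesis
    unfolding tangent_vec_transition[OF z C(1) D C(2) e]
    using d e by (simp add: tangent_map_def C_def[symmetric] fst_bundle_chart)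
qed

text \<open>The equation between two tangent vectors of the base is an equality of families of
  components; both sides transform by the Jacobian, so the component in one chart decides
  it.\<close>

lemma prolongation_iff:
  fixes \<rho> :: "'q \<Rightarrow> 'v::real_vector \<Rightarrow> ('q, real^'d) tvec" and B :: "('q, 'v, real^'r) triv set"
  assumes A: "smooth_atlas M A" and V: "vector_bundle M A V B" and c: "c \<in> A" "t \<in> B"
    and e: "(p, v) \<in> fst (bundle_chart V c t)" and \<rho>: "linear_between (V p) (tangent_space A p) (\<rho> p)"
  shows "(b, z) \<in> prolongation A V B \<rho> (p, v) \<longleftrightarrow>
    b \<in> V p \<and> z \<in> tangent_space (bundle_atlas A V B) (p, v) \<and> \<rho> p b c = fst (z (bundle_chart V c t))"
proof -
  have "\<rho> p b = tangent_map (bundle_atlas A V B) A fst (p, v) z \<longleftrightarrow> \<rho> p b c = fst (z (bundle_chart V c t))"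
    if b: "b \<in> V p" and z: "z \<in> tangent_space (bundle_atlas A V B) (p, v)"
  proof
    assume "\<rho> p b = tangent_map (bundle_atlas A V B) A fst (p, v) z"
    then show "\<rho> p b c = fst (z (bundle_chart V c t))"
      using tangent_map_fst[OF A V c e z] by simp
  next
    assume eq: "\<rho> p b c = fst (z (bundle_chart V c t))"
    have T: "\<rho> p b \<in> tangent_space A p" using \<rho> b by (simp add: linear_between_def)
    show "\<rho> p b = tangent_map (bundle_atlas A V B) A fst (p, v) z"
    proof
      fix d
      show "\<rho> p b d = tangent_map (bundle_atlas A V B) A fst (p, v) z d"
      proof (cases "d \<in> A \<and> p \<in> fst d")
        case True
        \<comment> \<open>Only the base chart is replaced by \<open>d\<close>. Keeping
          \<open>t\<close> ensures that \<open>(p, v)\<close> lies in the domain of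
          \<open>?D\<close>.\<close>
        let ?C = "bundle_chart V c t" and ?D = "bundle_chart V d t"
        have d: "d \<in> A" "p \<in> fst d" and p: "p \<in> fst c" using True e by (auto simp: fst_bundle_chart)
        have e': "(p, v) \<in> fst ?D" using e d by (simp add: fst_bundle_chart)
        have CD: "?C \<in> bundle_atlas A V B" "?D \<in> bundle_atlas A V B"
          using c d by (simp_all add: bundle_chart_in_atlas)
        have "\<rho> p b d = frechet_derivative (transition c d) (at (snd c p)) (fst (z ?C))"
          using tangent_vec_transition[OF T c(1) d(1) p d(2)] eq by simp
        also have "\<dots> = fst (frechet_derivative (transition ?C ?D) (at (snd ?C (p, v))) (z ?C))"
          by (rule frechet_bundle_transition_fst[OF A V c d(1) c(2) e e', symmetric])
        also have "\<dots> = fst (z ?D)"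
          unfolding tangent_vec_transition[OF z CD e e'] ..
        also have "\<dots> = tangent_map (bundle_atlas A V B) A fst (p, v) z d"
          by (rule tangent_map_fst[OF A V d(1) c(2) e' z, symmetric])
        finally show ?thesis .
      next
        case False
        then show ?thesis
          using tangent_vec_outside[OF T False] by (auto simp: tangent_map_def)
      qed
    qed
  qed
  then show ?thesis by (auto simp: prolongation_def)
qed

lemma snd_prol_triv: "snd (prol_triv V c t) e X = (snd t (fst e) (fst X), snd (snd X (bundle_chart V c t)))"
  by (simp add: prol_triv_def prol_z_dual_def prol_v_dual_def)

text \<open>The base part of \<open>z\<close> is determined by \<open>b\<close> through the anchor.
  What remains free are the components of \<open>b\<close> and the vertical part of
  \<open>z\<close>, and these are the two entries of \<open>prol_triv\<close>.\<close>

lemma triv_at_prolongation: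
  fixes \<rho> :: "'q \<Rightarrow> 'v::real_vector \<Rightarrow> ('q, real^'d) tvec" and B :: "('q, 'v, real^'r) triv set"
  assumes A: "smooth_atlas M A" and V: "vector_bundle M A V B" and c: "c \<in> A" "t \<in> B"
    and e: "(p, v) \<in> fst (bundle_chart V c t)" and \<rho>: "linear_between (V p) (tangent_space A p) (\<rho> p)"
  shows "triv_at (prolongation A V B \<rho>) (prol_triv V c t) (p, v)"
proof -
  let ?C = "bundle_chart V c t" and ?E = "bundle_atlas A V B" and ?P = "prolongation A V B \<rho> (p, v)"
  note TE = smooth_atlas_bundle[OF A V]
  have C: "?C \<in> ?E" by (rule bundle_chart_in_atlas[OF c])
  have p: "p \<in> fst t" using e by (simp add: fst_bundle_chart)
  note P = prolongation_iff[where \<rho> = \<rho> and p = p, OF A V c e \<rho>]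
  note t = vector_bundle_triv_at[OF V c(2) p]
  note Vp = triv_at_subspace[OF t] and Te = subspace_tangent_space[OF TE, of "(p, v)"]
  have \<rho>_add: "\<rho> p (x + y) = \<rho> p x + \<rho> p y" if "x \<in> V p" "y \<in> V p" for x y
    using \<rho> that by (simp add: linear_between_def)
  have \<rho>_scaleR: "\<rho> p (r *\<^sub>R x) = r *\<^sub>R \<rho> p x" if "x \<in> V p" for x r
    using \<rho> that by (simp add: linear_between_def)
  have sub: "subspace ?P"
  proof (rule subspaceI)
    have "\<rho> p 0 = 0" using \<rho>_scaleR[of 0 0] subspace_0[OF Vp] by simp
    then show "0 \<in> ?P"
      unfolding zero_prod_def P by (simp add: subspace_0[OF Vp] subspace_0[OF Te])
    show "X + Y \<in> ?P" if "X \<in> ?P" "Y \<in> ?P" for X Y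
      using that
      by (cases X; cases Y)
        (simp add: P subspace_add[OF Vp] subspace_add[OF Te] \<rho>_add)
    show "r *\<^sub>R X \<in> ?P" if "X \<in> ?P" for r X
      using that
      by (cases X) (simp add: P subspace_scale[OF Vp] subspace_scale[OF Te] \<rho>_scaleR scaleR_fun_apply)
  qed
  have lin: "linear_between ?P UNIV (snd (prol_triv V c t) (p, v))"
    unfolding linear_between_def snd_prol_triv
    by (auto simp: P triv_add[OF t] triv_scaleR[OF t] scaleR_fun_apply)
  have "bij_betw (snd (prol_triv V c t) (p, v)) ?P UNIV"
  proof (rule bij_betw_imageI)
    show "inj_on (snd (prol_triv V c t) (p, v)) ?P"
    proof (rule inj_onI)
      fix X Y assume X: "X \<in> ?P" and Y: "Y \<in> ?P"
        and eq: "snd (prol_triv V c t) (p, v) X = snd (prol_triv V c t) (p, v) Y"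
      obtain b z b' z' where XY: "X = (b, z)" "Y = (b', z')" by (cases X, cases Y)
      have b: "b \<in> V p" "b' \<in> V p" and z: "z \<in> tangent_space ?E (p, v)" "z' \<in> tangent_space ?E (p, v)"
        and fst: "\<rho> p b c = fst (z ?C)" "\<rho> p b' c = fst (z' ?C)"
        using X Y by (simp_all add: XY P)
      have "b = b'" using triv_eqI[OF t b] eq by (simp add: XY snd_prol_triv)
      moreover from this have "z ?C = z' ?C" using eq fst by (simp add: XY snd_prol_triv prod_eq_iff)
      then have "z = z'" by (rule tangent_vec_eqI[OF z C e])
      ultimately show "X = Y" by (simp add: XY)
    qed
    have "(\<xi>, \<eta>) \<in> snd (prol_triv V c t) (p, v) ` ?P" for \<xi> \<eta>
    proof (rule image_eqI)
      let ?b = "triv_vec V t \<xi> p"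
      \<comment> \<open>The base components of the second entry are forced to be those of the anchor
        of \<open>?b\<close>; the vertical ones are prescribed.\<close>
      let ?X = "(?b, coord_vec ?E ?C (p, v) (\<rho> p ?b c, \<eta>))"
      show "?X \<in> ?P"
        unfolding P by (simp add: triv_vec_in[OF t] coord_vec_in_tangent_space[OF TE C e] coord_vec_same_chart[OF TE C e])
      show "(\<xi>, \<eta>) = snd (prol_triv V c t) (p, v) ?X"
        by (simp add: snd_prol_triv triv_triv_vec[OF t] coord_vec_same_chart[OF TE C e])
    qed
    then show "snd (prol_triv V c t) (p, v) ` ?P = UNIV" by auto
  qed
  then show ?thesis using sub lin by (simp add: triv_at_def)
qed


section \<open>The canonical N-connection of a Lie algebroid\<close>

lemma lie_algebroidD:
  assumes "lie_algebroid M A V B \<rho> br"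
  shows "smooth_atlas M A" "vector_bundle M A V B"
    and "\<And>p. p \<in> M \<Longrightarrow> linear_between (V p) (tangent_space A p) (\<rho> p)"
    and "\<And>c t \<xi>. c \<in> A \<Longrightarrow> t \<in> B \<Longrightarrow> smooth_fun A (fst c \<inter> fst t) (\<lambda>p. \<rho> p (triv_vec V t \<xi> p) c)"
    and "\<And>U s1 s2. openin (atlas_topology M A) U \<Longrightarrow> smooth_section A V B U s1 \<Longrightarrow>
      smooth_section A V B U s2 \<Longrightarrow> smooth_section A V B U (br U s1 s2)"
proof -
  note D = assms[unfolded lie_algebroid_def smooth_manifold_def]
  note D2 = D[THEN conjunct2, THEN conjunct2]
  show "smooth_atlas M A" by (rule D[THEN conjunct1, THEN conjunct1])
  show "vector_bundle M A V B" by (rule D[THEN conjunct2, THEN conjunct1])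
  show "linear_between (V p) (tangent_space A p) (\<rho> p)" if "p \<in> M" for p
    using D2[THEN conjunct1] that by blast
  show "smooth_fun A (fst c \<inter> fst t) (\<lambda>p. \<rho> p (triv_vec V t \<xi> p) c)" if "c \<in> A" "t \<in> B" for c t \<xi>
    using D2[THEN conjunct2, THEN conjunct1] that by blast
  show "smooth_section A V B U (br U s1 s2)"
    if "openin (atlas_topology M A) U" "smooth_section A V B U s1" "smooth_section A V B U s2" for U s1 s2
    \<comment> \<open>Closure under brackets is stated together with the Jacobi identity for three
      sections; \<open>s2\<close> also fills the third place.\<close>
    using D2[THEN conjunct2, THEN conjunct2, THEN conjunct2, THEN spec, of U, THEN spec, of s1,
        THEN spec, of s2, THEN spec, of s2] that by blast
qed

definition la_connection :: "('p \<Rightarrow> 'v set) \<Rightarrow> ('p \<Rightarrow> 'v \<Rightarrow> ('p, real^'n) tvec) \<Rightarrow>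
    ('p set \<Rightarrow> ('p \<Rightarrow> 'v) \<Rightarrow> ('p \<Rightarrow> 'v) \<Rightarrow> ('p \<Rightarrow> 'v)) \<Rightarrow> ('p \<times> 'v \<Rightarrow> real) \<Rightarrow>
    ('p, real^'n) chart \<Rightarrow> ('p, 'v, real^'r) triv \<Rightarrow> 'p \<times> 'v \<Rightarrow> real^'r^'r" where
  "la_connection V \<rho> br l c t e = (\<chi> a b. la_N_at V \<rho> br l c t a b e)"

lemma smooth_on_structure_functions:
  fixes B :: "('q, 'v::real_vector, real^'r) triv set"
  assumes alg: "lie_algebroid M A V B \<rho> br" and c: "c \<in> A" "t \<in> B"
  shows "smooth_on (snd c ` (fst c \<inter> fst t)) (local_rep c (anchor_coeff V \<rho> c t i a))"
    and "smooth_on (snd c ` (fst c \<inter> fst t)) (local_rep c (bracket_coeff V br t e a b))"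
proof -
  note A = lie_algebroidD(1)[OF alg] and V = lie_algebroidD(2)[OF alg]
  let ?S = "snd c ` (fst c \<inter> fst t)"
  have S: "open ?S" by (intro open_chart_image[OF A c(1)] vector_bundleD(3)[OF V c(2)])
  have "smooth_on ?S (local_rep c (\<lambda>p. \<rho> p (triv_vec V t (axis a 1) p) c))"
    using lie_algebroidD(4)[OF alg c, of "axis a 1"] c(1) unfolding smooth_fun_def
    by (metis (no_types, lifting) Int_assoc Int_absorb)
  from smooth_on_nth[OF S this] show "smooth_on ?S (local_rep c (anchor_coeff V \<rho> c t i a))"
    by (simp add: local_rep_def anchor_coeff_def basis_section_def comp_def)
  \<comment> \<open>In another trivialization the components of a basis section form a column of the
    change of trivialization, smooth by the bundle axiom. The bracket of two basis sections is then
    a smooth section, and its components are the structure functions.\<close>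
  have sec: "smooth_section A V B (fst t) (basis_section V t a)" for a
    unfolding smooth_section_def basis_section_def
    using triv_vec_in[OF vector_bundle_triv_at[OF V c(2)]] vector_bundleD(6)[OF V c(2)] by blast
  have "smooth_fun A (fst t \<inter> fst t) (\<lambda>p. snd t p (br (fst t) (basis_section V t a) (basis_section V t b) p))"
    using lie_algebroidD(5)[OF alg vector_bundleD(3)[OF V c(2)] sec sec, of a b] c(2)
    unfolding smooth_section_def by blast
  then have "smooth_on ?S (local_rep c (\<lambda>p. snd t p (br (fst t) (basis_section V t a) (basis_section V t b) p)))"
    using c(1) unfolding smooth_fun_def Int_absorb by blast
  from smooth_on_nth[OF S this] show "smooth_on ?S (local_rep c (bracket_coeff V br t e a b))"
    by (simp add: local_rep_def bracket_coeff_def[abs_def] comp_def)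
qed

lemma bundle_slit_image:
  assumes "vector_bundle M A V B" "t \<in> B"
  shows "snd (bundle_chart V c t) ` (fst (bundle_chart V c t) \<inter> slit_total M V) =
    snd c ` (fst c \<inter> fst t) \<times> (UNIV - {0})"
proof -
  have "fst t \<inter> M = fst t" using vector_bundleD(2)[OF assms(1)] assms(2) by blast
  then show ?thesis using bundle_chart_image_slit[OF assms, of c M] by simp
qed

lemma smooth_on_la_spray_chart:
  fixes A :: "('q, real^'d) chart set" and B :: "('q, 'v::real_vector, real^'r) triv set"
  assumes alg: "lie_algebroid M A V B \<rho> br"
    and l: "regular_lagrangian (bundle_atlas A V B) (slit_total M V) l" and c: "c \<in> A" "t \<in> B"
  shows "smooth_on (snd c ` (fst c \<inter> fst t) \<times> (UNIV - {0}))
    (la_spray (\<lambda>x i a. local_rep c (anchor_coeff V \<rho> c t i a) x)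
      (\<lambda>x e a b. local_rep c (bracket_coeff V br t e a b) x) (local_rep (bundle_chart V c t) l) a)"
proof -
  note A = lie_algebroidD(1)[OF alg] and V = lie_algebroidD(2)[OF alg]
  have C: "bundle_chart V c t \<in> bundle_atlas A V B" by (rule bundle_chart_in_atlas[OF c])
  note reg = regular_lagrangianD[OF l C, unfolded bundle_slit_image[OF V c(2)]]
  show ?thesis
    by (rule smooth_on_la_spray[OF open_chart_image[OF A c(1) vector_bundleD(3)[OF V c(2)]]
          smooth_on_structure_functions[OF alg c]
          open_slit_coordinates[OF A c(1) vector_bundleD(3)[OF V c(2)]] _ reg]) auto
qed

lemma smooth_fun_la_connection:
  fixes A :: "('q, real^'d) chart set" and B :: "('q, 'v::real_vector, real^'r) triv set"
  assumes alg: "lie_algebroid M A V B \<rho> br"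
    and l: "regular_lagrangian (bundle_atlas A V B) (slit_total M V) l" and c: "c \<in> A" "t \<in> B"
  shows "smooth_fun (bundle_atlas A V B) (slit_total (fst t) V \<inter> fst (bundle_chart V c t))
    (\<lambda>e. la_connection V \<rho> br l c t e $ a $ b)"
proof -
  note A = lie_algebroidD(1)[OF alg] and V = lie_algebroidD(2)[OF alg]
  let ?C = "bundle_chart V c t" and ?W = "slit_total (fst t) V"
  let ?U = "snd c ` (fst c \<inter> fst t) \<times> (UNIV - {0 :: real^'r})"
  let ?E = "{(p, v). p \<in> M \<and> v \<in> V p}"
  note TE = smooth_atlas_bundle[OF A V]
  have C: "?C \<in> bundle_atlas A V B" by (rule bundle_chart_in_atlas[OF c])
  have img: "snd ?C ` (fst ?C \<inter> ?W) = ?U"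
    using bundle_chart_image_slit[OF V c(2), of c "fst t"] by simp
  show ?thesis
  proof (rule smooth_fun_in_chart[OF TE C])
    show "openin (atlas_topology ?E (bundle_atlas A V B)) (?W \<inter> fst ?C)"
      by (intro openin_Int openin_slit_total[OF A V vector_bundleD(3)[OF V c(2)] order_refl TE]
          openin_chart_domain[OF TE C])
    show "open ?U" by (rule open_slit_coordinates[OF A c(1) vector_bundleD(3)[OF V c(2)]])
    show "smooth_on ?U (la_N (\<lambda>x i a. local_rep c (anchor_coeff V \<rho> c t i a) x)
        (\<lambda>x e a b. local_rep c (bracket_coeff V br t e a b) x) (local_rep ?C l) a b)"
      unfolding la_N_def by (rule smooth_on_fibre_pd[OF smooth_on_la_spray_chart[OF alg l c]])
    show "snd ?C e \<in> ?U" if "e \<in> ?W \<inter> fst ?C" for e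
      using that img by blast
  qed (auto simp: la_connection_def la_N_at_def)
qed

text \<open>Equality, not conjugation, because the basis \<open>v_a\<close> stays the same. The
  anchor coefficients are components of a tangent vector and change by the Jacobian; the bracket
  coefficients are functions on the base, read in another chart.\<close>

lemma la_connection_compat:
  fixes A :: "('q, real^'d) chart set" and B :: "('q, 'v::real_vector, real^'r) triv set"
  assumes alg: "lie_algebroid M A V B \<rho> br"
    and l: "regular_lagrangian (bundle_atlas A V B) (slit_total M V) l" and c: "c \<in> A" "d \<in> A" "t \<in> B"
    and e: "e \<in> slit_total (fst t) V" "fst e \<in> fst c" "fst e \<in> fst d"
  shows "la_connection V \<rho> br l d t e = la_connection V \<rho> br l c t e"
proof -
  note A = lie_algebroidD(1)[OF alg] and V = lie_algebroidD(2)[OF alg]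
  let ?C = "bundle_chart V c t" and ?D = "bundle_chart V d t" and ?\<phi> = "transition c d"
  let ?S = "snd c ` (fst c \<inter> (fst t \<inter> fst d))"
  let ?U = "?S \<times> (UNIV - {0 :: real^'r})" and ?U' = "snd d ` (fst d \<inter> fst t) \<times> (UNIV - {0 :: real^'r})"
  have CD: "?C \<in> bundle_atlas A V B" "?D \<in> bundle_atlas A V B"
    using c by (simp_all add: bundle_chart_in_atlas)
  note TE = smooth_atlas_bundle[OF A V]
  have open_td: "openin (atlas_topology M A) (fst t \<inter> fst d)"
    by (intro openin_Int vector_bundleD(3)[OF V c(3)] openin_chart_domain[OF A c(2)])
  have S: "open ?S" by (rule open_chart_image[OF A c(1) open_td])
  have \<phi>: "smooth_on ?S ?\<phi>" by (rule smooth_on_subset[OF transition_smooth[OF A c(1,2)]]) auto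
  have U: "open ?U" by (rule open_slit_coordinates[OF A c(1) open_td])
  have U_sub: "?U \<subseteq> ?S \<times> UNIV" by blast
  have U': "open ?U'" by (rule open_slit_coordinates[OF A c(2) vector_bundleD(3)[OF V c(3)]])
  have reg: "smooth_on ?U (local_rep ?C l)"
    by (rule smooth_on_subset[OF regular_lagrangianD(1)[OF l CD(1), unfolded bundle_slit_image[OF V c(3)]]]) auto
  have reg': "smooth_on ?U' (local_rep ?D l)"
    by (rule regular_lagrangianD(1)[OF l CD(2), unfolded bundle_slit_image[OF V c(3)]])
  have rep: "local_rep c g (snd c q) = g q" if "q \<in> fst c" for g :: "'q \<Rightarrow> real" and q
    by (rule local_rep_apply[OF smooth_atlas_inj[OF A c(1)] that])
  have rep': "local_rep d g (snd d q) = g q" if "q \<in> fst d" for g :: "'q \<Rightarrow> real" and q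
    by (rule local_rep_apply[OF smooth_atlas_inj[OF A c(2)] that])
  have lift: "base_lift ?\<phi> (snd c q, \<xi>) = (snd d q, \<xi>)" if "q \<in> fst c" for q and \<xi> :: "real^'r"
    by (simp add: base_lift_def transition_apply[OF A c(1) that])
  have lift_U: "base_lift ?\<phi> ` ?U \<subseteq> ?U'"
    using lift by auto
  have l_eq: "local_rep ?C l z = local_rep ?D l (base_lift ?\<phi> z)" if zU: "z \<in> ?U" for z
  proof -
    obtain q \<xi> where z: "z = (snd c q, \<xi>)" and q: "q \<in> fst c" "q \<in> fst t" "q \<in> fst d"
      using zU by auto
    note tq = vector_bundle_triv_at[OF V c(3) q(2)]
    let ?v = "(q, triv_vec V t \<xi> q)"
    have v: "?v \<in> fst ?C" "?v \<in> fst ?D"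
      by (simp_all add: fst_bundle_chart q triv_vec_in[OF tq])
    have "z = snd ?C ?v" "base_lift ?\<phi> z = snd ?D ?v"
      using lift[OF q(1)] by (simp_all add: z snd_bundle_chart triv_triv_vec[OF tq])
    then show ?thesis
      using local_rep_apply[OF smooth_atlas_inj[OF TE CD(1)] v(1), of l]
        local_rep_apply[OF smooth_atlas_inj[OF TE CD(2)] v(2), of l] by simp
  qed
  have anchor: "local_rep d (anchor_coeff V \<rho> d t i a) (?\<phi> x) =
      frechet_derivative ?\<phi> (at x) (\<chi> k. local_rep c (anchor_coeff V \<rho> c t k a) x) $ i" if xS: "x \<in> ?S" for x i a
  proof -
    obtain q where x: "x = snd c q" and q: "q \<in> fst c" "q \<in> fst t" "q \<in> fst d" using xS by blast
    have "q \<in> M" using vector_bundleD(2)[OF V] c(3) q(2) by blast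
    then have "\<rho> q (basis_section V t a q) \<in> tangent_space A q"
      using lie_algebroidD(3)[OF alg] triv_vec_in[OF vector_bundle_triv_at[OF V c(3) q(2)]]
      unfolding linear_between_def basis_section_def by blast
    from tangent_vec_transition[OF this c(1,2) q(1,3)] show ?thesis
      unfolding x transition_apply[OF A c(1) q(1)] rep[OF q(1)] rep'[OF q(3)]
      by (simp add: anchor_coeff_def)
  qed
  have bracket: "(\<lambda>e a b. local_rep d (bracket_coeff V br t e a b) (?\<phi> x)) =
      (\<lambda>e a b. local_rep c (bracket_coeff V br t e a b) x)" if xS: "x \<in> ?S" for x
  proof -
    obtain q where x: "x = snd c q" and q: "q \<in> fst c" "q \<in> fst d" using xS by blast
    show ?thesis unfolding x transition_apply[OF A c(1) q(1)] rep[OF q(1)] rep'[OF q(2)] ..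
  qed
  obtain p v where e_eq: "e = (p, v)" by (cases e)
  have p: "p \<in> fst c" "p \<in> fst t" "p \<in> fst d" and v: "v \<in> V p" "v \<noteq> 0"
    using e by (auto simp: e_eq slit_total_iff)
  have "snd t p v \<noteq> 0"
    using triv_zero_iff[OF vector_bundle_triv_at[OF V c(3) p(2)] v(1)] v(2) by simp
  then have z: "(snd c p, snd t p v) \<in> ?U" using p by blast
  have "la_N_at V \<rho> br l d t a b e = la_N_at V \<rho> br l c t a b e" for a b
    using la_N_transform[OF S \<phi> U U_sub U' reg' reg lift_U l_eq z anchor bracket
        smooth_on_la_spray_chart[OF alg l c(2,3)], of a b]
    unfolding la_N_at_def e_eq snd_bundle_chart lift[OF p(1)] .
  then show ?thesis by (simp add: la_connection_def)
qed

proposition prolongation_almost_complex_structure: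
  fixes A :: "('q, real^'d) chart set" and B :: "('q, 'v::real_vector, real^'r) triv set"
  assumes alg: "lie_algebroid M A V B \<rho> br"
    and l: "regular_lagrangian (bundle_atlas A V B) (slit_total M V) l" and t: "t \<in> B"
  shows "\<exists>F. almost_complex_structure (bundle_atlas A V B) (slit_total (fst t) V)
      (prolongation A V B \<rho>) (prol_trivs A V B) F \<and>
    (\<forall>c\<in>A. \<forall>e \<in> slit_total (fst t) V. fst e \<in> fst c \<longrightarrow>
      (\<forall>a. F e (la_z A V B \<rho> br l c t a e) = - la_v A V B c t a e \<and>
        F e (la_v A V B c t a e) = la_z A V B \<rho> br l c t a e) \<and>
      (\<forall>X \<in> prolongation A V B \<rho> e.
        F e X = - (\<Sum>a\<in>UNIV. la_z_dual t a e X *\<^sub>R la_v A V B c t a e)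
                + (\<Sum>a\<in>UNIV. la_v_dual V \<rho> br l c t a e X *\<^sub>R la_z A V B \<rho> br l c t a e)))"
proof -
  note A = lie_algebroidD(1)[OF alg] and V = lie_algebroidD(2)[OF alg]
  let ?EA = "bundle_atlas A V B" and ?W = "slit_total (fst t) V" and ?P = "prolongation A V B \<rho>"
  let ?E = "{(p, v). p \<in> M \<and> v \<in> V p}" and ?T = "\<lambda>c. prol_triv V c t"
  note TE = smooth_atlas_bundle[OF A V]
  have tM: "fst t \<subseteq> M" using vector_bundleD(2)[OF V] t by blast
  have C: "bundle_chart V c t \<in> ?EA" if "c \<in> A" for c
    by (rule bundle_chart_in_atlas[OF that t])
  have fst_T: "fst (?T c) = fst (bundle_chart V c t)" for c :: "('q, real^'d) chart"
    by (simp add: prol_triv_def)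
  have in_C: "e \<in> fst (bundle_chart V c t)" if "e \<in> ?W" "fst e \<in> fst c" for e and c :: "('q, real^'d) chart"
    using that by (cases e) (simp add: fst_bundle_chart slit_total_iff)
  have triv: "triv_at ?P (?T c) e" if "c \<in> A" "e \<in> fst (bundle_chart V c t)" for c e
  proof (cases e)
    case (Pair p v)
    then have "p \<in> M" using that(2) tM by (auto simp: fst_bundle_chart)
    from triv_at_prolongation[OF A V that(1) t that(2)[unfolded Pair], where \<rho> = \<rho>] lie_algebroidD(3)[OF alg this]
    show ?thesis unfolding Pair by blast
  qed
  obtain F where F: "almost_complex_structure ?EA ?W ?P (prol_trivs A V B) F"
    and F_in: "\<And>e X. e \<in> ?W \<Longrightarrow> X \<in> ?P e \<Longrightarrow> F e X \<in> ?P e"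
    and F_T: "\<And>c e X. c \<in> A \<Longrightarrow> e \<in> ?W \<Longrightarrow> e \<in> fst (?T c) \<Longrightarrow> X \<in> ?P e \<Longrightarrow>
      snd (?T c) e (F e X) = adapted_J (la_connection V \<rho> br l c t e) (snd (?T c) e X)"
  \<comment> \<open>The index set consists of the base charts alone. Paired with the one
    trivialization \<open>t\<close>, they cover the part of the slit bundle over
    \<open>fst t\<close>.\<close>
  proof (rule almost_complex_structure_of_connection[OF TE,
        of ?W A ?T "prol_trivs A V B" ?P "\<lambda>c. la_connection V \<rho> br l c t"])
    show "openin (atlas_topology ?E ?EA) ?W"
      by (rule openin_slit_total[OF A V vector_bundleD(3)[OF V t] order_refl TE])
    show "?T c \<in> prol_trivs A V B" if "c \<in> A" for c
      using that t unfolding prol_trivs_def by blast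
    show "openin (atlas_topology ?E ?EA) (fst (?T c))" if "c \<in> A" for c
      unfolding fst_T by (rule openin_chart_domain[OF TE C[OF that]])
    show "triv_at ?P (?T c) e" if "c \<in> A" "e \<in> fst (?T c)" for c e
      using triv[OF that(1)] that(2) unfolding fst_T by blast
    show "\<exists>c\<in>A. e \<in> fst (?T c)" if e: "e \<in> ?W" for e
    proof -
      have "fst e \<in> M" using e tM by (cases e) (auto simp: slit_total_iff)
      then obtain c where "c \<in> A" "fst e \<in> fst c" using A unfolding smooth_atlas_def by blast
      then show ?thesis using in_C[OF e] unfolding fst_T by blast
    qed
    show "smooth_fun ?EA (?W \<inter> fst (?T c)) (\<lambda>e. la_connection V \<rho> br l c t e $ a $ b)" if "c \<in> A" for c a b
      unfolding fst_T by (rule smooth_fun_la_connection[OF alg l that t])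
    show "snd (?T d) e Y = adapted_J (la_connection V \<rho> br l d t e) (snd (?T d) e X)"
      if cd: "c \<in> A" "d \<in> A" and e: "e \<in> ?W" "e \<in> fst (?T c)" "e \<in> fst (?T d)" and XY: "X \<in> ?P e" "Y \<in> ?P e"
        and eq: "snd (?T c) e Y = adapted_J (la_connection V \<rho> br l c t e) (snd (?T c) e X)" for c d e X Y
    proof -
      obtain p v where e_eq: "e = (p, v)" by (cases e)
      have eC: "(p, v) \<in> fst (bundle_chart V c t)" "(p, v) \<in> fst (bundle_chart V d t)"
        using e(2,3) unfolding fst_T e_eq by simp_all
      then have p: "fst e \<in> fst c" "fst e \<in> fst d" by (auto simp: e_eq fst_bundle_chart)
      \<comment> \<open>The first entry comes from \<open>t\<close> and the second is the vertical
        part, which is unchanged for a fixed trivialization. Together with equal connection matrices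
        this makes the gluing condition immediate.\<close>
      have same: "snd (?T d) e Z = snd (?T c) e Z" if Z: "Z \<in> ?P e" for Z
      proof -
        have "snd Z \<in> tangent_space ?EA (p, v)" using Z by (auto simp: prolongation_def e_eq)
        from tangent_vec_transition[OF this C[OF cd(1)] C[OF cd(2)] eC] show ?thesis
          using frechet_bundle_transition_same_triv[OF A V cd(1) t cd(2) eC]
          unfolding snd_prol_triv by simp
      qed
      show ?thesis
        unfolding same[OF XY(1)] same[OF XY(2)] la_connection_compat[OF alg l cd t e(1) p] by (rule eq)
    qed
  qed blast
  have "(\<forall>a. F e (la_z A V B \<rho> br l c t a e) = - la_v A V B c t a e \<and>
        F e (la_v A V B c t a e) = la_z A V B \<rho> br l c t a e) \<and>
      (\<forall>X \<in> ?P e. F e X = - (\<Sum>a\<in>UNIV. la_z_dual t a e X *\<^sub>R la_v A V B c t a e)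
        + (\<Sum>a\<in>UNIV. la_v_dual V \<rho> br l c t a e X *\<^sub>R la_z A V B \<rho> br l c t a e))"
    if c: "c \<in> A" and e: "e \<in> ?W" "fst e \<in> fst c" for c e
  proof -
    let ?N = "la_connection V \<rho> br l c t e" and ?C = "bundle_chart V c t"
    obtain p v where e_eq: "e = (p, v)" by (cases e)
    note eC = in_C[OF e]
    have eT: "e \<in> fst (?T c)" using eC unfolding fst_T .
    note tr = triv[OF c eC]
    note P = triv_at_subspace[OF tr]
    have p: "p \<in> fst t" using e(1) by (simp add: e_eq slit_total_iff)
    note tp = vector_bundle_triv_at[OF V t p]
    have \<rho>: "linear_between (V p) (tangent_space A p) (\<rho> p)"
      using lie_algebroidD(3)[OF alg] p tM by blast
    note P_iff = prolongation_iff[where \<rho> = \<rho> and p = p, OF A V c t eC[unfolded e_eq] \<rho>]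
    note TV = triv_at_tangent[OF TE C[OF c] eC]
    have coord: "coord_vec ?EA ?C e h \<in> tangent_space ?EA e" "coord_vec ?EA ?C e h ?C = h" for h
      by (rule coord_vec_in_tangent_space[OF TE C[OF c] eC], rule coord_vec_same_chart[OF TE C[OF c] eC])
    \<comment> \<open>Summing the anchor coefficients against the coordinate vectors recovers the
      anchor of the basis section, so the two entries of \<open>prol_z\<close> satisfy the condition
      that defines the prolongation.\<close>
    have zc: "(\<Sum>i\<in>UNIV. anchor_coeff V \<rho> c t i a p *\<^sub>R coord_vec ?EA ?C e (axis i 1, 0)) ?C =
        (\<rho> p (basis_section V t a p) c, 0)" for a
    proof -
      have "(\<Sum>i\<in>UNIV. anchor_coeff V \<rho> c t i a p *\<^sub>R coord_vec ?EA ?C e (axis i 1, 0)) ?C =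
          (\<Sum>i\<in>UNIV. anchor_coeff V \<rho> c t i a p *\<^sub>R (axis i 1, 0))"
        by (rule triv_sum[OF TV coord(1), unfolded tangent_triv_def snd_conv coord(2)])
      then show ?thesis
        using basis_expansion[of "\<rho> p (basis_section V t a p) c"]
        by (simp add: prod_eq_iff fst_sum snd_sum anchor_coeff_def scalar_mult_eq_scaleR)
    qed
    have z_in: "prol_z A V B \<rho> c t a e \<in> ?P e" for a
    proof -
      have "(\<Sum>i\<in>UNIV. anchor_coeff V \<rho> c t i a p *\<^sub>R coord_vec ?EA ?C e (axis i 1, 0)) \<in> tangent_space ?EA e"
        by (intro subspace_sum subspace_scale subspace_tangent_space[OF TE] coord)
      then show ?thesis
        using zc[of a] triv_vec_in[OF tp]
        by (simp add: prol_z_def e_eq P_iff basis_section_def)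
    qed
    have z_T: "snd (?T c) e (prol_z A V B \<rho> c t a e) = (axis a 1, 0)" for a
      using zc[of a] by (simp add: snd_prol_triv prol_z_def e_eq basis_section_def triv_triv_vec[OF tp])
    have v_in: "prol_v A V B c t a e \<in> ?P e" for a
    proof -
      have "\<rho> p 0 = 0"
        using \<rho> subspace_0[OF triv_at_subspace[OF tp]] unfolding linear_between_def
        by (metis scaleR_zero_left)
      then show ?thesis
        using coord[of "(0, axis a 1)"]
        by (simp add: prol_v_def e_eq P_iff subspace_0[OF triv_at_subspace[OF tp]])
    qed
    have v_T: "snd (?T c) e (prol_v A V B c t a e) = (0, axis a 1)" for a
      using triv_zero_iff[OF tp subspace_0[OF triv_at_subspace[OF tp]]] coord(2)
      by (simp add: snd_prol_triv prol_v_def e_eq)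
    let ?s = "\<lambda>a. \<Sum>b\<in>UNIV. la_N_at V \<rho> br l c t b a e *\<^sub>R prol_v A V B c t b e"
    have s: "?s a \<in> ?P e" for a
      by (intro subspace_sum[OF P] subspace_scale[OF P] v_in)
    have s_T: "snd (?T c) e (?s a) = (0, ?N *v axis a 1)" for a
      unfolding triv_sum[OF tr v_in] v_T
      by (simp add: prod_eq_iff fst_sum snd_sum la_connection_def flip: matrix_column_sum)
    have v: "la_v A V B c t a e \<in> ?P e" "snd (?T c) e (la_v A V B c t a e) = (0, axis a 1)" for a
      unfolding la_v_def by (rule v_in, rule v_T)
    have z: "la_z A V B \<rho> br l c t a e \<in> ?P e"
      "snd (?T c) e (la_z A V B \<rho> br l c t a e) = (axis a 1, - (?N *v axis a 1))" for a
    proof -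
      have eq: "la_z A V B \<rho> br l c t a e = prol_z A V B \<rho> c t a e + - ?s a" by (simp add: la_z_def)
      show "la_z A V B \<rho> br l c t a e \<in> ?P e"
        unfolding eq by (intro subspace_add[OF P] subspace_neg[OF P] z_in s)
      show "snd (?T c) e (la_z A V B \<rho> br l c t a e) = (axis a 1, - (?N *v axis a 1))"
        unfolding eq triv_add[OF tr z_in subspace_neg[OF P s]] triv_minus[OF tr s] z_T s_T by simp
    qed
    note F' = F_in[OF e(1)] F_T[OF c e(1) eT]
    have "F e (la_z A V B \<rho> br l c t a e) = - la_v A V B c t a e" for a
      by (rule adapted_frame(1)[OF tr v z F'])
    moreover have "F e (la_v A V B c t a e) = la_z A V B \<rho> br l c t a e" for a
      by (rule adapted_frame(2)[OF tr v z F'])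
    moreover have "F e X = - (\<Sum>a\<in>UNIV. la_z_dual t a e X *\<^sub>R la_v A V B c t a e)
        + (\<Sum>a\<in>UNIV. la_v_dual V \<rho> br l c t a e X *\<^sub>R la_z A V B \<rho> br l c t a e)" if "X \<in> ?P e" for X
      using adapted_frame(3)[OF tr v z F' that]
      by (simp add: la_z_dual_def la_v_dual_def prol_z_dual_def prol_v_dual_def snd_prol_triv
          matrix_vector_mult_def la_connection_def)
    ultimately show ?thesis by blast
  qed
  then show ?thesis using F by blast
qed

theorem proposition4p2:
  fixes M :: "'m set" and A :: "('m, real^'n) chart set"
    and L :: "'m \<times> ('m, real^'n) tvec \<Rightarrow> real"
    and Q :: "'q set" and D :: "('q, real^'d) chart set"
    and V :: "'q \<Rightarrow> 'v::real_vector set" and B :: "('q, 'v, real^'r) triv set"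
    and \<rho> :: "'q \<Rightarrow> 'v \<Rightarrow> ('q, real^'d) tvec"
    and br :: "'q set \<Rightarrow> ('q \<Rightarrow> 'v) \<Rightarrow> ('q \<Rightarrow> 'v) \<Rightarrow> ('q \<Rightarrow> 'v)"
    and l :: "'q \<times> 'v \<Rightarrow> real"
  shows "
    (smooth_manifold M A \<and>
     regular_lagrangian (tangent_atlas A) (slit_total M (tangent_space A)) L \<longrightarrow>
     (\<exists>F. almost_complex_structure (tangent_atlas A) (slit_total M (tangent_space A))
            (tangent_space (tangent_atlas A)) (tangent_triv ` tangent_atlas A) F \<and>
          (\<forall>c\<in>A. \<forall>w \<in> slit_total M (tangent_space A). fst w \<in> fst c \<longrightarrow>
             (\<forall>i. F w (tm_e A L c i w) = - tm_v A c i w \<and>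
                  F w (tm_v A c i w) = tm_e A L c i w) \<and>
             (\<forall>X \<in> tangent_space (tangent_atlas A) w.
                F w X = - (\<Sum>i\<in>UNIV. tm_e_dual A c i w X *\<^sub>R tm_v A c i w)
                        + (\<Sum>i\<in>UNIV. tm_v_dual A L c i w X *\<^sub>R tm_e A L c i w)))))
    \<and>
    (lie_algebroid Q D V B \<rho> br \<and>
     regular_lagrangian (bundle_atlas D V B) (slit_total Q V) l \<longrightarrow>
     (\<forall>t\<in>B.
      \<exists>F. almost_complex_structure (bundle_atlas D V B) (slit_total (fst t) V)
            (prolongation D V B \<rho>) (prol_trivs D V B) F \<and>
          (\<forall>c\<in>D. \<forall>e \<in> slit_total (fst t) V. fst e \<in> fst c \<longrightarrow>
             (\<forall>a. F e (la_z D V B \<rho> br l c t a e) = - la_v D V B c t a e \<and>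
                  F e (la_v D V B c t a e) = la_z D V B \<rho> br l c t a e) \<and>
             (\<forall>X \<in> prolongation D V B \<rho> e.
                F e X = - (\<Sum>a\<in>UNIV. la_z_dual t a e X *\<^sub>R la_v D V B c t a e)
                        + (\<Sum>a\<in>UNIV. la_v_dual V \<rho> br l c t a e X *\<^sub>R la_z D V B \<rho> br l c t a e)))))"
proof (intro conjI impI ballI; elim conjE)
  assume "smooth_manifold M A"
  then have "smooth_atlas M A" by (simp add: smooth_manifold_def)
  moreover assume "regular_lagrangian (tangent_atlas A) (slit_total M (tangent_space A)) L"
  ultimately show "\<exists>F. almost_complex_structure (tangent_atlas A) (slit_total M (tangent_space A))
            (tangent_space (tangent_atlas A)) (tangent_triv ` tangent_atlas A) F \<and>
          (\<forall>c\<in>A. \<forall>w \<in> slit_total M (tangent_space A). fst w \<in> fst c \<longrightarrow>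
             (\<forall>i. F w (tm_e A L c i w) = - tm_v A c i w \<and>
                  F w (tm_v A c i w) = tm_e A L c i w) \<and>
             (\<forall>X \<in> tangent_space (tangent_atlas A) w.
                F w X = - (\<Sum>i\<in>UNIV. tm_e_dual A c i w X *\<^sub>R tm_v A c i w)
                        + (\<Sum>i\<in>UNIV. tm_v_dual A L c i w X *\<^sub>R tm_e A L c i w)))"
    by (rule tangent_almost_complex_structure)
qed (rule prolongation_almost_complex_structure)

end
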